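(* Let $d,N\ge1$ and let $\varphi_j(s)=c_{0,j}s+\psi_j(s)$, $j=1,\dots,N$, be symbols in $\mathcal G$ such that each $\psi_j$ involves only the first $d$ prime numbers. Assume that each Bohr lift $\mathcal B\psi_j$ extends to a $\mathcal C^2$-function on $\overline{\mathbb D}^d$ and that $\mathrm{char}(\varphi_1)>0$. Let $\lambda_1,\dots,\lambda_N$ be complex numbers such that $\sum_{j=1}^N\lambda_jC_{\varphi_j}$ is compact on $\mathcal H$. Let $z\in\Gamma(\mathcal B\psi_1)$ and let $\mathcal J$ be the set of $j\in\{1,\dots,N\}$ such that $\mathcal B\psi_j$ and $\mathcal B\psi_1$ have the same second order boundary data at $z$. Then $$\sum_{j\in\mathcal J}\lambda_j=0.$$
   Context: For $\theta\in\mathbb R$, $\mathbb C_\theta=\{s\in\mathbb C:\ \mathrm{Re}\, s>\theta\}$, $\mathbb C_+=\mathbb C_0$; $\mathbb D$ is the open unit disc, $\mathbb T$ the unit circle. $\mathcal H$ is the Hilbert space of Dirichlet series $f(s)=\sum_{n\ge1}a_nn^{-s}$ with $\|f\|^2=\sum_n|a_n|^2<\infty$; its elements are analytic on $\mathbb C_{1/2}$. The Gordon-Hedenmalm class $\mathcal G$ is the set of maps $\varphi:\mathbb C_{1/2}\to\mathbb C_{1/2}$ of the form $\varphi(s)=c_0s+\psi(s)$, where $c_0=:\mathrm{char}(\varphi)$ is a non-negative integer (the characteristic of $\varphi$) and $\psi(s)=\sum_{n\ge1}c_nn^{-s}$ converges uniformly in $\mathbb C_\varepsilon$ for every $\varepsilon>0$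 and satisfies: (a) if $c_0=0$, then $\psi(\mathbb C_0)\subseteq\mathbb C_{1/2}$; (b) if $c_0\ge1$, then either $\psi\equiv c_1$ with $\mathrm{Re}\,c_1\ge0$ or $\psi(\mathbb C_0)\subseteq\mathbb C_0$. These are exactly the analytic self-maps $\varphi$ of $\mathbb C_{1/2}$ for which $C_\varphi f=f\circ\varphi$ defines a bounded operator on $\mathcal H$. Let $p_1<p_2<\cdots$ be the primes. A Dirichlet series $\psi(s)=\sum_nc_nn^{-s}$ involves only the first $d$ primes if $c_n=0$ unless $n=p_1^{\alpha_1}\cdots p_d^{\alpha_d}$ with $\alpha\in\mathbb N_0^d$. Its Bohr lift is the holomorphic function on $\mathbb D^d$ given by $\mathcal B\psi(z)=\sum_{n=p_1^{\alpha_1}\cdots p_d^{\alpha_d}}c_n\,z_1^{\alpha_1}\cdots z_d^{\alpha_d}$. For $\varphi=c_0s+\psi\in\mathcal G$, $\mathcal B\psi$ takes values in $\overline{\mathbb C_+}$. For $F,G:\overline{\mathbb D}^d\to\overline{\mathbb C_+}$ of class $\mathcal C^2$ (here holomorphic in $\mathbb D^d$) and $\xi\in\mathbb T^d$, $F$ and $G$ have the same second order boundary data at $\xi$ if $F(\xi)=G(\xi)$ and $\partial_\alpha F(\xi)=\partial_\alpha G(\xi)$ for all multi-indices $\alpha\in\mathbb N_0^d$ with $|\alpha|\le2$. Also $\Gamma(F)=\{z\in\mathbb T^d:\ \mathrm{Re}\,F(z)=0\}$. *)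

theory Defs
  imports "HOL-Analysis.Analysis" "HOL-Computational_Algebra.Primes" "HOL-Library.Infinite_Set"
begin

definition right_half_plane :: "real \<Rightarrow> complex set" where
  "right_half_plane \<theta> = {s. \<theta> < Re s}"

text \<open>Coefficient sequences are indexed by all of \<^typ>\<open>nat\<close>; since \<open>0 powr z = 0\<close>, the
  coefficient at index \<open>0\<close> does not contribute, and the series starts at \<open>n = 1\<close>.\<close>

definition dirichlet_series :: "(nat \<Rightarrow> complex) \<Rightarrow> complex \<Rightarrow> complex" where
  "dirichlet_series c s = (\<Sum>n. c n * of_nat n powr (- s))"


subsection \<open>The Hilbert space of Dirichlet series with square summable coefficients\<close>

typedef hilbert_dirichlet =
  "{a :: nat \<Rightarrow> complex. a 0 = 0 \<and> summable (\<lambda>n. (cmod (a n))\<^sup>2)}"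
  morphisms dcoeff Abs_hilbert_dirichlet
  by (rule exI[of _ "\<lambda>_. 0"]) simp

lemma dcoeff_0: "dcoeff f 0 = 0"
  and summable_dcoeff: "summable (\<lambda>n. (cmod (dcoeff f n))\<^sup>2)"
  using dcoeff[of f] by auto

lemma dcoeff_eqI: "(\<And>n. dcoeff f n = dcoeff g n) \<Longrightarrow> f = g"
  by (metis dcoeff_inject ext)

lemma summable_dcoeff_inner: "summable (\<lambda>n. dcoeff f n \<bullet> dcoeff g n)"
proof (rule summable_comparison_test')
  show "summable (\<lambda>n. (cmod (dcoeff f n))\<^sup>2 + (cmod (dcoeff g n))\<^sup>2)"
    by (intro summable_add summable_dcoeff)
  fix n :: nat
  have "\<bar>dcoeff f n \<bullet> dcoeff g n\<bar> \<le> cmod (dcoeff f n) * cmod (dcoeff g n)"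
    by (rule Cauchy_Schwarz_ineq2)
  also have "\<dots> \<le> (cmod (dcoeff f n))\<^sup>2 + (cmod (dcoeff g n))\<^sup>2"
    using sum_squares_bound[of "cmod (dcoeff f n)" "cmod (dcoeff g n)"]
      mult_nonneg_nonneg[OF norm_ge_zero[of "dcoeff f n"] norm_ge_zero[of "dcoeff g n"]]
    by linarith
  finally show "norm (dcoeff f n \<bullet> dcoeff g n)
      \<le> (cmod (dcoeff f n))\<^sup>2 + (cmod (dcoeff g n))\<^sup>2"
    by simp
qed

instantiation hilbert_dirichlet :: real_inner
begin

definition "0 = Abs_hilbert_dirichlet (\<lambda>_. 0)"
definition "f + g = Abs_hilbert_dirichlet (\<lambda>n. dcoeff f n + dcoeff g n)"
definition "- f = Abs_hilbert_dirichlet (\<lambda>n. - dcoeff f n)"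
definition "(f::hilbert_dirichlet) - g = f + - g"
definition "r *\<^sub>R f = Abs_hilbert_dirichlet (\<lambda>n. r *\<^sub>R dcoeff f n)"
definition "f \<bullet> g = (\<Sum>n. dcoeff f n \<bullet> dcoeff g n)"
definition "norm f = sqrt (\<Sum>n. (cmod (dcoeff f n))\<^sup>2)"
definition "sgn (f::hilbert_dirichlet) = inverse (norm f) *\<^sub>R f"
definition "dist (f::hilbert_dirichlet) g = norm (f - g)"
definition "(uniformity :: (hilbert_dirichlet \<times> hilbert_dirichlet) filter) =
  (INF e\<in>{0<..}. principal {(x, y). dist x y < e})"
definition "open (U :: hilbert_dirichlet set) \<longleftrightarrow>
  (\<forall>x\<in>U. eventually (\<lambda>(x', y). x' = x \<longrightarrow> y \<in> U) uniformity)"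

lemma dcoeff_zero: "dcoeff 0 n = 0"
  by (simp add: zero_hilbert_dirichlet_def Abs_hilbert_dirichlet_inverse)

lemma dcoeff_add: "dcoeff (f + g) n = dcoeff f n + dcoeff g n"
proof -
  have "summable (\<lambda>n. (cmod (dcoeff f n + dcoeff g n))\<^sup>2)"
  proof -
    have "(\<lambda>n. (cmod (dcoeff f n + dcoeff g n))\<^sup>2) =
      (\<lambda>n. (cmod (dcoeff f n))\<^sup>2 + 2 * (dcoeff f n \<bullet> dcoeff g n) + (cmod (dcoeff g n))\<^sup>2)"
      by (auto simp: power2_norm_eq_inner inner_add inner_commute)
    then show ?thesis
      by (simp only:) (intro summable_add summable_mult summable_dcoeff summable_dcoeff_inner)
  qed
  then show ?thesis
    by (simp add: plus_hilbert_dirichlet_def Abs_hilbert_dirichlet_inverse dcoeff_0)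
qed

lemma dcoeff_uminus: "dcoeff (- f) n = - dcoeff f n"
  by (simp add: uminus_hilbert_dirichlet_def Abs_hilbert_dirichlet_inverse dcoeff_0 summable_dcoeff)

lemma dcoeff_scaleR: "dcoeff (r *\<^sub>R f) n = r *\<^sub>R dcoeff f n"
  using summable_mult[OF summable_dcoeff[of f], of "r\<^sup>2"]
  by (simp add: scaleR_hilbert_dirichlet_def Abs_hilbert_dirichlet_inverse dcoeff_0 norm_mult
      power_mult_distrib)

instance
proof
  fix f g h :: hilbert_dirichlet and r q :: real
  note dc = dcoeff_zero dcoeff_add dcoeff_uminus dcoeff_scaleR
  show "f + g + h = f + (g + h)" "f + g = g + f" "0 + f = f" "- f + f = 0" "f - g = f + - g"
    "r *\<^sub>R (f + g) = r *\<^sub>R f + r *\<^sub>R g" "(r + q) *\<^sub>R f = r *\<^sub>R f + q *\<^sub>R f"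
    "r *\<^sub>R q *\<^sub>R f = (r * q) *\<^sub>R f" "1 *\<^sub>R f = f"
    by (auto intro!: dcoeff_eqI simp: dc minus_hilbert_dirichlet_def algebra_simps)
  show "dist f g = norm (f - g)" "sgn f = inverse (norm f) *\<^sub>R f"
    "(uniformity :: (hilbert_dirichlet \<times> hilbert_dirichlet) filter) =
      (INF e\<in>{0<..}. principal {(x, y). dist x y < e})"
    by (rule dist_hilbert_dirichlet_def sgn_hilbert_dirichlet_def
        uniformity_hilbert_dirichlet_def)+
  show "open U \<longleftrightarrow> (\<forall>x\<in>U. eventually (\<lambda>(x', y). x' = x \<longrightarrow> y \<in> U) uniformity)"
    for U :: "hilbert_dirichlet set"
    by (rule open_hilbert_dirichlet_def)
  show "f \<bullet> g = g \<bullet> f"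
    by (simp add: inner_hilbert_dirichlet_def inner_commute)
  show "(f + g) \<bullet> h = f \<bullet> h + g \<bullet> h"
    by (simp add: inner_hilbert_dirichlet_def dc inner_add_left suminf_add summable_dcoeff_inner)
  show "r *\<^sub>R f \<bullet> g = r * (f \<bullet> g)"
    by (simp add: inner_hilbert_dirichlet_def dc suminf_mult summable_dcoeff_inner)
  show "0 \<le> f \<bullet> f"
    by (simp add: inner_hilbert_dirichlet_def suminf_nonneg summable_dcoeff_inner)
  show "f \<bullet> f = 0 \<longleftrightarrow> f = 0"
  proof
    assume "f \<bullet> f = 0"
    then have "\<forall>n. dcoeff f n \<bullet> dcoeff f n = 0"
      using suminf_eq_zero_iff[OF summable_dcoeff_inner[of f f]]
      by (simp add: inner_hilbert_dirichlet_def)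
    then show "f = 0"
      by (auto intro!: dcoeff_eqI simp: dc)
  qed (simp add: inner_hilbert_dirichlet_def dc)
  show "norm f = sqrt (f \<bullet> f)"
    by (simp add: norm_hilbert_dirichlet_def inner_hilbert_dirichlet_def power2_norm_eq_inner)
qed

end

text \<open>An element of the space as an analytic function on \<open>right_half_plane (1/2)\<close>.\<close>

definition hd_eval :: "hilbert_dirichlet \<Rightarrow> complex \<Rightarrow> complex" where
  "hd_eval f = dirichlet_series (dcoeff f)"


subsection \<open>Composition operators and compactness\<close>

definition composition :: "(complex \<Rightarrow> complex) \<Rightarrow> hilbert_dirichlet \<Rightarrow> complex \<Rightarrow> complex" where
  "composition \<phi> f = hd_eval f \<circ> \<phi>"

definition compact_operator :: "('a::real_normed_vector \<Rightarrow> 'b::real_normed_vector) \<Rightarrow> bool" where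
  "compact_operator T \<longleftrightarrow> linear T \<and> compact (closure (T ` cball 0 1))"

text \<open>\<open>L\<close> sends elements of the space to functions, of which only the values on
  \<open>right_half_plane (1/2)\<close> matter. It is compact on the space if it maps the space into itself
  and is compact there. The witness \<open>T\<close> is unique, because a function has at most one
  Dirichlet series expansion.\<close>

definition compact_on_hilbert_dirichlet ::
  "(hilbert_dirichlet \<Rightarrow> complex \<Rightarrow> complex) \<Rightarrow> bool" where
  "compact_on_hilbert_dirichlet L \<longleftrightarrow>
    (\<exists>T :: hilbert_dirichlet \<Rightarrow> hilbert_dirichlet.
      (\<forall>f. \<forall>s\<in>right_half_plane (1/2). hd_eval (T f) s = L f s) \<and> compact_operator T)"


subsection \<open>The Gordon--Hedenmalm class\<close>

text \<open>\<open>gordon_hedenmalm \<phi> c0 c\<close>: the map \<open>\<phi>\<close>, considered on \<open>right_half_plane (1/2)\<close> only, belongs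
  to the class, has characteristic \<open>c0\<close>, and its Dirichlet series part has coefficients \<open>c\<close>.\<close>

definition gordon_hedenmalm :: "(complex \<Rightarrow> complex) \<Rightarrow> nat \<Rightarrow> (nat \<Rightarrow> complex) \<Rightarrow> bool" where
  "gordon_hedenmalm \<phi> c0 c \<longleftrightarrow>
    \<phi> ` right_half_plane (1/2) \<subseteq> right_half_plane (1/2) \<and>
    (\<forall>s\<in>right_half_plane (1/2). \<phi> s = of_nat c0 * s + dirichlet_series c s) \<and>
    (\<forall>\<epsilon>>0. uniformly_convergent_on (right_half_plane \<epsilon>)
      (\<lambda>M s. \<Sum>n=1..M. c n * of_nat n powr (- s))) \<and>
    (c0 = 0 \<longrightarrow> dirichlet_series c ` right_half_plane 0 \<subseteq> right_half_plane (1/2)) \<and>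
    (c0 \<ge> 1 \<longrightarrow>
      (\<forall>s\<in>right_half_plane 0. dirichlet_series c s = c 1) \<and> Re (c 1) \<ge> 0 \<or>
      dirichlet_series c ` right_half_plane 0 \<subseteq> right_half_plane 0)"


subsection \<open>The Bohr lift\<close>

text \<open>Primes, coordinates and multi-indices are indexed from \<open>0\<close>. Points of $d$-dimensional complex
  space are the functions in \<open>{..<d} \<rightarrow>\<^sub>E UNIV\<close>, whose topology as a subspace of
  \<^typ>\<open>nat \<Rightarrow> complex\<close> (with the product topology) is the Euclidean one.\<close>

definition nth_prime :: "nat \<Rightarrow> nat" where
  "nth_prime i = enumerate {p. prime p} i"

definition involves_first_primes :: "nat \<Rightarrow> (nat \<Rightarrow> complex) \<Rightarrow> bool" where
  "involves_first_primes d c \<longleftrightarrow>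
    (\<forall>n\<ge>1. (\<nexists>\<alpha>. n = (\<Prod>i<d. nth_prime i ^ \<alpha> i)) \<longrightarrow> c n = 0)"

definition bohr_lift :: "nat \<Rightarrow> (nat \<Rightarrow> complex) \<Rightarrow> (nat \<Rightarrow> complex) \<Rightarrow> complex" where
  "bohr_lift d c z =
    (\<Sum>\<^sub>\<infinity>\<alpha>\<in>{..<d} \<rightarrow>\<^sub>E UNIV. c (\<Prod>i<d. nth_prime i ^ \<alpha> i) * (\<Prod>i<d. z i ^ \<alpha> i))"

definition polydisc :: "nat \<Rightarrow> (nat \<Rightarrow> complex) set" where
  "polydisc d = {..<d} \<rightarrow>\<^sub>E ball 0 1"

definition closed_polydisc :: "nat \<Rightarrow> (nat \<Rightarrow> complex) set" where
  "closed_polydisc d = {..<d} \<rightarrow>\<^sub>E cball 0 1"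

definition torus :: "nat \<Rightarrow> (nat \<Rightarrow> complex) set" where
  "torus d = {..<d} \<rightarrow>\<^sub>E sphere 0 1"


subsection \<open>Regularity up to the boundary and boundary data\<close>

definition extends_continuously :: "nat \<Rightarrow> ((nat \<Rightarrow> complex) \<Rightarrow> complex) \<Rightarrow> bool" where
  "extends_continuously d F \<longleftrightarrow>
    (\<exists>G. continuous_on (closed_polydisc d) G \<and> (\<forall>z\<in>polydisc d. G z = F z))"

text \<open>The continuous extension to the closed polydisc, when there is one.\<close>

definition boundary_ext ::
  "nat \<Rightarrow> ((nat \<Rightarrow> complex) \<Rightarrow> complex) \<Rightarrow> (nat \<Rightarrow> complex) \<Rightarrow> complex" where
  "boundary_ext d F z = Lim (at z within polydisc d) F"

text \<open>For \<open>v = 1\<close> and \<open>v = \<i>\<close> these are the real partial derivatives with respect to the real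
  and the imaginary part of the \<open>i\<close>-th coordinate.\<close>

definition line_map ::
  "nat \<Rightarrow> complex \<Rightarrow> ((nat \<Rightarrow> complex) \<Rightarrow> complex) \<Rightarrow> (nat \<Rightarrow> complex) \<Rightarrow> real \<Rightarrow> complex" where
  "line_map i v F z t = F (z(i := z i + of_real t * v))"

definition real_partial ::
  "nat \<Rightarrow> complex \<Rightarrow> ((nat \<Rightarrow> complex) \<Rightarrow> complex) \<Rightarrow> (nat \<Rightarrow> complex) \<Rightarrow> complex" where
  "real_partial i v F z = vector_derivative (line_map i v F z) (at 0)"

text \<open>A function on the open polydisc extends to a \<open>k\<close> times continuously differentiable function on
  the closed polydisc if all its real partial derivatives of order at most \<open>k\<close> exist in the open
  polydisc and extend continuously to the closed one.\<close>

primrec extends_C :: "nat \<Rightarrow> nat \<Rightarrow> ((nat \<Rightarrow> complex) \<Rightarrow> complex) \<Rightarrow> bool" where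
  "extends_C d 0 F \<longleftrightarrow> extends_continuously d F"
| "extends_C d (Suc k) F \<longleftrightarrow> extends_continuously d F \<and>
    (\<forall>i<d. \<forall>v\<in>{1, \<i>}. (\<forall>z\<in>polydisc d. line_map i v F z differentiable (at 0)) \<and>
      extends_C d k (real_partial i v F))"

text \<open>Complex partial derivatives of a function holomorphic in the open polydisc.\<close>

definition complex_partial ::
  "nat \<Rightarrow> ((nat \<Rightarrow> complex) \<Rightarrow> complex) \<Rightarrow> (nat \<Rightarrow> complex) \<Rightarrow> complex" where
  "complex_partial i F z = deriv (\<lambda>w. F (z(i := w))) (z i)"

definition multi_partial ::
  "nat \<Rightarrow> (nat \<Rightarrow> nat) \<Rightarrow> ((nat \<Rightarrow> complex) \<Rightarrow> complex) \<Rightarrow> (nat \<Rightarrow> complex) \<Rightarrow> complex" where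
  "multi_partial d \<alpha> F = fold (\<lambda>i. complex_partial i ^^ \<alpha> i) [0..<d] F"

text \<open>Both functions are given on the open polydisc. Values at boundary points, of the functions and
  of their derivatives, are those of the continuous extensions. The case \<open>\<alpha> = 0\<close> is equality of the
  functions themselves at \<open>\<xi>\<close>.\<close>

definition same_second_order_data ::
  "nat \<Rightarrow> ((nat \<Rightarrow> complex) \<Rightarrow> complex) \<Rightarrow> ((nat \<Rightarrow> complex) \<Rightarrow> complex) \<Rightarrow>
    (nat \<Rightarrow> complex) \<Rightarrow> bool" where
  "same_second_order_data d F G \<xi> \<longleftrightarrow>
    (\<forall>\<alpha>\<in>{..<d} \<rightarrow>\<^sub>E UNIV. (\<Sum>i<d. \<alpha> i) \<le> 2 \<longrightarrow>
      boundary_ext d (multi_partial d \<alpha> F) \<xi> = boundary_ext d (multi_partial d \<alpha> G) \<xi>)"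

definition boundary_zero_set ::
  "nat \<Rightarrow> ((nat \<Rightarrow> complex) \<Rightarrow> complex) \<Rightarrow> (nat \<Rightarrow> complex) set" where
  "boundary_zero_set d F = {z \<in> torus d. Re (boundary_ext d F z) = 0}"

end

theory Submission
  imports Defs "HOL-Complex_Analysis.Complex_Analysis" "HOL-Real_Asymp.Real_Asymp"
begin

text \<open>The operator is tested on kernels that involve finitely many primes. For \<open>D \<ge> d\<close>, it
preserves the space of square summable Dirichlet series supported on the integers without prime
factors beyond the first \<open>D\<close> primes (\<open>smooth_supported_T\<close>). On this space the evaluation at \<open>s\<close>
is bounded for all \<open>s\<close> with positive real part, and not only to the right of \<open>1/2\<close>; the square of its
norm is the finite Euler product \<open>E(2 Re s)\<close>, where \<open>E(w)\<close> is the product of \<open>1 / (1 - p powr (- w))\<close>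
over the first \<open>D\<close> primes. This is what makes the boundary points of the Bohr lifts on the torus
visible. Fix \<open>m\<close> with positive characteristic for which the real part of the Bohr lift vanishes at \<open>z\<close>,
and let \<open>s\<^sub>n\<close> be such that the \<open>m\<close>-th symbol \<open>\<Psi>\<^sub>m(s\<^sub>n)\<close> approaches the imaginary axis. The normalised kernels at
\<open>\<Psi>\<^sub>m(s\<^sub>n)\<close> tend to zero pointwise, so compactness sends their images to zero in norm, along a
subsequence. Dividing the values of the images at \<open>s\<^sub>n\<close> by the norm of the evaluation gives
(\<open>kernel_combination_null\<close>) that the sum over \<open>j\<close> of
\<open>\<lambda>\<^sub>j E(\<Psi>\<^sub>j(s\<^sub>n) + cnj (\<Psi>\<^sub>m(s\<^sub>n))) / sqrt (E(2 Re \<Psi>\<^sub>m(s\<^sub>n)) E(2 Re s\<^sub>n))\<close> tends to zero.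

The points are chosen on a parabolic scale. By Kronecker's theorem there are \<open>s\<^sub>n = \<delta>\<^sup>2 + \<i> t\<close>, where
\<open>\<delta>\<close> tends to zero, for which the point with coordinates \<open>p\<^sub>i powr (- s\<^sub>n)\<close> is
\<open>z\<^sub>i exp (\<i> \<delta> \<theta>\<^sub>i - \<delta>\<^sup>2 ln p\<^sub>i)\<close> up to \<open>o(\<delta>\<^sup>2)\<close>, with any prescribed real direction \<open>\<theta>\<close>
(\<open>approach_sequence\<close>). The displacement is of order \<open>\<delta>\<close> along the torus and of order \<open>\<delta>\<^sup>2\<close> across it.
The real part of the \<open>m\<close>-th Bohr lift is nonnegative and vanishes at \<open>z\<close>, so its tangential first
derivatives vanish there, and the real part of \<open>\<Psi>\<^sub>m(s\<^sub>n)\<close> is asymptotic to \<open>A \<delta>\<^sup>2\<close> with \<open>A \<ge> 1\<close>. The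
second order expansions of the other lifts enter on the same scale. If \<open>\<Psi>\<^sub>j\<close> and \<open>\<Psi>\<^sub>m\<close> have the same
characteristic and their lifts agree at \<open>z\<close> up to terms of order \<open>\<delta>\<close>, then
\<open>\<Psi>\<^sub>j(s\<^sub>n) + cnj (\<Psi>\<^sub>m(s\<^sub>n))\<close> is asymptotic to \<open>\<kappa>\<^sub>j \<delta>\<^sup>2\<close> for some nonzero \<open>\<kappa>\<^sub>j\<close> and the \<open>j\<close>-th quotient tends to
\<open>x\<^sub>j ^ D\<close>, where \<open>x\<^sub>j = 2 sqrt A / \<kappa>\<^sub>j\<close>. Otherwise one Euler factor is too small and the quotient tends to
zero; then \<open>x\<^sub>j\<close> is set to zero (\<open>term_limit\<close>).

Hence the sum of \<open>\<lambda>\<^sub>j x\<^sub>j ^ D\<close> over \<open>j\<close> is zero for every \<open>D > d\<close>, and polynomial interpolation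
(\<open>equal_power_sums_class\<close>) isolates the \<open>j\<close> with \<open>x\<^sub>j = x\<^sub>m\<close>. For a generic direction \<open>\<theta>\<close>, and a generic
limit of \<open>p powr (- \<i> t)\<close> for the first prime \<open>p\<close> that the symbols do not involve, these are exactly the
\<open>j\<close> with the characteristic of \<open>\<Psi>\<^sub>m\<close> and the second order data of its lift (\<open>data_class_sum_zero\<close>).
The symbols whose lifts have the data of the first one may have several characteristics; each value
occurs for a symbol that can serve as \<open>\<Psi>\<^sub>m\<close>, and the sums for the different values are added.\<close>

section \<open>Primes and smooth numbers\<close>

abbreviation log_prime :: "nat \<Rightarrow> real" where
  "log_prime i \<equiv> ln (real (nth_prime i))"

lemma prime_nth_prime: "prime (nth_prime i)"
  using enumerate_in_set[OF primes_infinite, of i] by (simp add: nth_prime_def)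

lemma inj_nth_prime: "inj nth_prime"
  using strict_mono_imp_inj_on[OF strict_mono_enumerate[OF primes_infinite], of UNIV]
  by (simp add: nth_prime_def[abs_def])

lemma prime_eq_nth_prime: "prime q \<Longrightarrow> \<exists>i. q = nth_prime i"
  using enumerate_Ex[OF _, of "{p. prime p}" q] primes_infinite
  by (auto simp: nth_prime_def)

lemma nth_prime_gt_1: "nth_prime i > 1"
  using prime_gt_1_nat[OF prime_nth_prime] .

lemma ln_nth_prime_pos: "log_prime i > 0"
  using nth_prime_gt_1[of i] by simp

lemma nth_prime_pos: "nth_prime i > 0"
  using nth_prime_gt_1[of i] by simp

lemma ln_prod_nth_prime:
  assumes "finite I"
  shows "ln (real (\<Prod>i\<in>I. nth_prime i ^ f i)) = (\<Sum>i\<in>I. real (f i) * log_prime i)"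
proof -
  have "ln (\<Prod>i\<in>I. real (nth_prime i ^ f i)) = (\<Sum>i\<in>I. ln (real (nth_prime i ^ f i)))"
    using assms nth_prime_pos by (intro ln_prod) simp_all
  thus ?thesis using nth_prime_pos by (simp add: ln_realpow)
qed

lemma multiplicity_nth_prime_prod:
  assumes "finite I"
  shows "multiplicity (nth_prime k) (\<Prod>i\<in>I. nth_prime i ^ f i) = (if k \<in> I then f k else 0)"
proof -
  have "(\<Prod>i\<in>I. nth_prime i ^ f i) = (\<Prod>q\<in>nth_prime ` I. q ^ (f (inv nth_prime q)))"
    by (subst prod.reindex) (auto simp: inj_nth_prime inj_on_subset[OF inj_nth_prime] inv_f_f)
  also have "multiplicity (nth_prime k) \<dots> = (if nth_prime k \<in> nth_prime ` I
      then f (inv nth_prime (nth_prime k)) else 0)"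
    using assms by (intro multiplicity_prod_prime_powers) (auto simp: prime_nth_prime)
  finally show ?thesis
    by (simp add: inj_nth_prime inv_f_f inj_image_mem_iff)
qed

definition smooth_numbers :: "nat \<Rightarrow> nat set" where
  "smooth_numbers D = {n. n > 0 \<and> (\<forall>q. prime q \<longrightarrow> q dvd n \<longrightarrow> q \<in> nth_prime ` {..<D})}"

lemma smooth_numbers_pos: "n \<in> smooth_numbers D \<Longrightarrow> n > 0"
  by (simp add: smooth_numbers_def)

lemma smooth_numbers_mono: "d \<le> D \<Longrightarrow> smooth_numbers d \<subseteq> smooth_numbers D"
  unfolding smooth_numbers_def using image_mono[of "{..<d}" "{..<D}" nth_prime] by auto

lemma prod_primes_in_smooth: "(\<Prod>i<D. nth_prime i ^ f i) \<in> smooth_numbers D"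
proof -
  have "q \<in> nth_prime ` {..<D}" if q: "prime q" "q dvd (\<Prod>i<D. nth_prime i ^ f i)" for q
  proof -
    obtain i where "i < D" "q dvd nth_prime i ^ f i"
      using q prime_dvd_prod_iff[of "{..<D}" q "\<lambda>i. nth_prime i ^ f i"] by auto
    hence "q dvd nth_prime i" using q prime_dvd_power by blast
    hence "q = nth_prime i" using q prime_nth_prime primes_dvd_imp_eq by blast
    thus ?thesis using \<open>i < D\<close> by blast
  qed
  moreover have "(\<Prod>i<D. nth_prime i ^ f i) > 0"
    using nth_prime_pos by (intro prod_pos) simp
  ultimately show ?thesis by (simp add: smooth_numbers_def)
qed

text \<open>Unique factorisation. It turns sums over smooth numbers into sums over exponent vectors, over which
products of one-variable series factor.\<close>

lemma bij_betw_prime_exponents: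
  "bij_betw (\<lambda>\<alpha>. \<Prod>i<D. nth_prime i ^ \<alpha> i) ({..<D} \<rightarrow>\<^sub>E UNIV) (smooth_numbers D)"
proof (rule bij_betwI[where g = "\<lambda>n. \<lambda>i\<in>{..<D}. multiplicity (nth_prime i) n"])
  show "(\<lambda>\<alpha>. \<Prod>i<D. nth_prime i ^ \<alpha> i) \<in> ({..<D} \<rightarrow>\<^sub>E UNIV) \<rightarrow> smooth_numbers D"
    by (simp add: prod_primes_in_smooth)
  show "(\<lambda>n. \<lambda>i\<in>{..<D}. multiplicity (nth_prime i) n) \<in> smooth_numbers D \<rightarrow> {..<D} \<rightarrow>\<^sub>E UNIV"
    by auto
next
  fix \<alpha> :: "nat \<Rightarrow> nat" assume "\<alpha> \<in> {..<D} \<rightarrow>\<^sub>E UNIV"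
  then show "(\<lambda>i\<in>{..<D}. multiplicity (nth_prime i) (\<Prod>i<D. nth_prime i ^ \<alpha> i)) = \<alpha>"
    by (auto simp: fun_eq_iff multiplicity_nth_prime_prod PiE_def extensional_def)
next
  fix n assume n: "n \<in> smooth_numbers D"
  have "(\<Prod>i<D. nth_prime i ^ multiplicity (nth_prime i) n)
      = (\<Prod>q\<in>nth_prime ` {..<D}. q ^ multiplicity q n)"
    by (subst prod.reindex) (auto simp: inj_on_subset[OF inj_nth_prime])
  also have "\<dots> = (\<Prod>q\<in>prime_factors n. q ^ multiplicity q n)"
  proof (rule prod.mono_neutral_right)
    show "prime_factors n \<subseteq> nth_prime ` {..<D}"
      using n by (auto simp: smooth_numbers_def prime_factors_dvd)
    show "\<forall>i\<in>nth_prime ` {..<D} - prime_factors n. i ^ multiplicity i n = 1"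
      by (metis Diff_iff image_iff power_0 prime_factorsI prime_nth_prime
          not_dvd_imp_multiplicity_0 n smooth_numbers_pos less_numeral_extra(3))
  qed simp
  also have "\<dots> = n"
    using prod_prime_factors[of n] n by (simp add: smooth_numbers_def)
  finally show "(\<Prod>i<D. nth_prime i ^ (\<lambda>i\<in>{..<D}. multiplicity (nth_prime i) n) i) = n"
    by simp
qed

lemma involves_first_primes_smooth:
  "involves_first_primes d c \<longleftrightarrow> (\<forall>n\<ge>1. n \<notin> smooth_numbers d \<longrightarrow> c n = 0)"
proof -
  have "(\<exists>\<alpha>. n = (\<Prod>i<d. nth_prime i ^ \<alpha> i)) \<longleftrightarrow> n \<in> smooth_numbers d" for n
  proof
    show "\<exists>\<alpha>. n = (\<Prod>i<d. nth_prime i ^ \<alpha> i) \<Longrightarrow> n \<in> smooth_numbers d"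
      using prod_primes_in_smooth by blast
    show "n \<in> smooth_numbers d \<Longrightarrow> \<exists>\<alpha>. n = (\<Prod>i<d. nth_prime i ^ \<alpha> i)"
      using bij_betw_prime_exponents[of d] by (auto simp: bij_betw_def)
  qed
  thus ?thesis by (auto simp: involves_first_primes_def)
qed

text \<open>Sorting the terms by the sign of their coefficients turns the relation into an equality of two
products of prime powers; comparing the exponents of the \<open>k\<close>-th prime gives
\<open>nat (u k) = nat (- u k)\<close>.\<close>

lemma ln_primes_independent:
  fixes u :: "nat \<Rightarrow> int"
  assumes "finite I" "(\<Sum>i\<in>I. of_int (u i) * log_prime i) = 0" "k \<in> I"
  shows "u k = 0"
proof -
  define P where "P = (\<lambda>f. \<Prod>i\<in>I. nth_prime i ^ f i)"
  have pos: "P f > 0" for f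
    unfolding P_def using nth_prime_pos by (intro prod_pos) simp
  have ln: "ln (real (P f)) = (\<Sum>i\<in>I. real (f i) * log_prime i)" for f
    unfolding P_def using assms(1) by (rule ln_prod_nth_prime)
  have "real_of_int (u i) = real (nat (u i)) - real (nat (- u i))" for i
    by linarith
  hence "(\<Sum>i\<in>I. of_int (u i) * log_prime i)
      = ln (real (P (\<lambda>i. nat (u i)))) - ln (real (P (\<lambda>i. nat (- u i))))"
    unfolding ln by (simp add: sum_subtractf[symmetric] left_diff_distrib)
  hence "ln (real (P (\<lambda>i. nat (u i)))) = ln (real (P (\<lambda>i. nat (- u i))))"
    using assms(2) by simp
  hence "P (\<lambda>i. nat (u i)) = P (\<lambda>i. nat (- u i))"
    using pos by simp
  hence "multiplicity (nth_prime k) (P (\<lambda>i. nat (u i))) = multiplicity (nth_prime k) (P (\<lambda>i. nat (- u i)))"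
    by simp
  hence "nat (u k) = nat (- u k)"
    using assms unfolding P_def by (simp add: multiplicity_nth_prime_prod)
  thus ?thesis by linarith
qed

text \<open>Kronecker's theorem for the frequencies \<open>ln p\<close>, normalised to angles: vertical translation by \<open>t\<close>
moves finitely many of the numbers \<open>p powr (- \<i> t)\<close> to prescribed places on the circle. The error is
kept explicit because a second order expansion has to absorb it.\<close>

lemma kronecker_primes:
  fixes \<theta> :: "nat \<Rightarrow> real"
  assumes "\<epsilon> > 0"
  obtains t where "\<And>i. i < n \<Longrightarrow> \<exists>h::int. \<bar>t * log_prime i - \<theta> i - 2 * pi * h\<bar> < \<epsilon>"
proof -
  interpret Modules.module "(\<lambda>r. (*) (real_of_int r))"
    by (simp add: Modules.module.intro distrib_left mult.commute)
  let ?L = log_prime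
  have inj: "inj ?L"
  proof (rule injI)
    fix i j assume "?L i = ?L j"
    hence "nth_prime i = nth_prime j"
      using nth_prime_gt_1[of i] nth_prime_gt_1[of j] by simp
    thus "i = j" using inj_nth_prime by (simp add: inj_eq)
  qed
  have ind: "independent (?L ` {..<n})"
    unfolding dependent_explicit
  proof safe
    fix T u v assume T: "finite T" "T \<subseteq> ?L ` {..<n}" "(\<Sum>v\<in>T. real_of_int (u v) * v) = 0"
      "v \<in> T" "u v \<noteq> 0"
    obtain I where I: "I \<subseteq> {..<n}" "T = ?L ` I" using T(2) by (meson subset_imageE)
    obtain k where k: "k \<in> I" "v = ?L k" using T I by auto
    have "(\<Sum>i\<in>I. real_of_int (u (?L i)) * ?L i) = 0"
      using T(3) unfolding I(2) by (subst (asm) sum.reindex) (auto simp: inj_on_subset[OF inj])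
    hence "u (?L k) = 0"
      using ln_primes_independent[of I "\<lambda>i. u (?L i)" k] k I finite_subset by auto
    thus False using T k by simp
  qed
  obtain t h where th: "\<And>i. i < n \<Longrightarrow> \<bar>t * ?L i - of_int (h i) - \<theta> i / (2*pi)\<bar> < \<epsilon> / (2*pi)"
    using Kronecker_thm_1[of ?L n "\<epsilon> / (2*pi)" "\<lambda>i. \<theta> i / (2*pi)", OF ind inj_on_subset[OF inj]] assms
    by auto
  have "\<bar>2*pi*t * ?L i - \<theta> i - 2 * pi * (h i)\<bar> < \<epsilon>" if "i < n" for i
  proof -
    have "2*pi*t * ?L i - \<theta> i - 2 * pi * (h i) = 2*pi*(t * ?L i - of_int (h i) - \<theta> i / (2*pi))"
      by (simp add: field_simps)
    hence "\<bar>2*pi*t * ?L i - \<theta> i - 2 * pi * (h i)\<bar> = 2*pi*\<bar>t * ?L i - of_int (h i) - \<theta> i / (2*pi)\<bar>"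
      by (simp add: abs_mult)
    also have "\<dots> < 2*pi*(\<epsilon>/(2*pi))" using th[OF that] by (intro mult_strict_left_mono) auto
    finally show ?thesis by simp
  qed
  thus ?thesis using that by blast
qed

section \<open>Finite Euler products\<close>

text \<open>A finite set of exponent vectors lies in a box, and the sum over a box factors into partial sums of
geometric series.\<close>

lemma summable_geometric_PiE:
  fixes x :: "nat \<Rightarrow> real"
  assumes "\<And>i. i < D \<Longrightarrow> 0 \<le> x i \<and> x i < 1"
  shows "(\<lambda>\<alpha>. \<Prod>i<D. x i ^ \<alpha> i) summable_on ({..<D} \<rightarrow>\<^sub>E UNIV)"
proof (rule nonneg_bdd_above_summable_on)
  show "bdd_above (sum (\<lambda>\<alpha>. \<Prod>i<D. x i ^ \<alpha> i) ` {F. F \<subseteq> {..<D} \<rightarrow>\<^sub>E UNIV \<and> finite F})"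
  proof (rule bdd_aboveI2)
    fix F :: "(nat \<Rightarrow> nat) set" assume F: "F \<in> {F. F \<subseteq> {..<D} \<rightarrow>\<^sub>E UNIV \<and> finite F}"
    define K where "K = Max (insert 0 ((\<lambda>(\<alpha>,i). \<alpha> i) ` (F \<times> {..<D})))"
    have "F \<subseteq> {..<D} \<rightarrow>\<^sub>E {..K}"
    proof
      fix \<alpha> assume a: "\<alpha> \<in> F"
      have "\<alpha> i \<le> K" if "i < D" for i
        unfolding K_def using F a that by (intro Max_ge) force+
      thus "\<alpha> \<in> {..<D} \<rightarrow>\<^sub>E {..K}" using F a by (auto simp: PiE_def)
    qed
    hence "(\<Sum>\<alpha>\<in>F. \<Prod>i<D. x i ^ \<alpha> i) \<le> (\<Sum>\<alpha>\<in>{..<D} \<rightarrow>\<^sub>E {..K}. \<Prod>i<D. x i ^ \<alpha> i)"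
      using assms by (intro sum_mono2 prod_nonneg) (auto intro!: finite_PiE)
    also have "\<dots> = (\<Prod>i<D. \<Sum>k\<le>K. x i ^ k)"
      by (rule prod_sum_PiE[symmetric]) auto
    also have "\<dots> \<le> (\<Prod>i<D. 1 / (1 - x i))"
    proof (rule prod_mono, intro conjI)
      fix i assume "i \<in> {..<D}"
      hence x: "0 \<le> x i" "x i < 1" using assms by auto
      show "0 \<le> (\<Sum>k\<le>K. x i ^ k)" using x by (intro sum_nonneg) auto
      have "(\<Sum>k\<le>K. x i ^ k) \<le> (\<Sum>k. x i ^ k)"
        using x by (intro sum_le_suminf summable_geometric) auto
      thus "(\<Sum>k\<le>K. x i ^ k) \<le> 1 / (1 - x i)" using x by (simp add: suminf_geometric)
    qed
    finally show "(\<Sum>\<alpha>\<in>F. \<Prod>i<D. x i ^ \<alpha> i) \<le> (\<Prod>i<D. 1 / (1 - x i))" .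
  qed
qed (use assms in \<open>auto intro!: prod_nonneg\<close>)

lemma has_sum_geometric_PiE:
  fixes x :: "nat \<Rightarrow> complex"
  assumes x: "\<And>i. i < D \<Longrightarrow> norm (x i) < 1"
  shows "((\<lambda>\<alpha>. \<Prod>i<D. x i ^ \<alpha> i) has_sum (\<Prod>i<D. 1 / (1 - x i))) ({..<D} \<rightarrow>\<^sub>E UNIV)"
proof -
  have "(\<lambda>\<alpha>. norm (\<Prod>i<D. x i ^ \<alpha> i)) summable_on ({..<D} \<rightarrow>\<^sub>E UNIV)"
    using summable_geometric_PiE[of D "\<lambda>i. norm (x i)"] x
    by (simp add: prod_norm[symmetric] norm_power)
  hence s: "(\<lambda>\<alpha>. \<Prod>i<D. x i ^ \<alpha> i) summable_on ({..<D} \<rightarrow>\<^sub>E UNIV)"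
    by (rule abs_summable_summable)
  have g: "((\<lambda>k. x i ^ k) has_sum (1 / (1 - x i))) UNIV" if "i < D" for i
    using x[OF that]
    by (intro norm_summable_imp_has_sum geometric_sums)
       (auto simp: norm_power intro!: summable_geometric)
  have "infsum (\<lambda>\<alpha>. \<Prod>i<D. x i ^ \<alpha> i) ({..<D} \<rightarrow>\<^sub>E UNIV) = (\<Prod>i<D. infsum (\<lambda>k. x i ^ k) UNIV)"
    by (rule infsum_prod_PiE) (use s g in \<open>auto simp: summable_on_def\<close>)
  also have "\<dots> = (\<Prod>i<D. 1 / (1 - x i))"
    using g by (intro prod.cong refl infsumI) auto
  finally show ?thesis using has_sum_infsum[OF s] by simp
qed

lemma nat_powr_complex:
  "n > 0 \<Longrightarrow> (of_nat n :: complex) powr w = exp (w * of_real (ln (real n)))"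
  by (simp add: powr_def Ln_of_nat)

lemma nat_prod_powr:
  fixes w :: complex
  shows "of_nat (\<Prod>i<D. nth_prime i ^ \<alpha> i) powr w = (\<Prod>i<D. (of_nat (nth_prime i) powr w) ^ \<alpha> i)"
proof -
  have pos: "(\<Prod>i<D. nth_prime i ^ \<alpha> i) > 0"
    using prod_primes_in_smooth smooth_numbers_pos by blast
  show ?thesis
    unfolding nat_powr_complex[OF pos] nat_powr_complex[OF nth_prime_pos]
    by (simp add: ln_prod_nth_prime exp_sum sum_distrib_left exp_of_nat_mult[symmetric] mult_ac
        del: of_nat_prod)
qed

lemma norm_nth_prime_powr:
  "norm ((of_nat (nth_prime i) :: complex) powr (- w)) = exp (- log_prime i * Re w)"
  using nth_prime_gt_1[of i] by (simp add: nat_powr_complex mult.commute)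

lemma norm_nth_prime_powr_less_1:
  "Re w > 0 \<Longrightarrow> norm ((of_nat (nth_prime i) :: complex) powr (- w)) < 1"
  using ln_nth_prime_pos[of i] by (simp add: norm_nth_prime_powr)

lemma has_sum_smooth_powr:
  assumes "Re w > 0"
  shows "((\<lambda>n. of_nat n powr (- w)) has_sum (\<Prod>i<D. 1 / (1 - of_nat (nth_prime i) powr (- w))))
           (smooth_numbers D)"
proof -
  have "((\<lambda>\<alpha>. of_nat (\<Prod>i<D. nth_prime i ^ \<alpha> i) powr (- w)) has_sum
      (\<Prod>i<D. 1 / (1 - of_nat (nth_prime i) powr (- w)))) ({..<D} \<rightarrow>\<^sub>E UNIV)"
    using has_sum_geometric_PiE[of D "\<lambda>i. of_nat (nth_prime i) powr (- w)"]
      norm_nth_prime_powr_less_1[OF assms]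
    by (simp only: nat_prod_powr)
  thus ?thesis
    using has_sum_reindex_bij_betw[OF bij_betw_prime_exponents[of D]] by fastforce
qed

section \<open>Absolutely convergent Dirichlet series\<close>

definition abs_conv :: "(nat \<Rightarrow> complex) \<Rightarrow> real \<Rightarrow> bool" where
  "abs_conv c \<sigma> \<longleftrightarrow> summable (\<lambda>n. norm (c n) * real n powr (- \<sigma>))"

lemma norm_dirichlet_term:
  "norm (c n * of_nat n powr (- s)) = norm (c n) * real n powr (- Re s)"
  by (simp add: norm_mult norm_powr_real_powr)

lemma nat_powr_antimono: "\<sigma> \<le> \<sigma>' \<Longrightarrow> real n powr (- \<sigma>') \<le> real n powr (- \<sigma>)"
  by (cases "n = 0") (auto intro: powr_mono)

lemma abs_conv_mono: "abs_conv c \<sigma> \<Longrightarrow> \<sigma> \<le> \<sigma>' \<Longrightarrow> abs_conv c \<sigma>'"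
  unfolding abs_conv_def
  by (erule summable_comparison_test') (auto intro: mult_left_mono nat_powr_antimono)

lemma abs_conv_norm_summable:
  "abs_conv c (Re s) \<Longrightarrow> summable (\<lambda>n. norm (c n * of_nat n powr (- s)))"
  by (simp add: abs_conv_def norm_dirichlet_term)

lemma abs_conv_sums:
  "abs_conv c (Re s) \<Longrightarrow> (\<lambda>n. c n * of_nat n powr (- s)) sums dirichlet_series c s"
  unfolding dirichlet_series_def
  by (rule summable_sums[OF summable_norm_cancel[OF abs_conv_norm_summable]])

lemma abs_conv_has_sum:
  "abs_conv c (Re s) \<Longrightarrow> ((\<lambda>n. c n * of_nat n powr (- s)) has_sum dirichlet_series c s) UNIV"
  by (rule norm_summable_imp_has_sum[OF abs_conv_norm_summable abs_conv_sums])

text \<open>Tannery's theorem for sequences; the majorant has to work for all terms of the series, but only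
eventually along the sequence.\<close>

lemma dominated_suminf:
  fixes a :: "nat \<Rightarrow> nat \<Rightarrow> complex"
  assumes "\<And>k. (\<lambda>n. a k n) \<longlonglongrightarrow> b k"
    and "eventually (\<lambda>n. \<forall>k. norm (a k n) \<le> M k) sequentially" and "summable M"
  shows "(\<lambda>n. \<Sum>k. a k n) \<longlonglongrightarrow> (\<Sum>k. b k)"
proof -
  have "eventually (\<lambda>(k,n). \<forall>k. norm (a k n) \<le> M k) (sequentially \<times>\<^sub>F sequentially)"
    using assms(2) by (simp add: eventually_prod2)
  hence "eventually (\<lambda>(k,n). norm (a k n) \<le> M k) (sequentially \<times>\<^sub>F sequentially)"
    by (rule eventually_mono) auto
  thus ?thesis using tannerys_theorem[of a b sequentially M, OF assms(1)] assms(3) by simp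
qed

text \<open>If \<open>m\<close> is the least index of a nonzero coefficient, then \<open>m powr s\<close> times the series tends to \<open>a m\<close>
as \<open>s\<close> tends to infinity along the real axis.\<close>

lemma dirichlet_series_unique_zero:
  assumes ac: "abs_conv a \<sigma>" and z: "\<And>k::nat. dirichlet_series a (of_real (\<sigma> + real k)) = 0"
    and "n \<ge> 1"
  shows "a n = 0"
  using \<open>n \<ge> 1\<close>
proof (induction n rule: less_induct)
  case (less m)
  define b where "b = (\<lambda>n k. a n * of_nat n powr (- of_real (\<sigma> + real k)) * of_nat m powr (of_real (\<sigma> + real k)))"
  have nb: "norm (b n k) = norm (a n) * real n powr (- (\<sigma> + real k)) * real m powr (\<sigma> + real k)" for n k
    unfolding b_def by (simp add: norm_mult norm_powr_real_powr)
  have split: "real n powr (- (\<sigma> + real k)) * real m powr (\<sigma> + real k)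
      = real n powr (- \<sigma>) * real m powr \<sigma> * (real n powr (- real k) * real m powr (real k))" for n k
  proof -
    have "real n powr (- (\<sigma> + real k)) = real n powr (- \<sigma>) * real n powr (- real k)"
      by (subst powr_add[symmetric]) simp
    thus ?thesis by (simp add: powr_add)
  qed
  have b0: "b n k = 0" if "n < m" for n k
    using less.IH[of n] that by (cases "n = 0") (auto simp: b_def)
  have le: "norm (b n k) \<le> norm (a n) * real n powr (- \<sigma>) * real m powr \<sigma>" for n k
  proof (cases "n < m")
    case False
    note split[of n k]
    also have "real n powr (- real k) * real m powr real k = (real m / real n) powr real k"
      using less.prems False by (simp add: powr_divide powr_minus field_simps)
    also have "real n powr - \<sigma> * real m powr \<sigma> * (real m / real n) powr real k
        \<le> real n powr - \<sigma> * real m powr \<sigma> * 1"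
      using False less.prems by (intro mult_left_mono powr_le1) auto
    finally have "real n powr (- (\<sigma> + real k)) * real m powr (\<sigma> + real k) \<le> real n powr (- \<sigma>) * real m powr \<sigma>"
      by simp
    thus ?thesis unfolding nb mult.assoc by (intro mult_left_mono) auto
  qed (simp add: b0)
  have lim: "(\<lambda>k. b n k) \<longlonglongrightarrow> (if n = m then a m else 0)" for n
  proof (cases "n \<le> m")
    case True
    have "b m k = a m" for k
      unfolding b_def using less.prems by (simp add: mult.assoc powr_add[symmetric])
    thus ?thesis using True b0[of n] by auto
  next
    case False
    have "norm (b n k) = norm (a n) * real n powr (- \<sigma>) * real m powr \<sigma> * (real m / real n) ^ k" for k
    proof -
      note split[of n k]
      also have "real n powr (- real k) * real m powr real k = (real m / real n) ^ k"
        using less.prems False by (simp add: powr_realpow powr_minus power_divide field_simps)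
      finally show ?thesis unfolding nb by (simp add: mult_ac)
    qed
    moreover have "(\<lambda>k. norm (a n) * real n powr (- \<sigma>) * real m powr \<sigma> * (real m / real n) ^ k) \<longlonglongrightarrow>
        norm (a n) * real n powr (- \<sigma>) * real m powr \<sigma> * 0"
      using False by (intro tendsto_mult tendsto_const LIMSEQ_realpow_zero) auto
    ultimately have "(\<lambda>k. norm (b n k)) \<longlonglongrightarrow> 0" by simp
    thus ?thesis using False by (auto simp: tendsto_norm_zero_iff)
  qed
  have "(\<lambda>k. suminf (\<lambda>n. b n k)) \<longlonglongrightarrow> suminf (\<lambda>n. if n = m then a m else 0)"
  proof -
    have "summable (\<lambda>n. norm (a n) * real n powr (- \<sigma>) * real m powr \<sigma>)"
      using ac unfolding abs_conv_def by (rule summable_mult2)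
    thus ?thesis
      by (intro dominated_suminf[OF lim, where M = "\<lambda>n. norm (a n) * real n powr (- \<sigma>) * real m powr \<sigma>"])
        (simp_all add: le)
  qed
  moreover have "suminf (\<lambda>n. b n k) = 0" for k
  proof -
    have "(\<lambda>n. a n * of_nat n powr (- of_real (\<sigma> + real k))) sums 0"
      using abs_conv_sums[of a "of_real (\<sigma> + real k)"] abs_conv_mono[OF ac, of "\<sigma> + real k"] z by simp
    hence "(\<lambda>n. b n k) sums (0 * of_nat m powr (of_real (\<sigma> + real k)))"
      unfolding b_def by (rule sums_mult2)
    thus ?thesis by (simp add: sums_iff)
  qed
  moreover have "suminf (\<lambda>n. if n = m then a m else 0) = a m"
    using sums_single[of m "\<lambda>_. a m"] by (auto simp: sums_iff eq_commute)
  ultimately show "a m = 0"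
    by (simp add: LIMSEQ_const_iff)
qed

lemma open_right_half_plane: "open (right_half_plane \<theta>)"
  unfolding right_half_plane_def by (rule open_halfspace_Re_gt)

lemma connected_right_half_plane: "connected (right_half_plane \<theta>)"
  unfolding right_half_plane_def by (intro convex_connected convex_halfspace_Re_gt)

lemma holomorphic_dirichlet_series:
  assumes "\<And>\<sigma>. \<sigma> > \<theta> \<Longrightarrow> abs_conv c \<sigma>"
  shows "dirichlet_series c holomorphic_on right_half_plane \<theta>"
proof (rule holomorphic_uniform_sequence[OF open_right_half_plane,
      where f = "\<lambda>N s. \<Sum>n<N. c n * of_nat n powr (- s)"])
  fix N :: nat
  show "(\<lambda>s. \<Sum>n<N. c n * of_nat n powr (- s)) holomorphic_on right_half_plane \<theta>"
  proof (intro holomorphic_on_sum holomorphic_on_mult holomorphic_on_const)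
    fix n :: nat
    show "(\<lambda>s. of_nat n powr (- s) :: complex) holomorphic_on right_half_plane \<theta>"
      by (cases "n = 0") (auto simp: nat_powr_complex intro!: holomorphic_intros)
  qed
next
  fix s assume s: "s \<in> right_half_plane \<theta>"
  define r where "r = (Re s - \<theta>) / 2"
  have r: "r > 0" "Re s - r > \<theta>" using s by (auto simp: r_def right_half_plane_def field_simps)
  have re: "Re s - r \<le> Re w" if "w \<in> cball s r" for w
    using that abs_Re_le_cmod[of "s - w"] by (auto simp: dist_norm)
  have "uniform_limit (cball s r) (\<lambda>N s. \<Sum>n<N. c n * of_nat n powr (- s)) (\<lambda>s. \<Sum>n. c n * of_nat n powr (- s)) sequentially"
  proof (rule Weierstrass_m_test)
    show "summable (\<lambda>n. norm (c n) * real n powr (- (Re s - r)))"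
      using assms[OF r(2)] by (simp add: abs_conv_def)
    show "norm (c n * of_nat n powr (- w)) \<le> norm (c n) * real n powr (- (Re s - r))" if "w \<in> cball s r" for n w
      unfolding norm_dirichlet_term by (intro mult_left_mono nat_powr_antimono re that) auto
  qed
  moreover have "cball s r \<subseteq> right_half_plane \<theta>"
    using re r by (fastforce simp: right_half_plane_def)
  ultimately show "\<exists>d>0. cball s d \<subseteq> right_half_plane \<theta> \<and>
      uniform_limit (cball s d) (\<lambda>N s. \<Sum>n<N. c n * of_nat n powr (- s)) (dirichlet_series c) sequentially"
    using r(1) by (auto simp: dirichlet_series_def[abs_def])
qed

text \<open>The finite Euler product at \<open>w\<close>. It is needed at complex arguments for the values of the kernels and
at real arguments for their norms, hence the polymorphic type.\<close>

definition euler_product :: "nat \<Rightarrow> 'a::{real_normed_field,banach} \<Rightarrow> 'a" where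
  "euler_product D w = (\<Prod>i<D. 1 / (1 - exp (- (w * of_real (log_prime i)))))"

lemma euler_product_of_real: "euler_product D (of_real x) = (of_real (euler_product D x) :: complex)"
  by (simp add: euler_product_def exp_of_real[symmetric])

lemma euler_product_pos:
  fixes x :: real
  assumes "x > 0" shows "euler_product D x > 0"
  unfolding euler_product_def using assms ln_nth_prime_pos by (intro prod_pos) simp

lemma sums_euler_product:
  assumes "Re w > 0"
  shows "(\<lambda>n. if n \<in> smooth_numbers D then of_nat n powr (- w) else 0) sums euler_product D w"
proof -
  have "((\<lambda>n. if n \<in> smooth_numbers D then of_nat n powr (- w) else 0) has_sum euler_product D w) UNIV
      \<longleftrightarrow> ((\<lambda>n. of_nat n powr (- w)) has_sum euler_product D w) (smooth_numbers D)"
    by (rule has_sum_cong_neutral) auto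
  thus ?thesis
    using has_sum_smooth_powr[OF assms, of D] has_sum_imp_sums
    by (auto simp: euler_product_def nat_powr_complex[OF nth_prime_pos])
qed

lemma sums_euler_product_real:
  fixes x :: real
  assumes "x > 0"
  shows "(\<lambda>n. if n \<in> smooth_numbers D then real n powr (- x) else 0) sums euler_product D x"
proof -
  have "(\<lambda>n. of_real (if n \<in> smooth_numbers D then real n powr (- x) else 0) :: complex)
      = (\<lambda>n. if n \<in> smooth_numbers D then of_nat n powr (- of_real x) else 0)"
  proof (intro ext)
    fix n
    have "of_real (real n powr (- x)) = (of_nat n powr (- of_real x) :: complex)"
      using powr_of_real[of "real n" "- x"] by simp
    thus "of_real (if n \<in> smooth_numbers D then real n powr (- x) else 0) =
       (if n \<in> smooth_numbers D then of_nat n powr (- of_real x) else (0::complex))" by simp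
  qed
  hence "(\<lambda>n. of_real (if n \<in> smooth_numbers D then real n powr (- x) else 0) :: complex)
     sums of_real (euler_product D x)"
    using sums_euler_product[of "of_real x" D] assms by (simp add: euler_product_of_real)
  thus ?thesis by (subst (asm) sums_of_real_iff)
qed

section \<open>The Hilbert space and kernels over finitely many primes\<close>

lemma summable_product_Cauchy_Schwarz:
  fixes x y :: "nat \<Rightarrow> real"
  assumes "summable (\<lambda>n. (x n)\<^sup>2)" "summable (\<lambda>n. (y n)\<^sup>2)" "\<And>n. x n \<ge> 0" "\<And>n. y n \<ge> 0"
  shows "summable (\<lambda>n. x n * y n)"
    and "(\<Sum>n. x n * y n) \<le> sqrt (\<Sum>n. (x n)\<^sup>2) * sqrt (\<Sum>n. (y n)\<^sup>2)"
proof -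
  have b: "(\<Sum>n<N. x n * y n) \<le> sqrt (\<Sum>n. (x n)\<^sup>2) * sqrt (\<Sum>n. (y n)\<^sup>2)" for N
  proof -
    have "(\<Sum>n<N. x n * y n) \<le> sqrt (\<Sum>n<N. (x n)\<^sup>2) * sqrt (\<Sum>n<N. (y n)\<^sup>2)"
      using L2_set_mult_ineq[of x y "{..<N}"] assms by (simp add: L2_set_def)
    also have "\<dots> \<le> sqrt (\<Sum>n. (x n)\<^sup>2) * sqrt (\<Sum>n. (y n)\<^sup>2)"
      using assms by (intro mult_mono real_sqrt_le_mono sum_le_suminf) (auto intro: sum_nonneg suminf_nonneg)
    finally show ?thesis .
  qed
  show s: "summable (\<lambda>n. x n * y n)"
    using b assms by (intro summableI_nonneg_bounded) auto
  show "(\<Sum>n. x n * y n) \<le> sqrt (\<Sum>n. (x n)\<^sup>2) * sqrt (\<Sum>n. (y n)\<^sup>2)"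
    using b by (intro suminf_le_const s)
qed

lemma abs_conv_dcoeff:
  assumes "\<sigma> > 1/2"
  shows "abs_conv (dcoeff f) \<sigma>"
  unfolding abs_conv_def
proof (rule summable_product_Cauchy_Schwarz(1))
  have "summable (\<lambda>n. real n powr (-2*\<sigma>))"
    using assms by (simp add: summable_real_powr_iff)
  moreover have "(real n powr - \<sigma>)\<^sup>2 = real n powr (-2*\<sigma>)" for n
    by (simp add: power2_eq_square powr_add[symmetric])
  ultimately show "summable (\<lambda>n. (real n powr - \<sigma>)\<^sup>2)" by simp
qed (auto intro: summable_dcoeff)

lemma norm_hd_eval_le:
  assumes "Re s > 1/2"
  shows "norm (hd_eval f s) \<le> norm f * sqrt (\<Sum>n. real n powr (- 2 * Re s))"
proof -
  have sq: "(real n powr - Re s)\<^sup>2 = real n powr (-2*Re s)" for n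
    by (simp add: power2_eq_square powr_add[symmetric])
  have "norm (hd_eval f s) \<le> (\<Sum>n. norm (dcoeff f n) * real n powr (- Re s))"
    unfolding hd_eval_def dirichlet_series_def
    using summable_norm[OF abs_conv_norm_summable[OF abs_conv_dcoeff[OF assms, of f]]]
    by (simp add: norm_dirichlet_term)
  also have "\<dots> \<le> sqrt (\<Sum>n. (norm (dcoeff f n))\<^sup>2) * sqrt (\<Sum>n. (real n powr - Re s)\<^sup>2)"
    using assms
    by (intro summable_product_Cauchy_Schwarz(2) summable_dcoeff)
      (auto simp only: sq summable_real_powr_iff norm_ge_zero powr_ge_zero)
  finally show ?thesis by (simp add: sq norm_hilbert_dirichlet_def)
qed

definition smooth_supported :: "nat \<Rightarrow> hilbert_dirichlet \<Rightarrow> bool" where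
  "smooth_supported D f \<longleftrightarrow> (\<forall>n. n \<notin> smooth_numbers D \<longrightarrow> dcoeff f n = 0)"

text \<open>On smooth numbers the weights \<open>n powr (- 2 * \<sigma>)\<close> are summable for every positive \<open>\<sigma>\<close>, so the
Cauchy-Schwarz inequality reaches up to the imaginary axis. For general elements of the space it stops
at abscissa \<open>1/2\<close>.\<close>

lemma smooth_supported_bounds:
  assumes f: "smooth_supported D f" and "\<sigma> > 0"
  shows "abs_conv (dcoeff f) \<sigma>"
    and "(\<Sum>n. norm (dcoeff f n) * real n powr (- \<sigma>)) \<le> norm f * sqrt (euler_product D (2 * \<sigma>))"
proof -
  define y where "y = (\<lambda>n. if n \<in> smooth_numbers D then real n powr (- \<sigma>) else 0)"
  have eq: "norm (dcoeff f n) * real n powr (- \<sigma>) = norm (dcoeff f n) * y n" for n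
    using f by (auto simp: smooth_supported_def y_def)
  have y2: "(\<lambda>n. (y n)\<^sup>2) = (\<lambda>n. if n \<in> smooth_numbers D then real n powr (- (2*\<sigma>)) else 0)"
    by (auto simp: y_def fun_eq_iff power2_eq_square powr_add[symmetric])
  have s: "(\<lambda>n. (y n)\<^sup>2) sums euler_product D (2*\<sigma>)"
    unfolding y2 using assms by (intro sums_euler_product_real) auto
  have y0: "y n \<ge> 0" for n by (simp add: y_def)
  show "abs_conv (dcoeff f) \<sigma>"
    unfolding abs_conv_def eq using s y0
    by (intro summable_product_Cauchy_Schwarz(1) summable_dcoeff) (auto simp: sums_iff)
  show "(\<Sum>n. norm (dcoeff f n) * real n powr (- \<sigma>)) \<le> norm f * sqrt (euler_product D (2 * \<sigma>))"
    unfolding eq using summable_product_Cauchy_Schwarz(2)[OF summable_dcoeff[of f], of y] s y0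
    by (simp add: norm_hilbert_dirichlet_def sums_iff)
qed

lemma norm_hd_eval_smooth_le:
  assumes f: "smooth_supported D f" and s: "Re s > 0"
  shows "norm (hd_eval f s) \<le> norm f * sqrt (euler_product D (2 * Re s))"
proof -
  have "norm (hd_eval f s) \<le> (\<Sum>n. norm (dcoeff f n) * real n powr (- Re s))"
    unfolding hd_eval_def dirichlet_series_def
    using summable_norm[OF abs_conv_norm_summable[OF smooth_supported_bounds(1)[OF f s]]]
    by (simp add: norm_dirichlet_term)
  also note smooth_supported_bounds(2)[OF f s]
  finally show ?thesis .
qed

text \<open>The reproducing kernel at \<open>v\<close> of the subspace of elements supported on \<open>D\<close>-smooth numbers, divided by
its norm.\<close>

definition unit_kernel :: "nat \<Rightarrow> complex \<Rightarrow> hilbert_dirichlet" where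
  "unit_kernel D v = Abs_hilbert_dirichlet
     (\<lambda>n. if n \<in> smooth_numbers D then of_nat n powr (- cnj v) / of_real (sqrt (euler_product D (2 * Re v))) else 0)"

lemma
  assumes "Re v > 0"
  shows dcoeff_unit_kernel: "dcoeff (unit_kernel D v) n = (if n \<in> smooth_numbers D
      then of_nat n powr (- cnj v) / of_real (sqrt (euler_product D (2 * Re v))) else 0)"
    and norm_unit_kernel: "norm (unit_kernel D v) = 1"
proof -
  let ?a = "\<lambda>n. if n \<in> smooth_numbers D
      then of_nat n powr (- cnj v) / of_real (sqrt (euler_product D (2 * Re v))) else 0"
  let ?E = "euler_product D (2 * Re v)"
  have E: "?E > 0" using assms by (intro euler_product_pos) simp
  have "(norm (?a n))\<^sup>2 = (if n \<in> smooth_numbers D then real n powr (- (2 * Re v)) else 0) / ?E" for n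
    using E by (auto simp: norm_divide norm_powr_real_powr power_divide power2_eq_square powr_add[symmetric])
  hence s: "(\<lambda>n. (norm (?a n))\<^sup>2) sums (?E / ?E)"
    using sums_divide[OF sums_euler_product_real[of "2 * Re v" D], of ?E] assms by simp
  have "0 \<notin> smooth_numbers D" using smooth_numbers_pos by blast
  hence d: "dcoeff (unit_kernel D v) = ?a"
    unfolding unit_kernel_def using s
    by (intro Abs_hilbert_dirichlet_inverse) (simp add: sums_iff)
  show "dcoeff (unit_kernel D v) n = ?a n" by (simp only: d)
  show "norm (unit_kernel D v) = 1"
    unfolding norm_hilbert_dirichlet_def d using s E by (simp add: sums_iff)
qed

lemma smooth_supported_unit_kernel: "Re v > 0 \<Longrightarrow> smooth_supported D (unit_kernel D v)"
  by (simp add: smooth_supported_def dcoeff_unit_kernel)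

lemma hd_eval_unit_kernel:
  assumes v: "Re v > 0" and s: "Re s > 0"
  shows "hd_eval (unit_kernel D v) s = euler_product D (s + cnj v) / of_real (sqrt (euler_product D (2 * Re v)))"
proof -
  have "dcoeff (unit_kernel D v) n * of_nat n powr (- s) =
     (if n \<in> smooth_numbers D then of_nat n powr (- (s + cnj v)) else 0) / of_real (sqrt (euler_product D (2 * Re v)))" for n
    using smooth_numbers_pos[of n D] by (auto simp: dcoeff_unit_kernel[OF v] powr_add[symmetric] algebra_simps)
  thus ?thesis
    unfolding hd_eval_def dirichlet_series_def
    using sums_divide[OF sums_euler_product[of "s + cnj v" D], of "of_real (sqrt (euler_product D (2 * Re v)))"] v s
    by (simp add: sums_iff)
qed

section \<open>Vertical translations and twists\<close>

text \<open>Vertical translations can approximate the completely multiplicative function that is \<open>cis a\<close> at the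
prime \<open>q\<close> and \<open>1\<close> at all other primes. Kronecker's theorem treats the first \<open>k\<close> primes up to an error
\<open>1 / (k + 1)\<close>, and multiplicativity carries the limit from primes to all integers.\<close>

lemma prime_twist_sequence:
  assumes q: "prime q"
  obtains \<tau> :: "nat \<Rightarrow> real" where
    "\<And>n. n > 0 \<Longrightarrow> (\<lambda>k. of_nat n powr (- (\<i> * of_real (\<tau> k))) :: complex) \<longlonglongrightarrow> cis (a * real (multiplicity q n))"
proof -
  define \<theta> where "\<theta> = (\<lambda>i. if nth_prime i = q then - a else 0)"
  have "\<exists>t. \<forall>i<k. \<exists>h::int. \<bar>t * log_prime i - \<theta> i - 2 * pi * h\<bar> < 1 / Suc k" for k
    using kronecker_primes[of "1 / Suc k" k \<theta>] by (metis of_nat_0_less_iff zero_less_Suc zero_less_divide_1_iff)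
  then obtain \<tau> where \<tau>: "\<And>k i. i < k \<Longrightarrow> \<exists>h::int. \<bar>\<tau> k * log_prime i - \<theta> i - 2 * pi * h\<bar> < 1 / Suc k"
    by metis
  let ?E = "\<lambda>n k. of_nat n powr (- (\<i> * of_real (\<tau> k))) :: complex"
  have E: "?E n k = cis (- \<tau> k * ln (real n))" if "n > 0" for n k
    using that by (simp add: nat_powr_complex cis_conv_exp mult_ac)
  have lim_prime: "?E (nth_prime i) \<longlonglongrightarrow> cis (- \<theta> i)" for i
  proof -
    obtain h :: "nat \<Rightarrow> int" where h: "\<And>k. i < k \<Longrightarrow> \<bar>\<tau> k * log_prime i - \<theta> i - 2 * pi * h k\<bar> < 1 / Suc k"
      using \<tau>[of i] by metis
    define e where "e = (\<lambda>k. \<tau> k * log_prime i - \<theta> i - 2 * pi * h k)"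
    have "e \<longlonglongrightarrow> 0"
    proof (rule Lim_null_comparison)
      show "\<forall>\<^sub>F k in sequentially. norm (e k) \<le> 1 / Suc k"
        using h by (intro eventually_sequentiallyI[of "Suc i"]) (auto simp: e_def less_imp_le)
      show "(\<lambda>k. 1 / real (Suc k)) \<longlonglongrightarrow> 0"
        using LIMSEQ_inverse_real_of_nat by (simp add: inverse_eq_divide)
    qed
    hence "(\<lambda>k. cis (- e k)) \<longlonglongrightarrow> cis (- 0)" by (intro tendsto_intros)
    hence "(\<lambda>k. cis (- e k) * cis (- \<theta> i)) \<longlonglongrightarrow> cis (- \<theta> i)"
      using tendsto_mult_right[of "\<lambda>k. cis (- e k)" 1 sequentially "cis (- \<theta> i)"] by simp
    moreover have "cis (- e k) * cis (- \<theta> i) = ?E (nth_prime i) k" for k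
    proof -
      have "cis (- e k) * cis (- \<theta> i) = cis (- \<tau> k * log_prime i) * cis (2 * pi * h k)"
        unfolding cis_mult by (rule arg_cong[of _ _ cis]) (simp add: e_def)
      also have "cis (2 * pi * h k) = 1"
        by (rule cis_multiple_2pi) auto
      finally show ?thesis by (simp add: E nth_prime_pos)
    qed
    ultimately show ?thesis by simp
  qed
  have "?E n \<longlonglongrightarrow> cis (a * real (multiplicity q n))" if "n > 0" for n
    using that
  proof (induction n rule: prime_divisors_induct)
    case zero thus ?case by simp
  next
    case (unit n) thus ?case by simp
  next
    case (factor p n)
    have pn: "p > 0" "n > 0" using factor by auto
    have "(\<lambda>k. ?E p k * ?E n k) \<longlonglongrightarrow> cis (if p = q then a else 0) * cis (a * real (multiplicity q n))"
    proof (intro tendsto_mult)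
      obtain i where i: "p = nth_prime i" using prime_eq_nth_prime factor by blast
      show "?E p \<longlonglongrightarrow> cis (if p = q then a else 0)"
        using lim_prime[of i] by (auto simp: i \<theta>_def)
      show "?E n \<longlonglongrightarrow> cis (a * real (multiplicity q n))" using factor pn by blast
    qed
    moreover have "?E p k * ?E n k = ?E (p * n) k" for k
    proof -
      have "ln (real (p * n)) = ln (real p) + ln (real n)" using pn by (simp add: ln_mult)
      moreover have "?E (p * n) k = cis (- \<tau> k * ln (real (p * n)))" using pn by (intro E) simp
      ultimately show ?thesis using pn by (simp add: E cis_mult algebra_simps del: of_nat_mult)
    qed
    moreover have "multiplicity q (p * n) = (if p = q then 1 else 0) + multiplicity q n"
      using pn factor q
      by (auto simp: prime_elem_multiplicity_mult_distrib prime_multiplicity_other)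
    hence "cis (if p = q then a else 0) * cis (a * real (multiplicity q n)) = cis (a * real (multiplicity q (p * n)))"
      by (auto simp: cis_mult algebra_simps)
    ultimately show ?case by (simp only:)
  qed
  thus ?thesis using that by blast
qed

lemma smooth_multiplicity_0:
  "n \<in> smooth_numbers D \<Longrightarrow> prime q \<Longrightarrow> q \<notin> nth_prime ` {..<D} \<Longrightarrow> multiplicity q n = 0"
  by (auto simp: smooth_numbers_def intro!: not_dvd_imp_multiplicity_0)

lemma nat_powr_split:
  "(of_nat n :: complex) powr (- (s + w)) = of_nat n powr (- s) * of_nat n powr (- w)"
  by (simp add: powr_add[symmetric])

lemma dirichlet_series_twist:
  assumes ac: "abs_conv c (Re s)" and "c 0 = 0"
    and \<tau>: "\<And>n. n > 0 \<Longrightarrow> (\<lambda>k. of_nat n powr (- (\<i> * of_real (\<tau> k))) :: complex) \<longlonglongrightarrow> \<omega> n"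
  shows "(\<lambda>k. dirichlet_series c (s + \<i> * of_real (\<tau> k))) \<longlonglongrightarrow> dirichlet_series (\<lambda>n. c n * \<omega> n) s"
  unfolding dirichlet_series_def
proof (rule dominated_suminf)
  show "summable (\<lambda>n. norm (c n) * real n powr (- Re s))" using ac by (simp add: abs_conv_def)
  show "\<forall>\<^sub>F k in sequentially. \<forall>n. norm (c n * of_nat n powr (- (s + \<i> * of_real (\<tau> k)))) \<le> norm (c n) * real n powr (- Re s)"
    unfolding norm_dirichlet_term by simp
  fix n
  show "(\<lambda>k. c n * of_nat n powr (- (s + \<i> * of_real (\<tau> k)))) \<longlonglongrightarrow> c n * \<omega> n * of_nat n powr (- s)"
  proof (cases "n = 0")
    case False
    hence "(\<lambda>k. c n * (of_nat n powr (- s) * of_nat n powr (- (\<i> * of_real (\<tau> k))))) \<longlonglongrightarrow> c n * (of_nat n powr (- s) * \<omega> n)"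
      by (intro tendsto_intros \<tau>) auto
    thus ?thesis unfolding nat_powr_split by (simp add: mult_ac)
  qed (simp add: \<open>c 0 = 0\<close>)
qed

section \<open>Symbols on the right half-plane\<close>

text \<open>The differences of consecutive partial sums are bounded on a smaller half-plane, so \<open>c n\<close> is
\<open>O(n powr (\<sigma>/2))\<close>; on smooth numbers this growth is compensated by \<open>n powr (- \<sigma>)\<close>.\<close>

lemma abs_conv_uniformly_convergent:
  assumes u: "\<forall>\<epsilon>>0. uniformly_convergent_on (right_half_plane \<epsilon>) (\<lambda>M s. \<Sum>n=1..M. c n * of_nat n powr (- s))"
    and sm: "involves_first_primes d c" and "\<sigma> > 0"
  shows "abs_conv c \<sigma>"
proof -
  let ?S = "\<lambda>M s. \<Sum>n=1..M. c n * of_nat n powr (- s)"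
  have "uniformly_Cauchy_on (right_half_plane (\<sigma>/4)) ?S"
    using u \<open>\<sigma> > 0\<close> by (intro uniformly_convergent_Cauchy) simp
  then obtain M0 where M0: "\<And>s m n. s \<in> right_half_plane (\<sigma>/4) \<Longrightarrow> m \<ge> M0 \<Longrightarrow> n \<ge> M0 \<Longrightarrow> dist (?S m s) (?S n s) < 1"
    unfolding uniformly_Cauchy_on_def using zero_less_one by blast
  have b: "norm (c n) * real n powr (- (\<sigma>/2)) \<le> 1" if nM: "n > M0" for n
  proof -
    obtain m where m: "n = Suc m" "m \<ge> M0" using nM by (cases n) auto
    have "dist (?S n (of_real (\<sigma>/2))) (?S m (of_real (\<sigma>/2))) < 1"
      using m \<open>\<sigma> > 0\<close> by (intro M0) (auto simp: right_half_plane_def)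
    hence "norm (c n * of_nat n powr (- of_real (\<sigma>/2))) < 1"
      using m by (simp add: dist_norm)
    thus ?thesis unfolding norm_dirichlet_term by simp
  qed
  show ?thesis unfolding abs_conv_def
  proof (rule summable_comparison_test'[where N = "Suc M0"])
    show "summable (\<lambda>n. if n \<in> smooth_numbers d then real n powr (- (\<sigma>/2)) else 0)"
      using sums_euler_product_real[of "\<sigma>/2" d] \<open>\<sigma> > 0\<close> by (simp add: sums_iff)
    fix n assume n: "n \<ge> Suc M0"
    show "norm (norm (c n) * real n powr - \<sigma>) \<le> (if n \<in> smooth_numbers d then real n powr (- (\<sigma>/2)) else 0)"
    proof (cases "n \<in> smooth_numbers d")
      case True
      have "real n powr - \<sigma> = real n powr (- (\<sigma>/2)) * real n powr (- (\<sigma>/2))"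
        by (simp add: powr_add[symmetric])
      hence "norm (c n) * real n powr - \<sigma> = norm (c n) * real n powr (- (\<sigma>/2)) * real n powr (- (\<sigma>/2))" by simp
      also have "\<dots> \<le> 1 * real n powr (- (\<sigma>/2))"
        using b[of n] n by (intro mult_right_mono) auto
      finally show ?thesis using True by simp
    next
      case False
      thus ?thesis using sm n by (auto simp: involves_first_primes_smooth)
    qed
  qed
qed

text \<open>The symbol, continued from abscissa \<open>1/2\<close> to the whole right half-plane.\<close>

definition symbol_map :: "nat \<Rightarrow> (nat \<Rightarrow> complex) \<Rightarrow> complex \<Rightarrow> complex" where
  "symbol_map c0 c s = of_nat c0 * s + dirichlet_series c s"

lemma dirichlet_series_drop_0: "dirichlet_series (c(0 := 0)) = dirichlet_series c"
  by (rule ext) (auto simp: dirichlet_series_def intro!: suminf_cong)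

lemma hd_eval_diff:
  assumes "Re s > 1/2"
  shows "hd_eval (f - g) s = hd_eval f s - hd_eval g s"
proof -
  have "dcoeff (f - g) n = dcoeff f n - dcoeff g n" for n
    unfolding minus_hilbert_dirichlet_def dcoeff_add dcoeff_uminus by simp
  thus ?thesis
    using sums_diff[OF abs_conv_sums[OF abs_conv_dcoeff[OF assms, of f]] abs_conv_sums[OF abs_conv_dcoeff[OF assms, of g]]]
    unfolding hd_eval_def by (simp add: dirichlet_series_def sums_iff left_diff_distrib)
qed

lemma hd_eval_eq_0_imp:
  assumes "\<And>s. Re s > 1/2 \<Longrightarrow> hd_eval f s = 0"
  shows "f = 0"
proof (rule dcoeff_eqI)
  fix n
  have "abs_conv (dcoeff f) 1" by (rule abs_conv_dcoeff) simp
  moreover have "dirichlet_series (dcoeff f) (of_real (1 + real k)) = 0" for k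
    using assms[of "of_real (1 + real k)"] by (simp add: hd_eval_def)
  ultimately have "dcoeff f n = 0" if "n \<ge> 1"
    using dirichlet_series_unique_zero that by blast
  thus "dcoeff f n = dcoeff 0 n"
    by (cases "n = 0") (auto simp: dcoeff_0 dcoeff_zero)
qed

lemma norm_inverse_one_minus_exp_le:
  assumes "0 < x" "x \<le> Re w"
  shows "norm (1 / (1 - exp (- w))) \<le> 1 / (1 - exp (- x))"
proof -
  have "1 - exp (- x) \<le> 1 - norm (exp (- w))" using assms by simp
  also have "\<dots> \<le> norm (1 - exp (- w))"
    using norm_triangle_ineq2[of 1 "exp (- w)"] by simp
  finally show ?thesis using assms by (simp add: norm_divide frac_le)
qed

lemma norm_euler_product_le:
  assumes "0 < x" "x \<le> Re w"
  shows "norm (euler_product D w) \<le> euler_product D x"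
  unfolding euler_product_def prod_norm[symmetric]
proof (intro prod_mono conjI norm_ge_zero)
  fix i
  show "norm (1 / (1 - exp (- (w * of_real (log_prime i)))))
      \<le> 1 / (1 - exp (- (x * of_real (log_prime i))))"
    using norm_inverse_one_minus_exp_le[of "x * log_prime i" "w * of_real (log_prime i)"]
      assms ln_nth_prime_pos[of i] by simp
qed

lemma inverse_euler_product_tendsto_0:
  fixes x :: "nat \<Rightarrow> real"
  assumes "x \<longlonglongrightarrow> 0" "D \<ge> 1"
  shows "(\<lambda>n. 1 / euler_product D (x n)) \<longlonglongrightarrow> 0"
proof -
  have "(\<lambda>n. \<Prod>i<D. (1 - exp (- (x n * log_prime i)))) \<longlonglongrightarrow> (\<Prod>i<D. (1 - exp (- (0 * log_prime i))))"
    by (intro tendsto_intros assms)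
  moreover have "(\<Prod>i<D. (1 - exp (- (0 * log_prime i)))) = 0"
    using assms by (simp add: power_0_left)
  ultimately have "(\<lambda>n. \<Prod>i<D. (1 - exp (- (x n * log_prime i)))) \<longlonglongrightarrow> 0" by (simp only:)
  thus ?thesis by (simp add: euler_product_def prod_dividef)
qed

section \<open>Compact combinations of composition operators\<close>

text \<open>\<open>T\<close> is the linear combination of the composition operators, as a map of the Hilbert space into
itself.\<close>

locale symbol_combination =
  fixes d N :: nat and \<phi> :: "nat \<Rightarrow> complex \<Rightarrow> complex" and c0 :: "nat \<Rightarrow> nat"
    and c :: "nat \<Rightarrow> nat \<Rightarrow> complex" and lam :: "nat \<Rightarrow> complex"
    and T :: "hilbert_dirichlet \<Rightarrow> hilbert_dirichlet"
  assumes gh: "\<And>j. j \<in> {1..N} \<Longrightarrow> gordon_hedenmalm (\<phi> j) (c0 j) (c j)"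
    and first_primes: "\<And>j. j \<in> {1..N} \<Longrightarrow> involves_first_primes d (c j)"
    and T_eval: "\<And>f s. Re s > 1/2 \<Longrightarrow> hd_eval (T f) s = (\<Sum>j=1..N. lam j * hd_eval f (\<phi> j s))"
    and T_compact: "compact_operator T"
begin

abbreviation \<psi> :: "nat \<Rightarrow> complex \<Rightarrow> complex" where "\<psi> j \<equiv> dirichlet_series (c j)"
abbreviation \<Psi> :: "nat \<Rightarrow> complex \<Rightarrow> complex" where "\<Psi> j \<equiv> symbol_map (c0 j) (c j)"

lemma abs_conv_c: "j \<in> {1..N} \<Longrightarrow> \<sigma> > 0 \<Longrightarrow> abs_conv (c j) \<sigma>"
  using gh[of j] first_primes[of j] unfolding gordon_hedenmalm_def
  by (intro abs_conv_uniformly_convergent) auto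

lemma Re_\<psi>: "j \<in> {1..N} \<Longrightarrow> Re s > 0 \<Longrightarrow> Re (\<psi> j s) \<ge> (if c0 j = 0 then 1/2 else 0)"
  using gh[of j] unfolding gordon_hedenmalm_def right_half_plane_def
  by (cases "c0 j = 0") (auto simp: image_subset_iff less_imp_le dest!: bspec[of _ _ s])

lemma Re_\<Psi>_pos: "j \<in> {1..N} \<Longrightarrow> Re s > 0 \<Longrightarrow> Re (\<Psi> j s) > 0"
  using Re_\<psi>[of j s] by (cases "c0 j = 0") (auto simp: symbol_map_def add_pos_nonneg)

lemma \<phi>_eq_\<Psi>: "j \<in> {1..N} \<Longrightarrow> Re s > 1/2 \<Longrightarrow> \<phi> j s = \<Psi> j s"
  and Re_\<Psi>_half: "j \<in> {1..N} \<Longrightarrow> Re s > 1/2 \<Longrightarrow> Re (\<Psi> j s) > 1/2"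
proof -
  assume j: "j \<in> {1..N}" "Re s > 1/2"
  show eq: "\<phi> j s = \<Psi> j s"
    using gh[of j] j by (auto simp: gordon_hedenmalm_def right_half_plane_def symbol_map_def)
  show "Re (\<Psi> j s) > 1/2"
    using gh[of j] j eq by (auto simp: gordon_hedenmalm_def right_half_plane_def)
qed

lemma holomorphic_\<Psi>: "j \<in> {1..N} \<Longrightarrow> \<Psi> j holomorphic_on right_half_plane 0"
  unfolding symbol_map_def[abs_def]
  by (intro holomorphic_intros holomorphic_dirichlet_series abs_conv_c)

lemma T_eval_\<Psi>: "Re s > 1/2 \<Longrightarrow> hd_eval (T f) s = (\<Sum>j=1..N. lam j * hd_eval f (\<Psi> j s))"
  by (simp add: T_eval \<phi>_eq_\<Psi>)

text \<open>Suppose that \<open>n\<close> has a prime factor \<open>q\<close> beyond the first \<open>D\<close> primes, with multiplicity \<open>m\<close>. A sequence of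
vertical translations that twists \<open>q\<close> by \<open>cis (pi / m)\<close> and fixes all other primes leaves the
symbols and \<open>f\<close> unchanged in the limit, hence also \<open>T f\<close>; but it changes the sign of the coefficient
of \<open>T f\<close> at \<open>n\<close>, which is therefore zero.\<close>

lemma smooth_supported_T:
  assumes f: "smooth_supported D f" and "d \<le> D"
  shows "smooth_supported D (T f)"
  unfolding smooth_supported_def
proof (intro allI impI)
  fix n assume n: "n \<notin> smooth_numbers D"
  show "dcoeff (T f) n = 0"
  proof (cases "n = 0")
    case False
    then obtain q where q: "prime q" "q dvd n" "q \<notin> nth_prime ` {..<D}"
      using n by (auto simp: smooth_numbers_def)
    define m where "m = multiplicity q n"
    have m: "m \<ge> 1"
      unfolding m_def using q False prime_multiplicity_gt_zero_iff[of q n] by (simp add: Suc_le_eq)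
    define \<omega> where "\<omega> = (\<lambda>k. cis (pi / real m * real (multiplicity q k)))"
    obtain \<tau> where \<tau>: "\<And>k. k > 0 \<Longrightarrow> (\<lambda>i. of_nat k powr (- (\<i> * of_real (\<tau> i))) :: complex) \<longlonglongrightarrow> \<omega> k"
      unfolding \<omega>_def using prime_twist_sequence[OF q(1)] by blast
    have \<omega>1: "\<omega> k = 1" if "k \<in> smooth_numbers D" for k
      using smooth_multiplicity_0[OF that q(1) q(3)] by (simp add: \<omega>_def)
    have invariant: "(\<lambda>k. hd_eval (T f) (s + \<i> * of_real (\<tau> k))) \<longlonglongrightarrow> hd_eval (T f) s" if s: "Re s > 1/2" for s
    proof -
      have "(\<lambda>k. \<Sum>j=1..N. lam j * hd_eval f (\<Psi> j (s + \<i> * of_real (\<tau> k)))) \<longlonglongrightarrow> (\<Sum>j=1..N. lam j * hd_eval f (\<Psi> j s))"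
      proof (intro tendsto_sum tendsto_mult tendsto_const)
        fix j assume j: "j \<in> {1..N}"
        \<comment> \<open>The value of a coefficient sequence at \<open>0\<close> is arbitrary, and twists concern positive integers.\<close>
        have "(\<lambda>k. dirichlet_series ((c j)(0:=0)) (s + \<i> * of_real (\<tau> k))) \<longlonglongrightarrow> dirichlet_series (\<lambda>n. ((c j)(0:=0)) n * \<omega> n) s"
        proof (rule dirichlet_series_twist[OF _ _ \<tau>])
          have "abs_conv (c j) (Re s)" using abs_conv_c[OF j] s by simp
          thus "abs_conv ((c j)(0:=0)) (Re s)"
            unfolding abs_conv_def by (rule back_subst[of summable]) auto
        qed auto
        moreover have "(\<lambda>n. ((c j)(0:=0)) n * \<omega> n) = (c j)(0:=0)"
          using first_primes[OF j] smooth_numbers_mono[OF \<open>d \<le> D\<close>] \<omega>1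
          by (auto simp: fun_eq_iff involves_first_primes_smooth) (metis One_nat_def Suc_leI mult_cancel_left2 subsetD)
        ultimately have \<psi>lim: "(\<lambda>k. \<psi> j (s + \<i> * of_real (\<tau> k))) \<longlonglongrightarrow> \<psi> j s"
          by (simp add: dirichlet_series_drop_0)
        define \<Psi>' where "\<Psi>' = (\<lambda>k. of_nat (c0 j) * s + \<psi> j (s + \<i> * of_real (\<tau> k)))"
        have \<Psi>'lim: "\<Psi>' \<longlonglongrightarrow> \<Psi> j s"
          unfolding \<Psi>'_def symbol_map_def by (intro tendsto_intros \<psi>lim)
        have \<Psi>': "\<Psi> j (s + \<i> * of_real (\<tau> k)) = of_nat (c0 j) * (\<i> * of_real (\<tau> k)) + \<Psi>' k" for k
          by (simp add: \<Psi>'_def symbol_map_def algebra_simps)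
        obtain \<sigma> where \<sigma>: "1/2 < \<sigma>" "\<sigma> < Re (\<Psi> j s)"
          using dense[OF Re_\<Psi>_half[OF j s]] by auto
        have "(\<lambda>k. Re (\<Psi>' k)) \<longlonglongrightarrow> Re (\<Psi> j s)" by (intro tendsto_intros \<Psi>'lim)
        hence ev: "eventually (\<lambda>k. Re (\<Psi>' k) > \<sigma>) sequentially" using \<sigma> by (intro order_tendstoD)
        show "(\<lambda>k. hd_eval f (\<Psi> j (s + \<i> * of_real (\<tau> k)))) \<longlonglongrightarrow> hd_eval f (\<Psi> j s)"
          unfolding hd_eval_def dirichlet_series_def
        proof (rule dominated_suminf)
          show "summable (\<lambda>n. norm (dcoeff f n) * real n powr (- \<sigma>))"
            using abs_conv_dcoeff[OF \<sigma>(1)] by (simp add: abs_conv_def)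
          show "\<forall>\<^sub>F k in sequentially. \<forall>n. norm (dcoeff f n * of_nat n powr (- \<Psi> j (s + \<i> * of_real (\<tau> k))))
              \<le> norm (dcoeff f n) * real n powr (- \<sigma>)"
            using ev
          proof eventually_elim
            case (elim k)
            thus ?case unfolding norm_dirichlet_term
              by (auto simp: \<Psi>' intro!: mult_left_mono nat_powr_antimono)
          qed
          fix n
          show "(\<lambda>k. dcoeff f n * of_nat n powr (- \<Psi> j (s + \<i> * of_real (\<tau> k)))) \<longlonglongrightarrow> dcoeff f n * of_nat n powr (- \<Psi> j s)"
          proof (cases "n \<in> smooth_numbers D")
            case True
            hence n0: "n > 0" by (rule smooth_numbers_pos)
            have "(\<lambda>k. (of_nat n powr (- (\<i> * of_real (\<tau> k)))) ^ c0 j * of_nat n powr (- \<Psi>' k)) \<longlonglongrightarrow> 1 ^ c0 j * of_nat n powr (- \<Psi> j s)"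
              using \<tau>[OF n0] \<omega>1[OF True] n0 unfolding nat_powr_complex[OF n0]
              by (intro tendsto_intros \<Psi>'lim) auto
            moreover have "(of_nat n powr (- (\<i> * of_real (\<tau> k)))) ^ c0 j * of_nat n powr (- \<Psi>' k)
                = of_nat n powr (- \<Psi> j (s + \<i> * of_real (\<tau> k)))" for k
              unfolding \<Psi>' nat_powr_split
              by (simp add: nat_powr_complex[OF n0] exp_of_nat_mult[symmetric] mult_ac)
            ultimately show ?thesis by (intro tendsto_mult tendsto_const) simp
          next
            case False
            thus ?thesis using f by (simp add: smooth_supported_def)
          qed
        qed
      qed
      thus ?thesis using s by (simp add: T_eval_\<Psi>)
    qed
    define b where "b = dcoeff (T f)"
    have "b n * \<omega> n - b n = 0"
    proof (rule dirichlet_series_unique_zero[where \<sigma> = 1 and a = "\<lambda>n. b n * \<omega> n - b n"])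
      have ac: "abs_conv b 1" unfolding b_def by (rule abs_conv_dcoeff) simp
      have "norm (\<omega> k) = 1" for k by (simp add: \<omega>_def)
      hence ac2: "abs_conv (\<lambda>n. b n * \<omega> n) 1" using ac by (simp add: abs_conv_def norm_mult)
      show "abs_conv (\<lambda>n. b n * \<omega> n - b n) 1"
        unfolding abs_conv_def
      proof (rule summable_comparison_test')
        show "summable (\<lambda>n. norm (b n * \<omega> n) * real n powr - 1 + norm (b n) * real n powr - 1)"
          using ac ac2 unfolding abs_conv_def by (rule summable_add[rotated])
        show "norm (norm (b n * \<omega> n - b n) * real n powr - 1) \<le> norm (b n * \<omega> n) * real n powr - 1 + norm (b n) * real n powr - 1" for n
          using mult_right_mono[OF norm_triangle_ineq4[of "b n * \<omega> n" "b n"], of "real n powr - 1"]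
          by (simp add: algebra_simps)
      qed
      fix k :: nat
      define s where "s = (of_real (1 + real k) :: complex)"
      have s: "Re s > 1/2" "Re s \<ge> 1" by (auto simp: s_def)
      have "(\<lambda>k. dirichlet_series b (s + \<i> * of_real (\<tau> k))) \<longlonglongrightarrow> dirichlet_series (\<lambda>n. b n * \<omega> n) s"
        using dirichlet_series_twist[OF abs_conv_mono[OF ac s(2)] _ \<tau>] by (simp add: b_def dcoeff_0)
      hence "dirichlet_series (\<lambda>n. b n * \<omega> n) s = dirichlet_series b s"
        using invariant[OF s(1)] LIMSEQ_unique unfolding b_def hd_eval_def by blast
      thus "dirichlet_series (\<lambda>n. b n * \<omega> n - b n) (of_real (1 + real k)) = 0"
        using sums_diff[OF abs_conv_sums[OF abs_conv_mono[OF ac2 s(2)]] abs_conv_sums[OF abs_conv_mono[OF ac s(2)]]]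
        unfolding s_def[symmetric] by (simp add: dirichlet_series_def sums_iff left_diff_distrib)
    qed (use False in auto)
    moreover have "\<omega> n = - 1" using m by (simp add: \<omega>_def m_def)
    ultimately show ?thesis by (simp add: b_def)
  qed (simp add: dcoeff_0)
qed

text \<open>The identity theorem: both sides are holomorphic on the right half-plane, because \<open>f\<close> and \<open>T f\<close> are
smooth-supported.\<close>

lemma T_eval_half_plane:
  assumes f: "smooth_supported D f" and "d \<le> D" and s: "Re s > 0"
  shows "hd_eval (T f) s = (\<Sum>j=1..N. lam j * hd_eval f (\<Psi> j s))"
proof (rule analytic_continuation_open[where s = "right_half_plane (1/2)" and s' = "right_half_plane 0"
      and f = "hd_eval (T f)" and g = "\<lambda>s. \<Sum>j=1..N. lam j * hd_eval f (\<Psi> j s)"])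
  have hol: "hd_eval g holomorphic_on right_half_plane 0" if "smooth_supported D g" for g
    unfolding hd_eval_def using smooth_supported_bounds(1)[OF that] by (rule holomorphic_dirichlet_series)
  show "hd_eval (T f) holomorphic_on right_half_plane 0"
    by (intro hol smooth_supported_T assms)
  show "(\<lambda>s. \<Sum>j=1..N. lam j * hd_eval f (\<Psi> j s)) holomorphic_on right_half_plane 0"
  proof (intro holomorphic_on_sum holomorphic_on_mult holomorphic_on_const)
    fix j assume j: "j \<in> {1..N}"
    have "hd_eval f \<circ> \<Psi> j holomorphic_on right_half_plane 0"
      by (rule holomorphic_on_compose_gen[OF holomorphic_\<Psi>[OF j] hol[OF f]])
        (auto simp: right_half_plane_def Re_\<Psi>_pos[OF j])
    thus "(\<lambda>s. hd_eval f (\<Psi> j s)) holomorphic_on right_half_plane 0" by (simp add: o_def)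
  qed
  have "1 \<in> right_half_plane (1/2)" by (simp add: right_half_plane_def)
  thus "right_half_plane (1/2) \<noteq> {}" by blast
  show "right_half_plane (1/2) \<subseteq> right_half_plane 0" "s \<in> right_half_plane 0"
    using s by (auto simp: right_half_plane_def)
  show "hd_eval (T f) z = (\<Sum>j=1..N. lam j * hd_eval f (\<Psi> j z))" if "z \<in> right_half_plane (1/2)" for z
    using that by (simp add: T_eval_\<Psi> right_half_plane_def)
qed (rule open_right_half_plane connected_right_half_plane)+

text \<open>A subsequence of the images converges in norm, and the limit vanishes pointwise because the
symbols map the half-plane \<open>Re s > 1/2\<close> into itself.\<close>

lemma compact_null_sequence:
  assumes "\<And>n. norm (g n) \<le> 1" and lim: "\<And>s. Re s > 1/2 \<Longrightarrow> (\<lambda>n. hd_eval (g n) s) \<longlonglongrightarrow> 0"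
  obtains r where "strict_mono (r :: nat \<Rightarrow> nat)" "(\<lambda>n. norm (T (g (r n)))) \<longlonglongrightarrow> 0"
proof -
  have "compact (closure (T ` cball 0 1))" using T_compact by (simp add: compact_operator_def)
  moreover have "T (g n) \<in> closure (T ` cball 0 1)" for n
    using assms(1) closure_subset[of "T ` cball 0 1"] by (auto simp: dist_norm)
  ultimately obtain h r where r: "strict_mono (r :: nat \<Rightarrow> nat)" and h: "((\<lambda>n. T (g n)) \<circ> r) \<longlonglongrightarrow> h"
    unfolding compact_def by metis
  have h': "(\<lambda>n. norm (T (g (r n)) - h)) \<longlonglongrightarrow> 0"
    using h by (simp add: o_def tendsto_norm_zero LIM_zero)
  have "h = 0"
  proof (rule hd_eval_eq_0_imp)
    fix s :: complex assume s: "Re s > 1/2"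
    define C where "C = sqrt (\<Sum>n. real n powr (- 2 * Re s))"
    have "(\<lambda>n. hd_eval (T (g (r n))) s - hd_eval h s) \<longlonglongrightarrow> 0"
    proof (rule Lim_null_comparison)
      show "\<forall>\<^sub>F n in sequentially. norm (hd_eval (T (g (r n))) s - hd_eval h s) \<le> norm (T (g (r n)) - h) * C"
        using norm_hd_eval_le[OF s] by (simp add: hd_eval_diff[OF s, symmetric] C_def)
      show "(\<lambda>n. norm (T (g (r n)) - h) * C) \<longlonglongrightarrow> 0"
        using tendsto_mult_right[OF h', of C] by simp
    qed
    moreover have "(\<lambda>n. hd_eval (T (g (r n))) s) \<longlonglongrightarrow> (\<Sum>j=1..N. lam j * 0)"
      unfolding T_eval_\<Psi>[OF s]
      by (intro tendsto_sum tendsto_mult tendsto_const LIMSEQ_subseq_LIMSEQ[OF lim r, unfolded o_def] Re_\<Psi>_half s)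
    ultimately have "(\<lambda>n. hd_eval (T (g (r n))) s - (hd_eval (T (g (r n))) s - hd_eval h s)) \<longlonglongrightarrow> 0 - 0"
      by (intro tendsto_diff) auto
    thus "hd_eval h s = 0" by (simp add: LIMSEQ_const_iff)
  qed
  thus ?thesis using that[OF r] h' by simp
qed

text \<open>As \<open>\<Psi> j0 (s n)\<close> approaches the imaginary axis, the norms of the kernels blow up while their values at
a fixed point stay bounded, so the unit kernels tend to zero pointwise. The displayed sum is the value
at \<open>s n\<close> of the image of the unit kernel, divided by the norm of the evaluation there.\<close>

lemma kernel_combination_null:
  assumes "d \<le> D" "D \<ge> 1" and j0: "j0 \<in> {1..N}" and s: "\<And>n. Re (s n) > 0"
    and lim: "(\<lambda>n. Re (\<Psi> j0 (s n))) \<longlonglongrightarrow> 0"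
  obtains r where "strict_mono (r :: nat \<Rightarrow> nat)"
    "(\<lambda>n. \<Sum>j=1..N. lam j * (euler_product D (\<Psi> j (s (r n)) + cnj (\<Psi> j0 (s (r n)))) /
        of_real (sqrt (euler_product D (2 * Re (\<Psi> j0 (s (r n))))) * sqrt (euler_product D (2 * Re (s (r n))))))) \<longlonglongrightarrow> 0"
proof -
  define v where "v = (\<lambda>n. \<Psi> j0 (s n))"
  define g where "g = (\<lambda>n. unit_kernel D (v n))"
  have v: "Re (v n) > 0" for n unfolding v_def by (intro Re_\<Psi>_pos j0 s)
  obtain r where r: "strict_mono (r :: nat \<Rightarrow> nat)" "(\<lambda>n. norm (T (g (r n)))) \<longlonglongrightarrow> 0"
  proof (rule compact_null_sequence[of g])
    show "norm (g n) \<le> 1" for n by (simp add: g_def norm_unit_kernel v)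
    fix u :: complex assume u: "Re u > 1/2"
    show "(\<lambda>n. hd_eval (g n) u) \<longlonglongrightarrow> 0"
    proof (rule Lim_null_comparison)
      show "\<forall>\<^sub>F n in sequentially. norm (hd_eval (g n) u) \<le> euler_product D (1/2) * sqrt (1 / euler_product D (2 * Re (v n)))"
      proof (intro always_eventually allI)
        fix n
        have "norm (euler_product D (u + cnj (v n))) \<le> euler_product D (1/2)"
          using u v[of n] by (intro norm_euler_product_le) auto
        moreover have "euler_product D (2 * Re (v n)) > 0" using v by (intro euler_product_pos) simp
        ultimately show "norm (hd_eval (g n) u) \<le> euler_product D (1/2) * sqrt (1 / euler_product D (2 * Re (v n)))"
          using u v by (simp add: g_def hd_eval_unit_kernel norm_divide real_sqrt_divide divide_right_mono)
      qed
      have "(\<lambda>n. 2 * Re (v n)) \<longlonglongrightarrow> 2 * 0" unfolding v_def by (intro tendsto_intros lim)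
      hence "(\<lambda>n. 1 / euler_product D (2 * Re (v n))) \<longlonglongrightarrow> 0"
        using assms by (intro inverse_euler_product_tendsto_0) auto
      hence "(\<lambda>n. euler_product D (1/2) * sqrt (1 / euler_product D (2 * Re (v n)))) \<longlonglongrightarrow> euler_product D (1/2) * sqrt 0"
        by (intro tendsto_mult tendsto_const tendsto_real_sqrt)
      thus "(\<lambda>n. euler_product D (1/2) * sqrt (1 / euler_product D (2 * Re (v n)))) \<longlonglongrightarrow> 0" by simp
    qed
  qed
  have "(\<lambda>n. \<Sum>j=1..N. lam j * (euler_product D (\<Psi> j (s (r n)) + cnj (\<Psi> j0 (s (r n)))) /
        of_real (sqrt (euler_product D (2 * Re (\<Psi> j0 (s (r n))))) * sqrt (euler_product D (2 * Re (s (r n))))))) \<longlonglongrightarrow> 0"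
  proof (rule Lim_null_comparison[OF _ r(2)], intro always_eventually allI)
    fix n
    let ?s = "s (r n)" and ?v = "v (r n)"
    have g: "smooth_supported D (g (r n))" unfolding g_def by (intro smooth_supported_unit_kernel v)
    have E: "euler_product D (2 * Re ?s) > 0" using s by (intro euler_product_pos) simp
    have "(\<Sum>j=1..N. lam j * (euler_product D (\<Psi> j ?s + cnj ?v) /
        of_real (sqrt (euler_product D (2 * Re ?v)) * sqrt (euler_product D (2 * Re ?s)))))
      = hd_eval (T (g (r n))) ?s / of_real (sqrt (euler_product D (2 * Re ?s)))"
      unfolding T_eval_half_plane[OF g \<open>d \<le> D\<close> s] sum_divide_distrib
      by (intro sum.cong refl) (simp add: g_def hd_eval_unit_kernel v s Re_\<Psi>_pos)
    also have "norm \<dots> \<le> norm (T (g (r n)))"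
      using norm_hd_eval_smooth_le[OF smooth_supported_T[OF g \<open>d \<le> D\<close>] s[of "r n"]] E
      by (simp add: norm_divide divide_simps)
    finally show "norm (\<Sum>j=1..N. lam j * (euler_product D (\<Psi> j (s (r n)) + cnj (\<Psi> j0 (s (r n)))) /
        of_real (sqrt (euler_product D (2 * Re (\<Psi> j0 (s (r n))))) * sqrt (euler_product D (2 * Re (s (r n)))))))
        \<le> norm (T (g (r n)))" unfolding v_def .
  qed
  thus ?thesis using that r by blast
qed

end

section \<open>Power series on the polydisc\<close>

definition monomial_series :: "nat \<Rightarrow> ((nat \<Rightarrow> nat) \<Rightarrow> complex) \<Rightarrow> (nat \<Rightarrow> complex) \<Rightarrow> complex" where
  "monomial_series d a z = (\<Sum>\<^sub>\<infinity>\<alpha>\<in>{..<d} \<rightarrow>\<^sub>E UNIV. a \<alpha> * (\<Prod>i<d. z i ^ \<alpha> i))"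

definition polydisc_summable :: "nat \<Rightarrow> ((nat \<Rightarrow> nat) \<Rightarrow> complex) \<Rightarrow> bool" where
  "polydisc_summable d a \<longleftrightarrow>
    (\<forall>z\<in>polydisc d. (\<lambda>\<alpha>. a \<alpha> * (\<Prod>i<d. z i ^ \<alpha> i)) summable_on ({..<d} \<rightarrow>\<^sub>E UNIV))"

definition derivative_coeffs :: "nat \<Rightarrow> ((nat \<Rightarrow> nat) \<Rightarrow> complex) \<Rightarrow> (nat \<Rightarrow> nat) \<Rightarrow> complex" where
  "derivative_coeffs i a \<alpha> = of_nat (Suc (\<alpha> i)) * a (\<alpha>(i := Suc (\<alpha> i)))"

lemma derivative_coeffs_commute:
  "derivative_coeffs i (derivative_coeffs k a) = derivative_coeffs k (derivative_coeffs i a)"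
  by (cases "i = k") (auto simp: derivative_coeffs_def fun_eq_iff fun_upd_twist)

lemma polydisc_upd: "z \<in> polydisc d \<Longrightarrow> i < d \<Longrightarrow> norm w < 1 \<Longrightarrow> z(i := w) \<in> polydisc d"
  by (auto simp: polydisc_def PiE_def extensional_def Pi_iff)

lemma polydisc_norm: "z \<in> polydisc d \<Longrightarrow> i < d \<Longrightarrow> norm (z i) < 1"
  by (auto simp: polydisc_def PiE_def Pi_iff)

text \<open>The finite partial sums, as a net, converge uniformly on a disc in the variable \<open>z i\<close>, so Weierstrass'
theorem differentiates the series term by term; shifting the exponent of \<open>z i\<close> brings the derived
series back to the same form. That partial derivatives are again power series of this kind makes
higher and mixed derivatives available without further analysis.\<close>

lemma monomial_series_derivative:
  assumes a: "polydisc_summable d a" and z: "z \<in> polydisc d" and i: "i < d"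
  shows "((\<lambda>\<alpha>. derivative_coeffs i a \<alpha> * (\<Prod>k<d. z k ^ \<alpha> k)) summable_on ({..<d} \<rightarrow>\<^sub>E UNIV))"
    and "((\<lambda>w. monomial_series d a (z(i := w))) has_field_derivative
           monomial_series d (derivative_coeffs i a) z) (at (z i))"
proof -
  let ?I = "{..<d} \<rightarrow>\<^sub>E (UNIV :: nat set)"
  define r where "r = (1 - norm (z i)) / 2"
  have r: "r > 0" "norm (z i) + r < 1" using polydisc_norm[OF z i] by (auto simp: r_def field_simps)
  define P where "P = (\<lambda>\<alpha>. \<Prod>k\<in>{..<d}-{i}. z k ^ (\<alpha> k :: nat))"
  have split: "(\<Prod>k<d. (z(i := w)) k ^ \<alpha> k) = w ^ \<alpha> i * P \<alpha>" for w \<alpha>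
  proof -
    have "(\<Prod>k<d. (z(i := w)) k ^ \<alpha> k) = (z(i := w)) i ^ \<alpha> i * (\<Prod>k\<in>{..<d}-{i}. (z(i := w)) k ^ \<alpha> k)"
      using i by (intro prod.remove) auto
    also have "(\<Prod>k\<in>{..<d}-{i}. (z(i := w)) k ^ \<alpha> k) = P \<alpha>"
      unfolding P_def by (intro prod.cong) auto
    finally show ?thesis by simp
  qed
  have nw: "norm w \<le> norm (z i) + r" if "w \<in> cball (z i) r" for w
    using that norm_triangle_sub[of w "z i"] by (auto simp: dist_norm norm_minus_commute)
  have "uniform_limit (cball (z i) r) (\<lambda>A w. \<Sum>\<alpha>\<in>A. a \<alpha> * (\<Prod>k<d. (z(i := w)) k ^ \<alpha> k))
      (\<lambda>w. \<Sum>\<^sub>\<infinity>\<alpha>\<in>?I. a \<alpha> * (\<Prod>k<d. (z(i := w)) k ^ \<alpha> k)) (finite_subsets_at_top ?I)"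
  proof (rule Weierstrass_m_test_general)
    define R where "R = (of_real (norm (z i) + r) :: complex)"
    have R: "norm R = norm (z i) + r" using r unfolding R_def norm_of_real by simp
    have "z(i := R) \<in> polydisc d" using z i r R by (intro polydisc_upd) auto
    hence "(\<lambda>\<alpha>. a \<alpha> * (\<Prod>k<d. (z(i := R)) k ^ \<alpha> k)) summable_on ?I"
      using a unfolding polydisc_summable_def by blast
    thus "(\<lambda>\<alpha>. norm (a \<alpha> * (\<Prod>k<d. (z(i := R)) k ^ \<alpha> k))) summable_on ?I"
      by (subst (asm) summable_on_iff_abs_summable_on_complex)
    show "norm (a \<alpha> * (\<Prod>k<d. (z(i := w)) k ^ \<alpha> k)) \<le> norm (a \<alpha> * (\<Prod>k<d. (z(i := R)) k ^ \<alpha> k))"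
      if "w \<in> cball (z i) r" for \<alpha> w
      unfolding split norm_mult norm_power R
      by (intro mult_left_mono mult_right_mono power_mono nw that) auto
  qed
  hence ul: "uniform_limit (cball (z i) r) (\<lambda>A w. \<Sum>\<alpha>\<in>A. a \<alpha> * (w ^ \<alpha> i * P \<alpha>))
      (\<lambda>w. monomial_series d a (z(i := w))) (finite_subsets_at_top ?I)"
    unfolding monomial_series_def split .
  obtain g' where g': "\<And>w. w \<in> ball (z i) r \<Longrightarrow>
      ((\<lambda>w. monomial_series d a (z(i := w))) has_field_derivative g' w) (at w) \<and>
      ((\<lambda>A. \<Sum>\<alpha>\<in>A. a \<alpha> * (of_nat (\<alpha> i) * w ^ (\<alpha> i - 1) * P \<alpha>)) \<longlongrightarrow> g' w) (finite_subsets_at_top ?I)"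
  proof (rule has_complex_derivative_uniform_limit[OF _ ul _ r(1),
        where f' = "\<lambda>A w. \<Sum>\<alpha>\<in>A. a \<alpha> * (of_nat (\<alpha> i) * w ^ (\<alpha> i - 1) * P \<alpha>)"])
    show "\<forall>\<^sub>F A in finite_subsets_at_top ?I. continuous_on (cball (z i) r) (\<lambda>w. \<Sum>\<alpha>\<in>A. a \<alpha> * (w ^ \<alpha> i * P \<alpha>)) \<and>
        (\<forall>w\<in>ball (z i) r. ((\<lambda>w. \<Sum>\<alpha>\<in>A. a \<alpha> * (w ^ \<alpha> i * P \<alpha>)) has_field_derivative
           (\<Sum>\<alpha>\<in>A. a \<alpha> * (of_nat (\<alpha> i) * w ^ (\<alpha> i - 1) * P \<alpha>))) (at w))"
      by (intro always_eventually allI conjI ballI continuous_intros DERIV_sum)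
        (auto intro!: derivative_eq_intros simp: mult_ac)
    show "finite_subsets_at_top ?I \<noteq> bot" by simp
  qed blast
  have "z i \<in> ball (z i) r" using r by simp
  note g'i = g'[OF this]
  have "((\<lambda>\<alpha>. a \<alpha> * (of_nat (\<alpha> i) * z i ^ (\<alpha> i - 1) * P \<alpha>)) has_sum g' (z i)) ?I"
    using g'i unfolding has_sum_def by blast
  also have "?this \<longleftrightarrow> ((\<lambda>\<alpha>. a \<alpha> * (of_nat (\<alpha> i) * z i ^ (\<alpha> i - 1) * P \<alpha>)) has_sum g' (z i)) {\<alpha>\<in>?I. \<alpha> i > 0}"
    by (rule has_sum_cong_neutral) auto
  also have "\<dots> \<longleftrightarrow> ((\<lambda>\<alpha>. derivative_coeffs i a \<alpha> * (\<Prod>k<d. z k ^ \<alpha> k)) has_sum g' (z i)) ?I"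
  proof (rule has_sum_reindex_bij_witness[of _ "\<lambda>\<alpha>. \<alpha>(i := Suc (\<alpha> i))" "\<lambda>\<alpha>. \<alpha>(i := \<alpha> i - 1)"])
    fix \<alpha> assume \<alpha>: "\<alpha> \<in> {\<alpha>\<in>?I. \<alpha> i > 0}"
    show "(\<alpha>(i := \<alpha> i - 1))(i := Suc ((\<alpha>(i := \<alpha> i - 1)) i)) = \<alpha>" using \<alpha> by auto
    show "\<alpha>(i := \<alpha> i - 1) \<in> ?I" using \<alpha> i by (auto simp: PiE_def extensional_def)
    have "(\<Prod>k<d. z k ^ (\<alpha>(i := \<alpha> i - 1)) k) = z i ^ (\<alpha> i - 1) * P \<alpha>"
      using split[of "z i" "\<alpha>(i := \<alpha> i - 1)"] by (simp add: P_def)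
    thus "derivative_coeffs i a (\<alpha>(i := \<alpha> i - 1)) * (\<Prod>k<d. z k ^ (\<alpha>(i := \<alpha> i - 1)) k)
        = a \<alpha> * (of_nat (\<alpha> i) * z i ^ (\<alpha> i - 1) * P \<alpha>)"
      using \<alpha> by (simp add: derivative_coeffs_def del: of_nat_Suc)
  qed (use i in \<open>auto simp: PiE_def extensional_def\<close>)
  finally have hs: "((\<lambda>\<alpha>. derivative_coeffs i a \<alpha> * (\<Prod>k<d. z k ^ \<alpha> k)) has_sum g' (z i)) ?I" .
  thus "((\<lambda>\<alpha>. derivative_coeffs i a \<alpha> * (\<Prod>k<d. z k ^ \<alpha> k)) summable_on ?I)"
    by (auto simp: summable_on_def)
  have "monomial_series d (derivative_coeffs i a) z = g' (z i)"
    unfolding monomial_series_def using hs by (rule infsumI)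
  thus "((\<lambda>w. monomial_series d a (z(i := w))) has_field_derivative
           monomial_series d (derivative_coeffs i a) z) (at (z i))"
    using g'i by simp
qed

lemma polydisc_summable_derivative:
  "polydisc_summable d a \<Longrightarrow> i < d \<Longrightarrow> polydisc_summable d (derivative_coeffs i a)"
  using monomial_series_derivative(1) by (auto simp: polydisc_summable_def)

lemma complex_partial_monomial_series:
  assumes a: "polydisc_summable d a" and F: "\<And>x. x \<in> polydisc d \<Longrightarrow> F x = monomial_series d a x"
    and z: "z \<in> polydisc d" and i: "i < d"
  shows "((\<lambda>w. F (z(i := w))) has_field_derivative monomial_series d (derivative_coeffs i a) z) (at (z i))"
    and "complex_partial i F z = monomial_series d (derivative_coeffs i a) z"
proof -
  show "((\<lambda>w. F (z(i := w))) has_field_derivative monomial_series d (derivative_coeffs i a) z) (at (z i))"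
    using monomial_series_derivative(2)[OF a z i]
  proof (rule has_field_derivative_transform_within_open[where S = "ball 0 1"])
    show "monomial_series d a (z(i := w)) = F (z(i := w))" if "w \<in> ball 0 1" for w
      using F[OF polydisc_upd[OF z i, of w]] that by simp
  qed (use polydisc_norm[OF z i] in auto)
  thus "complex_partial i F z = monomial_series d (derivative_coeffs i a) z"
    unfolding complex_partial_def by (rule DERIV_imp_deriv)
qed

lemma real_partial_eq_complex_derivative:
  assumes "((\<lambda>w. F (z(i := w))) has_field_derivative D) (at (z i))"
  shows "real_partial i 1 F z = D"
proof -
  have "((\<lambda>t. F (z(i := z i + of_real t * 1))) has_vector_derivative D) (at 0)"
  proof -
    have "((\<lambda>t::real. z i + of_real t) has_vector_derivative 1) (at 0)"
      by (auto intro!: derivative_eq_intros)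
    moreover have "((\<lambda>w. F (z(i := w))) has_field_derivative D) (at (z i + of_real 0))"
      using assms by simp
    ultimately have "((\<lambda>w. F (z(i := w))) \<circ> (\<lambda>t::real. z i + of_real t) has_vector_derivative 1 * D) (at 0)"
      by (intro field_vector_diff_chain_at)
    thus ?thesis by (simp add: o_def)
  qed
  thus ?thesis
    unfolding real_partial_def line_map_def[abs_def] by (rule vector_derivative_at)
qed

text \<open>Since \<open>c n\<close> is \<open>O(n powr \<sigma>)\<close> for every positive \<open>\<sigma>\<close>, the terms are dominated by those of a product of
geometric series with ratios \<open>p powr \<sigma>\<close> times \<open>norm (z i)\<close>. These are less than \<open>1\<close> when \<open>\<sigma>\<close> is small
in terms of \<open>z\<close>.\<close>

lemma bohr_lift_summable:
  assumes ac: "\<And>\<sigma>. \<sigma> > 0 \<Longrightarrow> abs_conv c \<sigma>"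
  shows "polydisc_summable d (\<lambda>\<alpha>. c (\<Prod>i<d. nth_prime i ^ \<alpha> i))"
  unfolding polydisc_summable_def
proof
  fix z assume z: "z \<in> polydisc d"
  let ?I = "{..<d} \<rightarrow>\<^sub>E (UNIV :: nat set)" and ?n = "\<lambda>\<alpha>. \<Prod>i<d. nth_prime i ^ \<alpha> i"
  let ?L = log_prime
  have "eventually (\<lambda>\<sigma>. \<forall>i\<in>{..<d}. exp (\<sigma> * ?L i) * norm (z i) < 1) (at_right 0)"
  proof (intro eventually_ball_finite ballI)
    fix i assume i: "i \<in> {..<d}"
    have "((\<lambda>\<sigma>. exp (\<sigma> * ?L i) * norm (z i)) \<longlongrightarrow> exp (0 * ?L i) * norm (z i)) (at_right 0)"
      by (intro tendsto_intros)
    thus "eventually (\<lambda>\<sigma>. exp (\<sigma> * ?L i) * norm (z i) < 1) (at_right 0)"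
      using polydisc_norm[OF z] i by (intro order_tendstoD(2)) auto
  qed simp
  hence "eventually (\<lambda>\<sigma>. \<sigma> > 0 \<and> (\<forall>i\<in>{..<d}. exp (\<sigma> * ?L i) * norm (z i) < 1)) (at_right 0)"
    by (intro eventually_conj eventually_at_right_less)
  then obtain \<sigma> where \<sigma>: "\<sigma> > 0" "\<And>i. i < d \<Longrightarrow> exp (\<sigma> * ?L i) * norm (z i) < 1"
    using eventually_happens'[OF trivial_limit_at_right_real[of "0::real"]] by force
  have s: "summable (\<lambda>n. norm (c n) * real n powr (- \<sigma>))" using ac[OF \<sigma>(1)] by (simp add: abs_conv_def)
  then obtain C where C: "\<And>n. norm (c n) * real n powr (- \<sigma>) \<le> C"
    using summable_imp_Bseq[OF s] by (auto simp: Bseq_def)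
  have "(\<lambda>\<alpha>. C * (\<Prod>i<d. (exp (\<sigma> * ?L i) * norm (z i)) ^ \<alpha> i)) summable_on ?I"
    using \<sigma> by (intro summable_on_cmult_right summable_geometric_PiE) auto
  hence "(\<lambda>\<alpha>. norm (c (?n \<alpha>) * (\<Prod>i<d. z i ^ \<alpha> i))) summable_on ?I"
  proof (rule summable_on_comparison_test)
    fix \<alpha> assume "\<alpha> \<in> ?I"
    have pos: "?n \<alpha> > 0" using prod_primes_in_smooth smooth_numbers_pos by blast
    have "real (?n \<alpha>) powr \<sigma> = exp (\<sigma> * ln (real (?n \<alpha>)))"
      using pos by (simp add: powr_def del: of_nat_prod)
    also have "\<dots> = (\<Prod>i<d. exp (\<sigma> * ?L i) ^ \<alpha> i)"
      by (simp add: ln_prod_nth_prime sum_distrib_left exp_sum exp_of_nat_mult[symmetric] mult_ac del: of_nat_prod)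
    finally have n: "real (?n \<alpha>) powr \<sigma> = (\<Prod>i<d. exp (\<sigma> * ?L i) ^ \<alpha> i)" .
    have "norm (c (?n \<alpha>)) = norm (c (?n \<alpha>)) * real (?n \<alpha>) powr (- \<sigma>) * real (?n \<alpha>) powr \<sigma>"
    proof -
      have "real (?n \<alpha>) powr (- \<sigma>) * real (?n \<alpha>) powr \<sigma> = real (?n \<alpha>) powr 0"
        by (subst powr_add[symmetric]) simp
      also have "\<dots> = 1" using pos by (simp del: of_nat_prod)
      finally show ?thesis by (simp add: mult.assoc del: of_nat_prod)
    qed
    also have "\<dots> \<le> C * real (?n \<alpha>) powr \<sigma>" by (intro mult_right_mono C) auto
    finally have "norm (c (?n \<alpha>)) \<le> C * (\<Prod>i<d. exp (\<sigma> * ?L i) ^ \<alpha> i)" unfolding n .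
    hence "norm (c (?n \<alpha>)) * (\<Prod>i<d. norm (z i) ^ \<alpha> i)
        \<le> C * (\<Prod>i<d. exp (\<sigma> * ?L i) ^ \<alpha> i) * (\<Prod>i<d. norm (z i) ^ \<alpha> i)"
      by (intro mult_right_mono prod_nonneg) auto
    thus "norm (c (?n \<alpha>) * (\<Prod>i<d. z i ^ \<alpha> i)) \<le> C * (\<Prod>i<d. (exp (\<sigma> * ?L i) * norm (z i)) ^ \<alpha> i)"
      by (simp add: norm_mult prod_norm[symmetric] norm_power power_mult_distrib prod.distrib mult_ac)
  qed simp
  thus "(\<lambda>\<alpha>. c (?n \<alpha>) * (\<Prod>i<d. z i ^ \<alpha> i)) summable_on ?I"
    by (rule abs_summable_summable)
qed

lemma bohr_lift_monomial_series: "bohr_lift d c = monomial_series d (\<lambda>\<alpha>. c (\<Prod>i<d. nth_prime i ^ \<alpha> i))"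
  by (simp add: bohr_lift_def[abs_def] monomial_series_def[abs_def])

text \<open>The point of the polydisc at which the Bohr lift takes the value of the Dirichlet series at \<open>s\<close>.\<close>

definition bohr_point :: "nat \<Rightarrow> complex \<Rightarrow> nat \<Rightarrow> complex" where
  "bohr_point d s = (\<lambda>i\<in>{..<d}. of_nat (nth_prime i) powr (- s))"

lemma bohr_point_in_polydisc: "Re s > 0 \<Longrightarrow> bohr_point d s \<in> polydisc d"
  using norm_nth_prime_powr_less_1[of s] by (auto simp: bohr_point_def polydisc_def)

lemma dirichlet_series_eq_bohr_lift:
  assumes ac: "abs_conv c (Re s)" and sm: "involves_first_primes d c"
  shows "dirichlet_series c s = bohr_lift d c (bohr_point d s)"
proof -
  let ?I = "{..<d} \<rightarrow>\<^sub>E (UNIV :: nat set)" and ?n = "\<lambda>\<alpha>. \<Prod>i<d. nth_prime i ^ \<alpha> i"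
  have "((\<lambda>n. c n * of_nat n powr (- s)) has_sum dirichlet_series c s) UNIV"
    by (rule abs_conv_has_sum[OF ac])
  also have "?this \<longleftrightarrow> ((\<lambda>n. c n * of_nat n powr (- s)) has_sum dirichlet_series c s) (smooth_numbers d)"
  proof (rule has_sum_cong_neutral)
    fix n assume "n \<in> UNIV - smooth_numbers d"
    thus "c n * of_nat n powr (- s) = 0"
      using sm by (cases "n = 0") (auto simp: involves_first_primes_smooth)
  qed auto
  also have "\<dots> \<longleftrightarrow> ((\<lambda>\<alpha>. c (?n \<alpha>) * of_nat (?n \<alpha>) powr (- s)) has_sum dirichlet_series c s) ?I"
    using has_sum_reindex_bij_betw[OF bij_betw_prime_exponents[of d]] by fastforce
  finally have "((\<lambda>\<alpha>. c (?n \<alpha>) * (\<Prod>i<d. bohr_point d s i ^ \<alpha> i)) has_sum dirichlet_series c s) ?I"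
    unfolding nat_prod_powr by (simp add: bohr_point_def)
  thus ?thesis unfolding bohr_lift_def by (rule infsumI[symmetric])
qed

section \<open>Approach to the torus\<close>

lemma torus_norm:
  assumes "\<zeta> \<in> torus d" "i < d"
  shows "norm (\<zeta> i) = 1"
proof -
  have "\<zeta> i \<in> sphere 0 1" using PiE_mem[OF assms(1)[unfolded torus_def], of i] assms(2) by simp
  thus ?thesis by simp
qed

text \<open>All points involved are \<open>undefined\<close> at the coordinates from \<open>d\<close> on, so that convergence in the product
topology only concerns the first \<open>d\<close> coordinates.\<close>

lemma filterlim_polydisc:
  assumes w: "\<And>n. w n \<in> polydisc d" and \<zeta>: "\<zeta> \<in> torus d" and d: "d \<ge> 1"
    and lim: "\<And>i. i < d \<Longrightarrow> (\<lambda>n. w n i) \<longlonglongrightarrow> \<zeta> i"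
  shows "filterlim w (at \<zeta> within polydisc d) sequentially"
proof -
  have "(\<lambda>n. w n i) \<longlonglongrightarrow> \<zeta> i" for i
  proof (cases "i < d")
    case False
    hence "w n i = \<zeta> i" for n
      using PiE_arb[OF w[of n, unfolded polydisc_def], of i] PiE_arb[OF \<zeta>[unfolded torus_def], of i] by simp
    thus ?thesis by simp
  qed (use lim in auto)
  hence "limitin (product_topology (\<lambda>i. euclidean) UNIV) w \<zeta> sequentially"
    by (simp add: limitin_componentwise)
  hence "w \<longlonglongrightarrow> \<zeta>" by (simp add: euclidean_product_topology)
  moreover have "w n \<noteq> \<zeta>" for n
    using polydisc_norm[OF w[of n], of 0] torus_norm[OF \<zeta>, of 0] d by force
  ultimately show ?thesis using w by (simp add: filterlim_at)
qed

lemma radial_approach: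
  assumes \<zeta>: "\<zeta> \<in> torus d" and d: "d \<ge> 1"
  shows "\<exists>a. (\<forall>n. a n \<in> polydisc d) \<and> (\<forall>i<d. (\<lambda>n. a n i) \<longlonglongrightarrow> \<zeta> i) \<and>
    filterlim a (at \<zeta> within polydisc d) sequentially"
proof -
  define a where "a = (\<lambda>n. \<lambda>i\<in>{..<d}. of_real (1 - 1 / (real n + 2)) * \<zeta> i)"
  have "norm (of_real (1 - 1 / (real n + 2)) :: complex) < 1" for n
    unfolding norm_of_real by (simp add: field_simps)
  hence a1: "a n \<in> polydisc d" for n
    using torus_norm[OF \<zeta>] by (auto simp: a_def polydisc_def norm_mult simp del: of_real_diff of_real_divide)
  have "(\<lambda>n. 1 - 1 / (real n + 2)) \<longlonglongrightarrow> 1" by real_asymp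
  hence "(\<lambda>n. of_real (1 - 1 / (real n + 2)) * \<zeta> i) \<longlonglongrightarrow> of_real 1 * \<zeta> i" for i
    by (intro tendsto_intros)
  hence a2: "(\<lambda>n. a n i) \<longlonglongrightarrow> \<zeta> i" if "i < d" for i
    using that by (simp add: a_def)
  show ?thesis using a1 a2 filterlim_polydisc[OF a1 \<zeta> d a2] by blast
qed

lemma boundary_ext_tendsto:
  assumes F: "extends_continuously d F" and \<zeta>: "\<zeta> \<in> torus d" and d: "d \<ge> 1"
  shows "(F \<longlongrightarrow> boundary_ext d F \<zeta>) (at \<zeta> within polydisc d)"
proof -
  obtain G where G: "continuous_on (closed_polydisc d) G" "\<And>z. z \<in> polydisc d \<Longrightarrow> G z = F z"
    using F by (auto simp: extends_continuously_def)
  have "\<zeta> \<in> closed_polydisc d"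
    using \<zeta> PiE_mono[of "{..<d}" "\<lambda>_. sphere (0::complex) 1" "\<lambda>_. cball 0 1"]
    unfolding torus_def closed_polydisc_def by (auto simp: sphere_cball)
  hence "(G \<longlongrightarrow> G \<zeta>) (at \<zeta> within closed_polydisc d)"
    using G(1) by (auto simp: continuous_on_def)
  hence "(G \<longlongrightarrow> G \<zeta>) (at \<zeta> within polydisc d)"
    by (rule tendsto_within_subset) (simp add: polydisc_def closed_polydisc_def PiE_mono)
  moreover have "eventually (\<lambda>x. G x = F x) (at \<zeta> within polydisc d)"
    using G(2) by (simp add: eventually_at_filter)
  ultimately have lim: "(F \<longlongrightarrow> G \<zeta>) (at \<zeta> within polydisc d)"
    by (rule Lim_transform_eventually)
  have "at \<zeta> within polydisc d \<noteq> bot"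
  proof
    assume bot: "at \<zeta> within polydisc d = bot"
    obtain a where "filterlim a (at \<zeta> within polydisc d) sequentially"
      using radial_approach[OF \<zeta> d] by (elim exE conjE)
    thus False unfolding bot filterlim_def
      using bot.extremum_uniqueI filtermap_bot_iff trivial_limit_sequentially by blast
  qed
  thus ?thesis unfolding boundary_ext_def using tendsto_Lim[OF _ lim] lim by simp
qed

lemma polydisc_approach_box:
  assumes lim: "(F \<longlongrightarrow> l) (at \<zeta> within polydisc d)" and \<zeta>: "\<zeta> \<in> torus d" and d: "d \<ge> 1"
    and \<eta>: "\<eta> > (0::real)"
  shows "\<exists>r>0. \<forall>x\<in>polydisc d. (\<forall>i<d. norm (x i - \<zeta> i) < r) \<longrightarrow> norm (F x - l :: complex) < \<eta>"
proof (rule ccontr)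
  assume "\<not> ?thesis"
  hence "\<forall>n. \<exists>x. x \<in> polydisc d \<and> (\<forall>i<d. norm (x i - \<zeta> i) < 1 / Suc n) \<and> \<not> norm (F x - l) < \<eta>"
    by (meson of_nat_0_less_iff zero_less_Suc zero_less_divide_1_iff)
  then obtain x where x: "\<And>n. x n \<in> polydisc d" "\<And>n i. i < d \<Longrightarrow> norm (x n i - \<zeta> i) < 1 / Suc n"
    "\<And>n. \<not> norm (F (x n) - l) < \<eta>" by metis
  have "(\<lambda>n. x n i) \<longlonglongrightarrow> \<zeta> i" if "i < d" for i
  proof (rule LIM_zero_cancel, rule Lim_null_comparison)
    show "\<forall>\<^sub>F n in sequentially. norm (x n i - \<zeta> i) \<le> 1 / Suc n"
      using x(2)[OF that] by (intro always_eventually) (auto simp: less_imp_le)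
    show "(\<lambda>n. 1 / real (Suc n)) \<longlonglongrightarrow> 0"
      using LIMSEQ_inverse_real_of_nat by (simp add: inverse_eq_divide)
  qed
  hence "filterlim x (at \<zeta> within polydisc d) sequentially"
    by (intro filterlim_polydisc x \<zeta> d)
  hence "(\<lambda>n. F (x n)) \<longlonglongrightarrow> l" by (rule filterlim_compose[OF lim])
  hence "(\<lambda>n. norm (F (x n) - l)) \<longlonglongrightarrow> 0" by (simp add: LIM_zero tendsto_norm_zero)
  hence "eventually (\<lambda>n. norm (F (x n) - l) < \<eta>) sequentially" using \<eta> by (rule order_tendstoD)
  thus False using x(3) by (simp add: eventually_sequentially)
qed

section \<open>Second order expansion at a boundary point\<close>

text \<open>Going from \<open>a\<close> to \<open>b\<close> by changing one coordinate after the other stays in a product of convex sets, so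
the mean value inequality in one variable suffices and no joint differentiability is needed.\<close>

lemma box_mean_value:
  fixes G :: "(nat \<Rightarrow> complex) \<Rightarrow> complex" and V :: "nat \<Rightarrow> complex set"
  assumes cvx: "\<And>i. i < d \<Longrightarrow> convex (V i)"
    and der: "\<And>x i. x \<in> PiE {..<d} V \<Longrightarrow> i < d \<Longrightarrow>
      ((\<lambda>w. G (x(i := w))) has_field_derivative G' i x) (at (x i))"
    and bd: "\<And>x i. x \<in> PiE {..<d} V \<Longrightarrow> i < d \<Longrightarrow> norm (G' i x - L i) \<le> \<eta>"
    and a: "a \<in> PiE {..<d} V" and b: "b \<in> PiE {..<d} V"
  shows "norm (G b - G a - (\<Sum>i<d. L i * (b i - a i))) \<le> \<eta> * (\<Sum>i<d. norm (b i - a i))"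
proof -
  \<comment> \<open>the path from \<open>a\<close> to \<open>b\<close> after \<open>m\<close> coordinates have been changed\<close>
  define x where "x = (\<lambda>m i. if i < m then b i else a i)"
  have x0: "x 0 = a" by (simp add: x_def)
  have xd: "x d = b"
    using PiE_arb[OF a] PiE_arb[OF b] by (auto simp: x_def fun_eq_iff)
  have step: "norm (G (x (Suc m)) - G (x m) - L m * (b m - a m)) \<le> \<eta> * norm (b m - a m)" if m: "m < d" for m
  proof -
    have mem: "(x m)(m := w) \<in> PiE {..<d} V" if "w \<in> V m" for w
      using a b that m by (auto simp: x_def PiE_def extensional_def Pi_iff)
    define h where "h = (\<lambda>w. G ((x m)(m := w)) - L m * w)"
    have "norm (h (b m) - h (a m)) \<le> \<eta> * norm (b m - a m)"
    proof (rule field_differentiable_bound[OF cvx[OF m]])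
      fix w assume w: "w \<in> V m"
      have "((\<lambda>u. G (((x m)(m := w))(m := u))) has_field_derivative G' m ((x m)(m := w))) (at (((x m)(m := w)) m))"
        by (rule der[OF mem[OF w] m])
      hence "((\<lambda>u. G ((x m)(m := u))) has_field_derivative G' m ((x m)(m := w))) (at w)" by simp
      hence "(h has_field_derivative G' m ((x m)(m := w)) - L m) (at w)"
        unfolding h_def by (auto intro!: derivative_eq_intros)
      thus "(h has_field_derivative G' m ((x m)(m := w)) - L m) (at w within V m)"
        by (rule has_field_derivative_at_within)
      show "norm (G' m ((x m)(m := w)) - L m) \<le> \<eta>"
        by (rule bd[OF mem[OF w] m])
    qed (use a b m in auto)
    moreover have "(x m)(m := b m) = x (Suc m)" "(x m)(m := a m) = x m"
      by (auto simp: x_def fun_eq_iff less_Suc_eq)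
    ultimately show ?thesis by (simp add: h_def algebra_simps)
  qed
  have "G b - G a = (\<Sum>m<d. G (x (Suc m)) - G (x m))"
    using sum_lessThan_telescope[of "\<lambda>m. G (x m)" d] by (simp only: x0 xd)
  hence "norm (G b - G a - (\<Sum>i<d. L i * (b i - a i))) = norm (\<Sum>m<d. G (x (Suc m)) - G (x m) - L m * (b m - a m))"
    by (simp add: sum_subtractf)
  also have "\<dots> \<le> (\<Sum>m<d. \<eta> * norm (b m - a m))"
    by (intro sum_norm_le step) simp
  finally show ?thesis by (simp add: sum_distrib_left)
qed

text \<open>A function on the open polydisc, its first and second complex partial derivatives, and the limits
\<open>f0\<close>, \<open>f1\<close>, \<open>f2\<close> of all these at the point \<open>\<zeta>\<close> of the torus.\<close>

locale boundary_C2 =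
  fixes d :: nat and F :: "(nat \<Rightarrow> complex) \<Rightarrow> complex"
    and F1 :: "nat \<Rightarrow> (nat \<Rightarrow> complex) \<Rightarrow> complex"
    and F2 :: "nat \<Rightarrow> nat \<Rightarrow> (nat \<Rightarrow> complex) \<Rightarrow> complex"
    and \<zeta> :: "nat \<Rightarrow> complex"
    and f0 :: complex and f1 :: "nat \<Rightarrow> complex" and f2 :: "nat \<Rightarrow> nat \<Rightarrow> complex"
  assumes d: "d \<ge> 1" and \<zeta>: "\<zeta> \<in> torus d"
    and der1: "\<And>x i. x \<in> polydisc d \<Longrightarrow> i < d \<Longrightarrow>
      ((\<lambda>w. F (x(i := w))) has_field_derivative F1 i x) (at (x i))"
    and der2: "\<And>x i k. x \<in> polydisc d \<Longrightarrow> i < d \<Longrightarrow> k < d \<Longrightarrow>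
      ((\<lambda>w. F1 i (x(k := w))) has_field_derivative F2 i k x) (at (x k))"
    and lim0: "(F \<longlongrightarrow> f0) (at \<zeta> within polydisc d)"
    and lim1: "\<And>i. i < d \<Longrightarrow> (F1 i \<longlongrightarrow> f1 i) (at \<zeta> within polydisc d)"
    and lim2: "\<And>i k. i < d \<Longrightarrow> k < d \<Longrightarrow> (F2 i k \<longlongrightarrow> f2 i k) (at \<zeta> within polydisc d)"
    and sym: "\<And>i k. i < d \<Longrightarrow> k < d \<Longrightarrow> f2 i k = f2 k i"
begin

definition box :: "real \<Rightarrow> (nat \<Rightarrow> complex) set" where
  "box \<delta> = PiE {..<d} (\<lambda>i. ball 0 1 \<inter> ball (\<zeta> i) \<delta>)"

lemma box_iff: "x \<in> box \<delta> \<longleftrightarrow> x \<in> polydisc d \<and> (\<forall>i<d. norm (x i - \<zeta> i) < \<delta>)"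
  by (auto simp: box_def polydisc_def PiE_def Pi_iff dist_norm norm_minus_commute)

lemma box_approach:
  assumes "\<delta> > 0"
  shows "\<exists>a. (\<forall>n. a n \<in> box \<delta>) \<and> (\<forall>i<d. (\<lambda>n. a n i) \<longlonglongrightarrow> \<zeta> i) \<and>
    filterlim a (at \<zeta> within polydisc d) sequentially"
proof -
  obtain a where a: "\<forall>n. a n \<in> polydisc d" "\<forall>i<d. (\<lambda>n. a n i) \<longlonglongrightarrow> \<zeta> i"
    "filterlim a (at \<zeta> within polydisc d) sequentially"
    using radial_approach[OF \<zeta> d] by (elim exE conjE)
  have "eventually (\<lambda>n. \<forall>i\<in>{..<d}. norm (a n i - \<zeta> i) < \<delta>) sequentially"
  proof (intro eventually_ball_finite ballI)
    fix i assume "i \<in> {..<d}"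
    hence "(\<lambda>n. norm (a n i - \<zeta> i)) \<longlonglongrightarrow> 0" using a(2) by (simp add: LIM_zero tendsto_norm_zero)
    thus "eventually (\<lambda>n. norm (a n i - \<zeta> i) < \<delta>) sequentially"
      using assms by (rule order_tendstoD)
  qed simp
  then obtain n0 where n0: "\<And>n. n \<ge> n0 \<Longrightarrow> \<forall>i<d. norm (a n i - \<zeta> i) < \<delta>"
    by (auto simp: eventually_sequentially)
  have 1: "\<forall>n. a (n + n0) \<in> box \<delta>" using a(1) n0 by (simp add: box_iff)
  have 2: "\<forall>i<d. (\<lambda>n. a (n + n0) i) \<longlonglongrightarrow> \<zeta> i"
    using a(2) LIMSEQ_ignore_initial_segment by blast
  have 3: "filterlim (\<lambda>n. a (n + n0)) (at \<zeta> within polydisc d) sequentially"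
    using filterlim_compose[OF a(3) filterlim_add_const_nat_at_top[of n0]] by simp
  show ?thesis using 1 2 3 by (intro exI[of _ "\<lambda>n. a (n + n0)"] conjI)
qed

text \<open>The mean value inequality is applied between interior points; then the base point tends to \<open>\<zeta>\<close>.\<close>

lemma boundary_taylor_1:
  assumes d2: "\<And>x. x \<in> box \<delta> \<Longrightarrow> (\<And>k. k < d \<Longrightarrow> norm (F2 i k x - f2 i k) \<le> \<eta>)"
    and i: "i < d" and x: "x \<in> box \<delta>" and \<delta>: "\<delta> > 0" and \<eta>: "\<eta> \<ge> 0"
  shows "norm (F1 i x - f1 i - (\<Sum>k<d. f2 i k * (x k - \<zeta> k))) \<le> \<eta> * (real d * \<delta>)"
proof -
  obtain a where a: "\<forall>n. a n \<in> box \<delta>" "\<forall>i<d. (\<lambda>n. a n i) \<longlonglongrightarrow> \<zeta> i"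
    "filterlim a (at \<zeta> within polydisc d) sequentially"
    using box_approach[OF \<delta>] by (elim exE conjE)
  have "norm (F1 i x - F1 i (a n) - (\<Sum>k<d. f2 i k * (x k - a n k))) \<le> \<eta> * (\<Sum>k<d. norm (x k - a n k))" for n
  proof (rule box_mean_value[where V = "\<lambda>i. ball 0 1 \<inter> ball (\<zeta> i) \<delta>" and G' = "F2 i"])
    show "((\<lambda>w. F1 i (y(k := w))) has_field_derivative F2 i k y) (at (y k))"
      if "y \<in> PiE {..<d} (\<lambda>i. ball 0 1 \<inter> ball (\<zeta> i) \<delta>)" "k < d" for y k
      using that i by (intro der2) (auto simp: box_iff box_def[symmetric])
    show "norm (F2 i k y - f2 i k) \<le> \<eta>"
      if "y \<in> PiE {..<d} (\<lambda>i. ball 0 1 \<inter> ball (\<zeta> i) \<delta>)" "k < d" for y k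
      using that d2 unfolding box_def by blast
  qed (use a x in \<open>auto simp: box_def[symmetric] intro: convex_Int convex_ball\<close>)
  moreover have "(\<lambda>n. norm (F1 i x - F1 i (a n) - (\<Sum>k<d. f2 i k * (x k - a n k)))) \<longlonglongrightarrow>
      norm (F1 i x - f1 i - (\<Sum>k<d. f2 i k * (x k - \<zeta> k)))"
    using a(2) by (intro tendsto_intros filterlim_compose[OF lim1[OF i] a(3)]) auto
  moreover have "(\<lambda>n. \<eta> * (\<Sum>k<d. norm (x k - a n k))) \<longlonglongrightarrow> \<eta> * (\<Sum>k<d. norm (x k - \<zeta> k))"
    using a(2) by (intro tendsto_intros) auto
  ultimately have "norm (F1 i x - f1 i - (\<Sum>k<d. f2 i k * (x k - \<zeta> k))) \<le> \<eta> * (\<Sum>k<d. norm (x k - \<zeta> k))"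
    by (intro LIMSEQ_le[of _ _ "\<lambda>n. \<eta> * (\<Sum>k<d. norm (x k - a n k))"]) blast+
  also have "\<dots> \<le> \<eta> * (\<Sum>k<d. \<delta>)"
    using x \<eta> by (intro mult_left_mono sum_mono) (auto simp: box_iff less_imp_le)
  finally show ?thesis by simp
qed

text \<open>The partial derivatives of the difference between \<open>F\<close> and its candidate Taylor polynomial are the
quantities estimated in \<open>boundary_taylor_1\<close>. This is where the symmetry of \<open>f2\<close> enters: it makes the
derivative of the quadratic form a single sum.\<close>

lemma boundary_taylor_2_box:
  assumes d2: "\<And>x i k. x \<in> box \<delta> \<Longrightarrow> i < d \<Longrightarrow> k < d \<Longrightarrow> norm (F2 i k x - f2 i k) \<le> \<eta>"
    and x: "x \<in> box \<delta>" and \<delta>: "\<delta> > 0" and \<eta>: "\<eta> \<ge> 0"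
  shows "norm (F x - f0 - (\<Sum>i<d. f1 i * (x i - \<zeta> i))
     - (\<Sum>i<d. \<Sum>k<d. f2 i k * (x i - \<zeta> i) * (x k - \<zeta> k)) / 2) \<le> \<eta> * (real d * \<delta>)\<^sup>2"
proof -
  define q where "q = (\<lambda>x. (\<Sum>i<d. f1 i * (x i - \<zeta> i)) + (\<Sum>i<d. \<Sum>k<d. f2 i k * (x i - \<zeta> i) * (x k - \<zeta> k)) / 2)"
  define q1 where "q1 = (\<lambda>j (x::nat\<Rightarrow>complex). f1 j + (\<Sum>k<d. f2 j k * (x k - \<zeta> k)))"
  have dq: "((\<lambda>w. q (y(j := w))) has_field_derivative q1 j y) (at (y j))" if j: "j < d" for y j
  proof -
    have c: "((\<lambda>w. (y(j := w)) i - \<zeta> i) has_field_derivative (if i = j then 1 else 0)) (at u)" for i u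
      by (cases "i = j") (auto intro!: derivative_eq_intros)
    have s1: "((\<lambda>w. \<Sum>i<d. f1 i * ((y(j := w)) i - \<zeta> i)) has_field_derivative f1 j) (at (y j))"
    proof -
      have "((\<lambda>w. \<Sum>i<d. f1 i * ((y(j := w)) i - \<zeta> i)) has_field_derivative (\<Sum>i<d. f1 i * (if i = j then 1 else 0))) (at (y j))"
        by (intro DERIV_sum DERIV_cmult c)
      thus ?thesis using j by (simp add: if_distrib sum.delta cong: if_cong)
    qed
    have s2: "((\<lambda>w. \<Sum>i<d. \<Sum>k<d. f2 i k * ((y(j := w)) i - \<zeta> i) * ((y(j := w)) k - \<zeta> k)) has_field_derivative
        2 * (\<Sum>k<d. f2 j k * (y k - \<zeta> k))) (at (y j))"
    proof -
      have "((\<lambda>w. \<Sum>i<d. \<Sum>k<d. f2 i k * ((y(j := w)) i - \<zeta> i) * ((y(j := w)) k - \<zeta> k)) has_field_derivative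
        (\<Sum>i<d. \<Sum>k<d. (f2 i k * (if i = j then 1 else 0)) * ((y(j := y j)) k - \<zeta> k)
            + (if k = j then 1 else 0) * (f2 i k * ((y(j := y j)) i - \<zeta> i)))) (at (y j))"
        by (intro DERIV_sum DERIV_mult DERIV_cmult c)
      also have "(\<Sum>i<d. \<Sum>k<d. (f2 i k * (if i = j then 1 else 0)) * ((y(j := y j)) k - \<zeta> k)
            + (if k = j then 1 else 0) * (f2 i k * ((y(j := y j)) i - \<zeta> i)))
          = (\<Sum>k<d. \<Sum>i<d. if i = j then f2 i k * (y k - \<zeta> k) else 0)
            + (\<Sum>i<d. \<Sum>k<d. if k = j then f2 i k * (y i - \<zeta> i) else 0)"
        unfolding sum.distrib by (subst sum.swap) (intro arg_cong2[of _ _ _ _ "(+)"] sum.cong refl; simp)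
      also have "\<dots> = (\<Sum>k<d. f2 j k * (y k - \<zeta> k)) + (\<Sum>i<d. f2 i j * (y i - \<zeta> i))"
        using j by (simp add: sum.delta)
      also have "(\<Sum>i<d. f2 i j * (y i - \<zeta> i)) = (\<Sum>k<d. f2 j k * (y k - \<zeta> k))"
        using sym j by (intro sum.cong) auto
      finally show ?thesis by simp
    qed
    show ?thesis unfolding q_def q1_def
      using DERIV_add[OF s1 DERIV_cdivide[OF s2, of 2]] by simp
  qed
  obtain a where a: "\<forall>n. a n \<in> box \<delta>" "\<forall>i<d. (\<lambda>n. a n i) \<longlonglongrightarrow> \<zeta> i"
    "filterlim a (at \<zeta> within polydisc d) sequentially"
    using box_approach[OF \<delta>] by (elim exE conjE)
  have "norm ((F x - q x) - (F (a n) - q (a n)) - (\<Sum>k<d. 0 * (x k - a n k)))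
      \<le> \<eta> * (real d * \<delta>) * (\<Sum>k<d. norm (x k - a n k))" for n
  proof (rule box_mean_value[where V = "\<lambda>i. ball 0 1 \<inter> ball (\<zeta> i) \<delta>" and G = "\<lambda>x. F x - q x"
        and G' = "\<lambda>i y. F1 i y - q1 i y" and L = "\<lambda>_. 0"])
    fix y k assume y: "y \<in> PiE {..<d} (\<lambda>i. ball 0 1 \<inter> ball (\<zeta> i) \<delta>)" and k: "k < d"
    have yb: "y \<in> box \<delta>" using y by (simp add: box_def)
    show "((\<lambda>w. F (y(k := w)) - q (y(k := w))) has_field_derivative F1 k y - q1 k y) (at (y k))"
      using yb k by (intro DERIV_diff der1 dq) (auto simp: box_iff)
    show "norm (F1 k y - q1 k y - 0) \<le> \<eta> * (real d * \<delta>)"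
      using boundary_taylor_1[of \<delta> k \<eta> y] d2 k yb \<delta> \<eta> by (simp add: q1_def diff_diff_eq)
  qed (use a x in \<open>auto simp: box_def[symmetric] intro: convex_Int convex_ball\<close>)
  hence "norm ((F x - q x) - (F (a n) - q (a n))) \<le> \<eta> * (real d * \<delta>) * (\<Sum>k<d. norm (x k - a n k))" for n
    by simp
  moreover have "(\<lambda>n. norm ((F x - q x) - (F (a n) - q (a n)))) \<longlonglongrightarrow> norm ((F x - q x) - (f0 - q \<zeta>))"
    unfolding q_def using a(2) by (intro tendsto_intros filterlim_compose[OF lim0 a(3)]) auto
  moreover have "(\<lambda>n. \<eta> * (real d * \<delta>) * (\<Sum>k<d. norm (x k - a n k))) \<longlonglongrightarrow> \<eta> * (real d * \<delta>) * (\<Sum>k<d. norm (x k - \<zeta> k))"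
    using a(2) by (intro tendsto_intros) auto
  ultimately have "norm ((F x - q x) - (f0 - q \<zeta>)) \<le> \<eta> * (real d * \<delta>) * (\<Sum>k<d. norm (x k - \<zeta> k))"
    by (intro LIMSEQ_le[of _ _ "\<lambda>n. \<eta> * (real d * \<delta>) * (\<Sum>k<d. norm (x k - a n k))"]) blast+
  also have "\<dots> \<le> \<eta> * (real d * \<delta>) * (\<Sum>k<d. \<delta>)"
    using x \<eta> \<delta> by (intro mult_left_mono sum_mono) (auto simp: box_iff less_imp_le)
  finally show ?thesis by (simp add: q_def power2_eq_square mult_ac diff_diff_eq add_ac)
qed

lemma boundary_taylor_2:
  assumes \<eta>: "\<eta> > 0"
  shows "\<exists>r>0. \<forall>x\<in>polydisc d. \<forall>\<delta>. 0 < \<delta> \<and> \<delta> \<le> r \<longrightarrow> (\<forall>i<d. norm (x i - \<zeta> i) < \<delta>) \<longrightarrow>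
    norm (F x - f0 - (\<Sum>i<d. f1 i * (x i - \<zeta> i))
     - (\<Sum>i<d. \<Sum>k<d. f2 i k * (x i - \<zeta> i) * (x k - \<zeta> k)) / 2) \<le> \<eta> * \<delta>\<^sup>2"
proof -
  define \<eta>' where "\<eta>' = \<eta> / (real d)\<^sup>2"
  have \<eta>': "\<eta>' > 0" using \<eta> d by (simp add: \<eta>'_def)
  have "\<forall>p\<in>{..<d}\<times>{..<d}. \<exists>r>0. \<forall>x\<in>polydisc d. (\<forall>i<d. norm (x i - \<zeta> i) < r) \<longrightarrow>
      norm (F2 (fst p) (snd p) x - f2 (fst p) (snd p)) < \<eta>'"
    by (intro ballI polydisc_approach_box lim2 \<zeta> d \<eta>') auto
  then obtain R where R: "\<And>p. p \<in> {..<d}\<times>{..<d} \<Longrightarrow> R p > 0 \<and> (\<forall>x\<in>polydisc d. (\<forall>i<d. norm (x i - \<zeta> i) < R p) \<longrightarrow>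
      norm (F2 (fst p) (snd p) x - f2 (fst p) (snd p)) < \<eta>')"
    by (metis (no_types, lifting))
  define r where "r = Min (R ` ({..<d}\<times>{..<d}))"
  have ne: "{..<d}\<times>{..<d} \<noteq> {}" using d by (auto simp: lessThan_empty_iff)
  have "r > 0" unfolding r_def using ne R by (subst Min_gr_iff) auto
  moreover have "norm (F x - f0 - (\<Sum>i<d. f1 i * (x i - \<zeta> i))
     - (\<Sum>i<d. \<Sum>k<d. f2 i k * (x i - \<zeta> i) * (x k - \<zeta> k)) / 2) \<le> \<eta> * \<delta>\<^sup>2"
    if x: "x \<in> polydisc d" "\<forall>i<d. norm (x i - \<zeta> i) < \<delta>" and \<delta>: "0 < \<delta>" "\<delta> \<le> r" for x \<delta>
  proof -
    have "norm (F2 i k y - f2 i k) \<le> \<eta>'" if y: "y \<in> box \<delta>" and ik: "i < d" "k < d" for y i k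
    proof -
      have "r \<le> R (i, k)" unfolding r_def using ik by (intro Min_le) auto
      hence "\<forall>j<d. norm (y j - \<zeta> j) < R (i, k)" using y \<delta> by (force simp: box_iff)
      thus ?thesis using R[of "(i, k)"] y ik by (auto simp: box_iff less_imp_le)
    qed
    hence "norm (F x - f0 - (\<Sum>i<d. f1 i * (x i - \<zeta> i))
     - (\<Sum>i<d. \<Sum>k<d. f2 i k * (x i - \<zeta> i) * (x k - \<zeta> k)) / 2) \<le> \<eta>' * (real d * \<delta>)\<^sup>2"
      using x \<delta> \<eta>' by (intro boundary_taylor_2_box) (auto simp: box_iff)
    also have "\<dots> = \<eta> * \<delta>\<^sup>2" using d by (simp add: \<eta>'_def power_mult_distrib)
    finally show ?thesis .
  qed
  ultimately show ?thesis by blast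
qed

text \<open>The Taylor expansion along points \<open>w = \<zeta> + \<delta> a + \<delta>\<^sup>2 b + o(\<delta>\<^sup>2)\<close>: the velocity \<open>a\<close> enters
quadratically and the acceleration \<open>b\<close> linearly in the coefficient of \<open>\<delta>\<^sup>2\<close>.\<close>

lemma second_order_expansion:
  assumes w: "\<And>n. w n \<in> polydisc d" and \<delta>: "\<And>n. \<delta> n > 0" "\<delta> \<longlonglongrightarrow> 0"
    and exp: "\<And>i. i < d \<Longrightarrow> (\<lambda>n. (w n i - \<zeta> i - of_real (\<delta> n) * a i) / of_real ((\<delta> n)\<^sup>2)) \<longlonglongrightarrow> b i"
  shows "(\<lambda>n. (F (w n) - f0 - of_real (\<delta> n) * (\<Sum>i<d. f1 i * a i)) / of_real ((\<delta> n)\<^sup>2)) \<longlonglongrightarrow>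
    (\<Sum>i<d. f1 i * b i) + (\<Sum>i<d. \<Sum>k<d. f2 i k * a i * a k) / 2"
proof -
  define y where "y = (\<lambda>n i. (w n i - \<zeta> i) / of_real (\<delta> n))"
  have y: "(\<lambda>n. y n i) \<longlonglongrightarrow> a i" if "i < d" for i
  proof -
    have "(\<lambda>n. of_real (\<delta> n) * ((w n i - \<zeta> i - of_real (\<delta> n) * a i) / of_real ((\<delta> n)\<^sup>2)) + a i) \<longlonglongrightarrow> of_real 0 * b i + a i"
      by (intro tendsto_intros \<delta> exp that)
    moreover have "of_real (\<delta> n) * ((w n i - \<zeta> i - of_real (\<delta> n) * a i) / of_real ((\<delta> n)\<^sup>2)) + a i = y n i" for n
      using \<delta>(1)[of n] by (simp add: y_def field_simps power2_eq_square)
    ultimately show ?thesis by simp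
  qed
  define R where "R = (\<lambda>x. F x - f0 - (\<Sum>i<d. f1 i * (x i - \<zeta> i))
     - (\<Sum>i<d. \<Sum>k<d. f2 i k * (x i - \<zeta> i) * (x k - \<zeta> k)) / 2)"
  \<comment> \<open>a common bound for the increments in units of \<open>\<delta> n\<close>, eventually\<close>
  define C where "C = 1 + (\<Sum>i<d. norm (a i))"
  have C: "C \<ge> 1" unfolding C_def by (simp add: sum_nonneg)
  have evC: "eventually (\<lambda>n. \<forall>i\<in>{..<d}. norm (y n i) < C) sequentially"
  proof (intro eventually_ball_finite ballI)
    fix i assume i: "i \<in> {..<d}"
    have "norm (a i) \<le> (\<Sum>i<d. norm (a i))" using i by (intro member_le_sum) auto
    hence "norm (a i) < C" by (simp add: C_def)
    moreover have "(\<lambda>n. norm (y n i)) \<longlonglongrightarrow> norm (a i)" using y i by (intro tendsto_intros) auto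
    ultimately show "eventually (\<lambda>n. norm (y n i) < C) sequentially" by (intro order_tendstoD)
  qed simp
  have Rlim: "(\<lambda>n. R (w n) / of_real ((\<delta> n)\<^sup>2)) \<longlonglongrightarrow> 0"
  proof (rule tendstoI)
    fix e :: real assume e: "e > 0"
    define \<eta> where "\<eta> = e / (2 * C\<^sup>2)"
    have \<eta>: "\<eta> > 0" using e C by (simp add: \<eta>_def)
    obtain r where r: "r > 0" "\<And>x \<rho>. x \<in> polydisc d \<Longrightarrow> 0 < \<rho> \<Longrightarrow> \<rho> \<le> r \<Longrightarrow> (\<forall>i<d. norm (x i - \<zeta> i) < \<rho>) \<Longrightarrow>
        norm (R x) \<le> \<eta> * \<rho>\<^sup>2"
      using boundary_taylor_2[OF \<eta>] unfolding R_def by blast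
    have "(\<lambda>n. C * \<delta> n) \<longlonglongrightarrow> C * 0" by (intro tendsto_intros \<delta>)
    hence "eventually (\<lambda>n. C * \<delta> n < r) sequentially" using r(1) by (intro order_tendstoD) auto
    with evC show "eventually (\<lambda>n. dist (R (w n) / of_real ((\<delta> n)\<^sup>2)) 0 < e) sequentially"
    proof eventually_elim
      case (elim n)
      have "norm (w n i - \<zeta> i) < C * \<delta> n" if "i < d" for i
        using elim(1) that \<delta>(1)[of n] by (auto simp: y_def norm_divide divide_simps mult_ac)
      hence "norm (R (w n)) \<le> \<eta> * (C * \<delta> n)\<^sup>2"
        using elim(2) C \<delta>(1)[of n] by (intro r w) auto
      also have "\<dots> = (e / 2) * (\<delta> n)\<^sup>2" using C by (simp add: \<eta>_def power_mult_distrib)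
      also have "\<dots> < e * (\<delta> n)\<^sup>2" using e \<delta>(1)[of n] by (intro mult_strict_right_mono) auto
      finally show ?case using \<delta>(1)[of n] by (simp add: norm_divide norm_power divide_simps)
    qed
  qed
  have "(\<lambda>n. R (w n) / of_real ((\<delta> n)\<^sup>2)
      + (\<Sum>i<d. f1 i * ((w n i - \<zeta> i - of_real (\<delta> n) * a i) / of_real ((\<delta> n)\<^sup>2)))
      + (\<Sum>i<d. \<Sum>k<d. f2 i k * y n i * y n k) / 2) \<longlonglongrightarrow>
     0 + (\<Sum>i<d. f1 i * b i) + (\<Sum>i<d. \<Sum>k<d. f2 i k * a i * a k) / 2"
    by (intro tendsto_intros Rlim exp y) auto
  moreover have "R (w n) / of_real ((\<delta> n)\<^sup>2)
      + (\<Sum>i<d. f1 i * ((w n i - \<zeta> i - of_real (\<delta> n) * a i) / of_real ((\<delta> n)\<^sup>2)))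
      + (\<Sum>i<d. \<Sum>k<d. f2 i k * y n i * y n k) / 2
      = (F (w n) - f0 - of_real (\<delta> n) * (\<Sum>i<d. f1 i * a i)) / of_real ((\<delta> n)\<^sup>2)" for n
  proof -
    let ?D = "of_real ((\<delta> n)\<^sup>2) :: complex"
    have "(\<Sum>i<d. f1 i * ((w n i - \<zeta> i - of_real (\<delta> n) * a i) / ?D))
      = ((\<Sum>i<d. f1 i * (w n i - \<zeta> i)) - of_real (\<delta> n) * (\<Sum>i<d. f1 i * a i)) / ?D"
      by (simp add: sum_divide_distrib sum_distrib_left sum_subtractf diff_divide_distrib right_diff_distrib mult_ac)
    moreover have "(\<Sum>i<d. \<Sum>k<d. f2 i k * y n i * y n k) / 2 = (\<Sum>i<d. \<Sum>k<d. f2 i k * (w n i - \<zeta> i) * (w n k - \<zeta> k)) / 2 / ?D"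
      unfolding sum_divide_distrib by (intro sum.cong refl) (simp add: y_def power2_eq_square)
    ultimately show ?thesis by (simp add: R_def diff_divide_distrib add_divide_distrib)
  qed
  ultimately show ?thesis by simp
qed

end

section \<open>Boundary data of Bohr lifts\<close>

lemma boundary_ext_cong:
  assumes "\<And>x. x \<in> polydisc d \<Longrightarrow> F x = G x"
  shows "boundary_ext d F \<zeta> = boundary_ext d G \<zeta>"
proof -
  have "(F \<longlongrightarrow> l) (at \<zeta> within polydisc d) \<longleftrightarrow> (G \<longlongrightarrow> l) (at \<zeta> within polydisc d)" for l
    using assms by (intro tendsto_cong) (simp add: eventually_at_filter)
  thus ?thesis by (simp only: boundary_ext_def Topological_Spaces.Lim_def)
qed

lemma extends_continuously_cong:
  "(\<And>x. x \<in> polydisc d \<Longrightarrow> F x = G x) \<Longrightarrow> extends_continuously d F \<longleftrightarrow> extends_continuously d G"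
  by (simp add: extends_continuously_def)

text \<open>In the polydisc the real partial derivatives in the direction \<open>1\<close>, whose extension to the boundary is
assumed, are the complex ones, and mixed derivatives commute because both orders have the same
coefficients.\<close>

lemma bohr_lift_boundary_C2:
  assumes ac: "\<And>\<sigma>. \<sigma> > 0 \<Longrightarrow> abs_conv c \<sigma>" and ext: "extends_C d 2 (bohr_lift d c)"
    and \<zeta>: "\<zeta> \<in> torus d" and d: "d \<ge> 1"
  defines "F \<equiv> bohr_lift d c"
  shows "boundary_C2 d F (\<lambda>i. complex_partial i F) (\<lambda>i k. complex_partial k (complex_partial i F)) \<zeta>
    (boundary_ext d F \<zeta>) (\<lambda>i. boundary_ext d (complex_partial i F) \<zeta>)
    (\<lambda>i k. boundary_ext d (complex_partial k (complex_partial i F)) \<zeta>)"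
proof -
  define a where "a = (\<lambda>\<alpha>. c (\<Prod>i<d. nth_prime i ^ \<alpha> i))"
  have a: "polydisc_summable d a" unfolding a_def by (rule bohr_lift_summable[OF ac])
  have F: "F x = monomial_series d a x" for x by (simp add: F_def a_def bohr_lift_monomial_series)
  note sa = polydisc_summable_derivative[OF a]
  note d1 = complex_partial_monomial_series[OF a F]
  have d2: "((\<lambda>w. complex_partial i F (x(k := w))) has_field_derivative
        monomial_series d (derivative_coeffs k (derivative_coeffs i a)) x) (at (x k))"
    "complex_partial k (complex_partial i F) x = monomial_series d (derivative_coeffs k (derivative_coeffs i a)) x"
    if "x \<in> polydisc d" "i < d" "k < d" for x i k
    using complex_partial_monomial_series[of d "derivative_coeffs i a" "complex_partial i F" x k] sa d1(2) that
    by auto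
  have rp1: "real_partial i 1 F x = complex_partial i F x" if "x \<in> polydisc d" "i < d" for x i
    using real_partial_eq_complex_derivative[OF d1(1)[OF that]] d1(2)[OF that] by simp
  have rp2: "real_partial k 1 (real_partial i 1 F) x = complex_partial k (complex_partial i F) x"
    if "x \<in> polydisc d" "i < d" "k < d" for x i k
  proof -
    have "real_partial i 1 F y = monomial_series d (derivative_coeffs i a) y" if "y \<in> polydisc d" for y
      using rp1 d1(2) that \<open>i < d\<close> by simp
    from complex_partial_monomial_series(1)[OF sa[OF \<open>i < d\<close>] this that(1,3)]
    show ?thesis using real_partial_eq_complex_derivative d2(2)[OF that] by simp
  qed
  have e0: "extends_continuously d F" and e1: "\<And>i. i < d \<Longrightarrow> extends_continuously d (real_partial i 1 F)"
    and e2: "\<And>i k. i < d \<Longrightarrow> k < d \<Longrightarrow> extends_continuously d (real_partial k 1 (real_partial i 1 F))"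
    using ext unfolding F_def numeral_2_eq_2 by auto
  have e1': "extends_continuously d (complex_partial i F)" if "i < d" for i
    using e1[OF that] extends_continuously_cong[of d "real_partial i 1 F" "complex_partial i F"] rp1 that by blast
  have e2': "extends_continuously d (complex_partial k (complex_partial i F))" if "i < d" "k < d" for i k
    using e2[OF that] extends_continuously_cong[of d "real_partial k 1 (real_partial i 1 F)" "complex_partial k (complex_partial i F)"]
      rp2 that by blast
  show ?thesis
  proof
    show "1 \<le> d" "\<zeta> \<in> torus d" by (fact d \<zeta>)+
    show "((\<lambda>w. F (x(i := w))) has_field_derivative complex_partial i F x) (at (x i))"
      if "x \<in> polydisc d" "i < d" for x i
      using d1[OF that] by simp
    show "((\<lambda>w. complex_partial i F (x(k := w))) has_field_derivative complex_partial k (complex_partial i F) x) (at (x k))"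
      if "x \<in> polydisc d" "i < d" "k < d" for x i k
      using d2[OF that] by simp
    show "(F \<longlongrightarrow> boundary_ext d F \<zeta>) (at \<zeta> within polydisc d)"
      by (intro boundary_ext_tendsto e0 \<zeta> d)
    show "(complex_partial i F \<longlongrightarrow> boundary_ext d (complex_partial i F) \<zeta>) (at \<zeta> within polydisc d)" if "i < d" for i
      by (intro boundary_ext_tendsto e1' \<zeta> d that)
    show "(complex_partial k (complex_partial i F) \<longlongrightarrow> boundary_ext d (complex_partial k (complex_partial i F)) \<zeta>)
        (at \<zeta> within polydisc d)" if "i < d" "k < d" for i k
      by (intro boundary_ext_tendsto e2' \<zeta> d that)
    show "boundary_ext d (complex_partial k (complex_partial i F)) \<zeta> = boundary_ext d (complex_partial i (complex_partial k F)) \<zeta>"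
      if "i < d" "k < d" for i k
      using d2(2) that by (intro boundary_ext_cong) (simp add: derivative_coeffs_commute)
  qed
qed

text \<open>Multi-indices of order at most two are encoded by pairs \<open>i \<le> k\<close>; an index that is at least \<open>d\<close>
stands for no derivative.\<close>

lemma fold_iterate_pair:
  fixes g :: "nat \<Rightarrow> 'a \<Rightarrow> 'a"
  assumes "i \<le> k" "\<And>l. l < d \<Longrightarrow> \<alpha> l = of_bool (l = i) + of_bool (l = k)"
  shows "fold (\<lambda>l. g l ^^ \<alpha> l) [0..<d] F = (if k < d then g k (g i F) else if i < d then g i F else F)"
  using assms(2)
proof (induction d)
  case (Suc d)
  have "fold (\<lambda>l. g l ^^ \<alpha> l) [0..<Suc d] F
      = (g d ^^ \<alpha> d) (if k < d then g k (g i F) else if i < d then g i F else F)"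
    using Suc by simp
  thus ?case using Suc.prems[of d] assms(1) by (auto simp: less_Suc_eq)
qed simp

lemma multi_index_le_2:
  fixes \<alpha> :: "nat \<Rightarrow> nat"
  assumes "(\<Sum>i<d. \<alpha> i) \<le> 2"
  shows "\<exists>i k. i \<le> k \<and> (\<forall>l<d. \<alpha> l = of_bool (l = i) + of_bool (l = k))"
proof -
  have dec: "\<exists>i \<beta>. (\<forall>l<d. \<alpha> l = of_bool (l = i) + \<beta> l) \<and> (\<Sum>l<d. \<beta> l) \<le> m"
    if sum: "(\<Sum>l<d. \<alpha> l) \<le> Suc m" for \<alpha> :: "nat \<Rightarrow> nat" and m
  proof (cases "\<exists>i<d. \<alpha> i > 0")
    case True
    then obtain i where i: "i < d" "\<alpha> i > 0" by blast
    define \<beta> where "\<beta> = \<alpha>(i := \<alpha> i - 1)"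
    have \<beta>: "\<alpha> l = of_bool (l = i) + \<beta> l" for l using i by (simp add: \<beta>_def)
    have "(\<Sum>l<d. \<alpha> l) = (\<Sum>l<d. of_bool (l = i)) + (\<Sum>l<d. \<beta> l)"
      by (subst \<beta>) (simp add: sum.distrib)
    moreover have "(\<Sum>l<d. of_bool (l = i) :: nat) = 1" using i by simp
    ultimately show ?thesis using \<beta> sum by (intro exI[of _ i] exI[of _ \<beta>]) auto
  next
    case False
    hence "\<forall>l<d. \<alpha> l = 0" by auto
    thus ?thesis by (intro exI[of _ d] exI[of _ "\<lambda>_. 0"]) auto
  qed
  obtain i \<beta> where 1: "\<forall>l<d. \<alpha> l = of_bool (l = i) + \<beta> l" "(\<Sum>l<d. \<beta> l) \<le> 1"
    using dec[of \<alpha> 1] assms by (auto simp: numeral_2_eq_2)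
  obtain k \<gamma> where 2: "\<forall>l<d. \<beta> l = of_bool (l = k) + \<gamma> l" "(\<Sum>l<d. \<gamma> l) \<le> 0"
    using dec[of \<beta> 0] 1(2) unfolding One_nat_def by blast
  hence eq: "\<alpha> l = of_bool (l = i) + of_bool (l = k)" if "l < d" for l using 1(1) 2 that by simp
  show ?thesis
  proof (cases "i \<le> k")
    case True thus ?thesis using eq by blast
  next
    case False thus ?thesis using eq by (intro exI[of _ k] exI[of _ i]) simp
  qed
qed

text \<open>Only the mixed derivatives with \<open>i \<le> k\<close> occur, because a multi-index applies the derivatives in
increasing order of the coordinates.\<close>

lemma same_second_order_data_iff:
  "same_second_order_data d F G \<zeta> \<longleftrightarrow> boundary_ext d F \<zeta> = boundary_ext d G \<zeta> \<and>
    (\<forall>i<d. boundary_ext d (complex_partial i F) \<zeta> = boundary_ext d (complex_partial i G) \<zeta>) \<and>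
    (\<forall>k<d. \<forall>i\<le>k. boundary_ext d (complex_partial k (complex_partial i F)) \<zeta> =
       boundary_ext d (complex_partial k (complex_partial i G)) \<zeta>)" (is "?L \<longleftrightarrow> ?R")
proof
  assume L: ?L
  define A :: "nat \<Rightarrow> nat \<Rightarrow> nat \<Rightarrow> nat" where "A = (\<lambda>i k. \<lambda>l\<in>{..<d}. of_bool (l = i) + of_bool (l = k))"
  have "boundary_ext d (if k < d then complex_partial k (complex_partial i F) else if i < d then complex_partial i F else F) \<zeta>
      = boundary_ext d (if k < d then complex_partial k (complex_partial i G) else if i < d then complex_partial i G else G) \<zeta>"
    if "i \<le> k" for i k
  proof -
    have mp: "multi_partial d (A i k) H = (if k < d then complex_partial k (complex_partial i H) else if i < d then complex_partial i H else H)" for H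
      unfolding multi_partial_def by (rule fold_iterate_pair[OF that]) (simp add: A_def)
    have "(\<Sum>l<d. A i k l) = (\<Sum>l<d. of_bool (l = i)) + (\<Sum>l<d. of_bool (l = k))"
      by (simp add: A_def sum.distrib)
    also have "\<dots> \<le> 1 + 1"
    proof -
      have "(\<Sum>l<d. of_bool (l = j)) \<le> (1::nat)" for j
        using card_mono[of "{j}" "{..<d} \<inter> {j}"] by simp
      thus ?thesis by (intro add_mono)
    qed
    finally have "(\<Sum>l<d. A i k l) \<le> 2" by simp
    moreover have "A i k \<in> {..<d} \<rightarrow>\<^sub>E UNIV" by (simp add: A_def)
    ultimately have "boundary_ext d (multi_partial d (A i k) F) \<zeta> = boundary_ext d (multi_partial d (A i k) G) \<zeta>"
      using L unfolding same_second_order_data_def by blast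
    thus ?thesis unfolding mp .
  qed
  note * = this
  show ?R
  proof (intro conjI allI impI)
    show "boundary_ext d F \<zeta> = boundary_ext d G \<zeta>" using *[of d d] by simp
    show "boundary_ext d (complex_partial i F) \<zeta> = boundary_ext d (complex_partial i G) \<zeta>" if "i < d" for i
      using *[of i d] that by simp
    show "boundary_ext d (complex_partial k (complex_partial i F)) \<zeta> = boundary_ext d (complex_partial k (complex_partial i G)) \<zeta>"
      if "k < d" "i \<le> k" for i k
      using *[of i k] that by simp
  qed
next
  assume R: ?R
  show ?L unfolding same_second_order_data_def
  proof (intro ballI impI)
    fix \<alpha> :: "nat \<Rightarrow> nat" assume "(\<Sum>i<d. \<alpha> i) \<le> 2"
    then obtain i k where ik: "i \<le> k" "\<And>l. l < d \<Longrightarrow> \<alpha> l = of_bool (l = i) + of_bool (l = k)"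
      using multi_index_le_2 by blast
    have mp: "multi_partial d \<alpha> H = (if k < d then complex_partial k (complex_partial i H) else if i < d then complex_partial i H else H)" for H
      unfolding multi_partial_def by (rule fold_iterate_pair[OF ik(1)]) (rule ik(2))
    show "boundary_ext d (multi_partial d \<alpha> F) \<zeta> = boundary_ext d (multi_partial d \<alpha> G) \<zeta>"
      unfolding mp using R ik(1) by auto
  qed
qed

section \<open>Generic directions\<close>

text \<open>On the line that joins a common non-zero of the functions treated so far to a non-zero of the new one,
every function is a nonzero polynomial, so only finitely many points have to be avoided.\<close>

lemma avoid_quadratic_zeros:
  fixes f :: "'b \<Rightarrow> (nat \<Rightarrow> real) \<Rightarrow> complex"
  assumes "finite J"
    and "\<And>j \<theta> \<theta>'. j \<in> J \<Longrightarrow> \<exists>a b c. \<forall>\<tau>. f j (\<lambda>i. \<theta> i + \<tau> * \<theta>' i) = a + b * of_real \<tau> + c * (of_real \<tau>)\<^sup>2"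
    and "\<And>j. j \<in> J \<Longrightarrow> \<exists>\<theta>. f j \<theta> \<noteq> 0"
  shows "\<exists>\<theta>. \<forall>j\<in>J. f j \<theta> \<noteq> 0"
  using assms
proof (induction J rule: finite_induct)
  case (insert m J)
  obtain \<theta>0 where \<theta>0: "\<forall>j\<in>J. f j \<theta>0 \<noteq> 0" using insert by blast
  obtain \<theta>1 where \<theta>1: "f m \<theta>1 \<noteq> 0" using insert.prems(2)[of m] by blast
  define line where "line = (\<lambda>\<tau> i. \<theta>0 i + \<tau> * (\<theta>1 i - \<theta>0 i))"
  have fin: "finite {\<tau>. f j (line \<tau>) = 0}" if j: "j \<in> insert m J" for j
  proof -
    obtain a b c where abc: "\<And>\<tau>. f j (line \<tau>) = a + b * of_real \<tau> + c * (of_real \<tau>)\<^sup>2"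
      using insert.prems(1)[OF j, of \<theta>0 "\<lambda>i. \<theta>1 i - \<theta>0 i"] unfolding line_def by blast
    have pol: "f j (line \<tau>) = poly [:a, b, c:] (of_real \<tau>)" for \<tau>
      by (simp add: abc algebra_simps power2_eq_square)
    have "f j (line 0) \<noteq> 0 \<or> f j (line 1) \<noteq> 0"
      using j \<theta>0 \<theta>1 by (auto simp: line_def)
    hence "[:a, b, c:] \<noteq> 0" using pol by (metis poly_0)
    hence "finite {x. poly [:a, b, c:] x = 0}" by (rule poly_roots_finite)
    hence "finite ((of_real :: real \<Rightarrow> complex) -` {x. poly [:a, b, c:] x = 0})"
      by (intro finite_vimageI inj_of_real)
    thus ?thesis by (simp add: pol vimage_def)
  qed
  have "finite (\<Union>j\<in>insert m J. {\<tau>. f j (line \<tau>) = 0})"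
    using fin insert.hyps by blast
  then obtain \<tau> where "\<tau> \<notin> (\<Union>j\<in>insert m J. {\<tau>. f j (line \<tau>) = 0})"
    using ex_new_if_finite[OF infinite_UNIV_char_0] by blast
  thus ?case by (intro exI[of _ "line \<tau>"]) auto
qed simp

lemma quadratic_along_line:
  fixes l :: "nat \<Rightarrow> complex" and q :: "nat \<Rightarrow> nat \<Rightarrow> complex"
  shows "\<exists>a b c. \<forall>\<tau>. (\<Sum>i<d. l i * of_real (\<theta> i + \<tau> * \<theta>' i))
      + (\<Sum>i<d. \<Sum>k<d. q i k * of_real (\<theta> i + \<tau> * \<theta>' i) * of_real (\<theta> k + \<tau> * \<theta>' k))
      = a + b * of_real \<tau> + c * (of_real \<tau>)\<^sup>2"
proof (intro exI allI)
  fix \<tau>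
  show "(\<Sum>i<d. l i * of_real (\<theta> i + \<tau> * \<theta>' i))
      + (\<Sum>i<d. \<Sum>k<d. q i k * of_real (\<theta> i + \<tau> * \<theta>' i) * of_real (\<theta> k + \<tau> * \<theta>' k))
      = ((\<Sum>i<d. l i * of_real (\<theta> i)) + (\<Sum>i<d. \<Sum>k<d. q i k * of_real (\<theta> i) * of_real (\<theta> k)))
        + ((\<Sum>i<d. l i * of_real (\<theta>' i)) + (\<Sum>i<d. \<Sum>k<d. q i k * (of_real (\<theta> i) * of_real (\<theta>' k) + of_real (\<theta>' i) * of_real (\<theta> k)))) * of_real \<tau>
        + (\<Sum>i<d. \<Sum>k<d. q i k * of_real (\<theta>' i) * of_real (\<theta>' k)) * (of_real \<tau>)\<^sup>2"
    by (simp add: sum.distrib sum_distrib_left sum_distrib_right algebra_simps power2_eq_square)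
qed

lemma linear_form_nonzero:
  fixes l :: "nat \<Rightarrow> complex"
  assumes "i < d" "l i \<noteq> 0"
  shows "\<exists>\<theta> :: nat \<Rightarrow> real. (\<Sum>k<d. l k * of_real (\<theta> k)) \<noteq> 0"
proof -
  have "(\<Sum>k<d. l k * of_real (of_bool (k = i))) = (\<Sum>k<d. if k = i then l k else 0)"
    by (intro sum.cong) auto
  also have "\<dots> = l i" using assms(1) by simp
  finally have "(\<Sum>k<d. l k * of_real (of_bool (k = i))) = l i" .
  thus ?thesis using assms(2) by (intro exI[of _ "\<lambda>k. of_bool (k = i)"]) simp
qed

text \<open>Polarisation: the form vanishes at the coordinate vectors and at their sums only if its coefficients
vanish.\<close>

lemma quadratic_form_nonzero:
  fixes q :: "nat \<Rightarrow> nat \<Rightarrow> complex"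
  assumes sym: "\<And>i k. i < d \<Longrightarrow> k < d \<Longrightarrow> q i k = q k i" and ik: "i < d" "k < d" and nz: "q i k \<noteq> 0"
  shows "\<exists>\<theta> :: nat \<Rightarrow> real. (\<Sum>i<d. \<Sum>k<d. q i k * of_real (\<theta> i) * of_real (\<theta> k)) \<noteq> 0"
proof (rule ccontr)
  assume contra: "\<not> ?thesis"
  define B where "B = (\<lambda>(\<theta>::nat\<Rightarrow>real) (\<theta>'::nat\<Rightarrow>real). \<Sum>i<d. \<Sum>k<d. q i k * of_real (\<theta> i) * of_real (\<theta>' k))"
  have z: "B \<theta> \<theta> = 0" for \<theta> using contra by (simp add: B_def)
  define e :: "nat \<Rightarrow> nat \<Rightarrow> real" where "e = (\<lambda>i k. of_bool (k = i))"
  have Be: "B (e i) (e k) = q i k" if "i < d" "k < d" for i k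
  proof -
    have "B (e i) (e k) = (\<Sum>i'<d. \<Sum>k'<d. if k' = k then (if i' = i then q i' k' else 0) else 0)"
      unfolding B_def e_def by (intro sum.cong refl) auto
    thus ?thesis using that by (simp add: sum.delta)
  qed
  have "B (\<lambda>l. e i l + e k l) (\<lambda>l. e i l + e k l) = B (e i) (e i) + B (e i) (e k) + B (e k) (e i) + B (e k) (e k)"
    by (simp add: B_def sum.distrib algebra_simps)
  hence "q i k + q k i = 0" using z Be ik by simp
  thus False using sym[OF ik] nz by simp
qed

section \<open>Approach sequences on the parabolic scale\<close>

lemma exp_second_order:
  fixes y :: "nat \<Rightarrow> complex" and \<delta> :: "nat \<Rightarrow> real"
  assumes \<delta>: "\<And>n. \<delta> n > 0" "\<delta> \<longlonglongrightarrow> 0" and y: "y \<longlonglongrightarrow> b"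
  shows "(\<lambda>n. (exp (of_real (\<delta> n) * a + of_real ((\<delta> n)\<^sup>2) * y n) - 1 - of_real (\<delta> n) * a) / of_real ((\<delta> n)\<^sup>2)) \<longlonglongrightarrow> b + a\<^sup>2 / 2"
proof -
  define x where "x = (\<lambda>n. of_real (\<delta> n) * a + of_real ((\<delta> n)\<^sup>2) * y n)"
  define u where "u = (\<lambda>n. a + of_real (\<delta> n) * y n)"
  have xu: "x n = of_real (\<delta> n) * u n" for n by (simp add: x_def u_def algebra_simps power2_eq_square)
  have "u \<longlonglongrightarrow> a + of_real 0 * b" unfolding u_def by (intro tendsto_intros \<delta> y)
  hence u: "u \<longlonglongrightarrow> a" by simp
  have "x \<longlonglongrightarrow> of_real 0 * a" unfolding xu[abs_def] by (intro tendsto_intros \<delta> u)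
  hence x: "x \<longlonglongrightarrow> 0" by simp
  define r where "r = (\<lambda>n. exp (x n) - (1 + x n + (x n)\<^sup>2 / 2))"
  have r: "(\<lambda>n. r n / of_real ((\<delta> n)\<^sup>2)) \<longlonglongrightarrow> 0"
  proof (rule Lim_null_comparison)
    show "\<forall>\<^sub>F n in sequentially. norm (r n / of_real ((\<delta> n)\<^sup>2)) \<le> exp \<bar>Re (x n)\<bar> * (norm (u n)) ^ 3 / 2 * \<delta> n"
    proof (intro always_eventually allI)
      fix n
      have "norm (r n) \<le> exp \<bar>Re (x n)\<bar> * norm (x n) ^ 3 / 2"
        using Taylor_exp[of "x n" 2] by (simp add: r_def numeral_eq_Suc)
      also have "norm (x n) ^ 3 = norm (u n) ^ 3 * \<delta> n * (\<delta> n)\<^sup>2"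
        using \<delta>(1)[of n] by (simp add: xu norm_mult power_mult_distrib power3_eq_cube power2_eq_square)
      finally show "norm (r n / of_real ((\<delta> n)\<^sup>2)) \<le> exp \<bar>Re (x n)\<bar> * (norm (u n)) ^ 3 / 2 * \<delta> n"
        using \<delta>(1)[of n] by (simp add: norm_divide norm_power divide_le_eq mult_ac)
    qed
    have "(\<lambda>n. exp \<bar>Re (x n)\<bar> * (norm (u n)) ^ 3 / 2 * \<delta> n) \<longlonglongrightarrow> exp \<bar>Re 0\<bar> * (norm a) ^ 3 / 2 * 0"
      by (intro tendsto_intros x u \<delta>) simp
    thus "(\<lambda>n. exp \<bar>Re (x n)\<bar> * (norm (u n)) ^ 3 / 2 * \<delta> n) \<longlonglongrightarrow> 0" by simp
  qed
  have "(\<lambda>n. r n / of_real ((\<delta> n)\<^sup>2) + y n + (u n)\<^sup>2 / 2) \<longlonglongrightarrow> 0 + b + a\<^sup>2 / 2"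
    by (intro tendsto_intros r y u) simp
  moreover have "r n / of_real ((\<delta> n)\<^sup>2) + y n + (u n)\<^sup>2 / 2
      = (exp (x n) - 1 - of_real (\<delta> n) * a) / of_real ((\<delta> n)\<^sup>2)" for n
  proof -
    have "(x n)\<^sup>2 = of_real ((\<delta> n)\<^sup>2) * (u n)\<^sup>2" by (simp add: xu power_mult_distrib)
    hence "exp (x n) - 1 - of_real (\<delta> n) * a = r n + of_real ((\<delta> n)\<^sup>2) * y n + of_real ((\<delta> n)\<^sup>2) * (u n)\<^sup>2 / 2"
      by (simp add: r_def) (simp add: x_def)
    thus ?thesis using \<delta>(1)[of n] by (simp add: add_divide_distrib)
  qed
  ultimately show ?thesis by (simp add: x_def)
qed

text \<open>Approach to \<open>\<zeta>\<close> along the direction \<open>\<theta>\<close> of the torus, at distance \<open>O(\<delta>)\<close> from \<open>\<zeta>\<close> and of order \<open>\<delta>\<^sup>2\<close>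
from the torus; at the same time the prime with index \<open>d\<close>, the first one that does not enter the
Bohr lifts, is sent to \<open>cis \<phi>\<close>. Kronecker's theorem is used with the error \<open>\<delta> ^ 3\<close>, which is
negligible on the scale \<open>\<delta>\<^sup>2\<close>.\<close>

lemma approach_sequence:
  fixes \<theta> :: "nat \<Rightarrow> real" and \<phi> :: real
  assumes \<zeta>: "\<zeta> \<in> torus d"
  obtains s :: "nat \<Rightarrow> complex" and \<delta> :: "nat \<Rightarrow> real" where
    "\<And>n. \<delta> n > 0" "\<delta> \<longlonglongrightarrow> 0" "\<And>n. Re (s n) = (\<delta> n)\<^sup>2"
    "\<And>i. i < d \<Longrightarrow> (\<lambda>n. (bohr_point d (s n) i - \<zeta> i - of_real (\<delta> n) * (\<i> * \<zeta> i * of_real (\<theta> i))) / of_real ((\<delta> n)\<^sup>2))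
       \<longlonglongrightarrow> \<zeta> i * of_real (- log_prime i - (\<theta> i)\<^sup>2 / 2)"
    "(\<lambda>n. exp (- (\<i> * of_real (Im (s n) * log_prime d)))) \<longlonglongrightarrow> cis \<phi>"
proof -
  let ?L = log_prime
  define \<delta> where "\<delta> = (\<lambda>n. 1 / real (Suc n))"
  have \<delta>: "\<delta> n > 0" for n by (simp add: \<delta>_def)
  have \<delta>0: "\<delta> \<longlonglongrightarrow> 0" unfolding \<delta>_def using LIMSEQ_inverse_real_of_nat by (simp add: inverse_eq_divide)
  have "\<forall>i. \<exists>t. i < d \<longrightarrow> \<zeta> i = cis t"
    using torus_norm[OF \<zeta>] complex_norm_eq_1_exp by (metis cis_conv_exp)
  then obtain A where A: "\<And>i. i < d \<Longrightarrow> \<zeta> i = cis (A i)" by metis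
  have "\<exists>t. \<forall>i<Suc d. \<exists>h::int. \<bar>t * ?L i - (if i < d then - (A i + \<delta> n * \<theta> i) else - \<phi>) - 2 * pi * h\<bar> < \<delta> n ^ 3" for n
  proof -
    have "\<delta> n ^ 3 > 0" using \<delta>[of n] by simp
    from kronecker_primes[OF this, of "Suc d" "\<lambda>i. if i < d then - (A i + \<delta> n * \<theta> i) else - \<phi>"]
    show ?thesis by metis
  qed
  then obtain t where "\<And>n i. i < Suc d \<Longrightarrow> \<exists>h::int. \<bar>t n * ?L i - (if i < d then - (A i + \<delta> n * \<theta> i) else - \<phi>) - 2 * pi * h\<bar> < \<delta> n ^ 3"
    by metis
  note t = this
  define h where "h = (\<lambda>n i. SOME h::int. \<bar>t n * ?L i - (if i < d then - (A i + \<delta> n * \<theta> i) else - \<phi>) - 2 * pi * h\<bar> < \<delta> n ^ 3)"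
  have h: "\<bar>t n * ?L i - (if i < d then - (A i + \<delta> n * \<theta> i) else - \<phi>) - 2 * pi * h n i\<bar> < \<delta> n ^ 3"
    if "i < Suc d" for n i
    unfolding h_def by (rule someI_ex) (rule t[OF that])
  define e where "e = (\<lambda>n i. t n * ?L i - (if i < d then - (A i + \<delta> n * \<theta> i) else - \<phi>) - 2 * pi * h n i)"
  have e: "\<bar>e n i\<bar> < \<delta> n ^ 3" if "i < Suc d" for n i using h[OF that, of n] by (simp add: e_def)
  have e0: "(\<lambda>n. e n i / (\<delta> n)\<^sup>2) \<longlonglongrightarrow> 0" if "i < Suc d" for i
  proof (rule Lim_null_comparison[OF _ \<delta>0], intro always_eventually allI)
    fix n
    show "norm (e n i / (\<delta> n)\<^sup>2) \<le> \<delta> n"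
      using e[OF that, of n] \<delta>[of n] by (simp add: divide_simps power3_eq_cube power2_eq_square mult_ac)
  qed
  have cis_t: "cis (- (t n * ?L i)) = cis ((if i < d then A i + \<delta> n * \<theta> i else \<phi>) - e n i)" for n i
  proof -
    have "- (t n * ?L i) = ((if i < d then A i + \<delta> n * \<theta> i else \<phi>) - e n i) + 2 * pi * (- h n i)"
      by (simp add: e_def)
    hence "cis (- (t n * ?L i)) = cis ((if i < d then A i + \<delta> n * \<theta> i else \<phi>) - e n i) * cis (2 * pi * (- h n i))"
      by (simp only: cis_mult)
    also have "cis (2 * pi * (- h n i)) = 1" by (rule cis_multiple_2pi) auto
    finally show ?thesis by simp
  qed
  define s where "s = (\<lambda>n. Complex ((\<delta> n)\<^sup>2) (t n))"
  have pt: "bohr_point d (s n) i = \<zeta> i * exp (of_real (\<delta> n) * (\<i> * of_real (\<theta> i)) + of_real ((\<delta> n)\<^sup>2) * (- of_real (?L i) - \<i> * of_real (e n i / (\<delta> n)\<^sup>2)))"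
    if i: "i < d" for n i
  proof -
    have "bohr_point d (s n) i = exp (- s n * of_real (?L i))"
      using i by (simp add: bohr_point_def nat_powr_complex nth_prime_pos)
    also have "- s n * of_real (?L i) = - of_real ((\<delta> n)\<^sup>2 * ?L i) + \<i> * of_real (- (t n * ?L i))"
      by (simp add: s_def complex_eq_iff)
    also have "exp \<dots> = exp (- of_real ((\<delta> n)\<^sup>2 * ?L i)) * cis (- (t n * ?L i))"
      by (simp only: exp_add cis_conv_exp)
    also have "cis (- (t n * ?L i)) = cis (A i) * cis (\<delta> n * \<theta> i - e n i)"
      unfolding cis_t using i by (simp add: cis_mult algebra_simps)
    also have "cis (A i) = \<zeta> i" using A i by simp
    also have "exp (- of_real ((\<delta> n)\<^sup>2 * ?L i)) * (\<zeta> i * cis (\<delta> n * \<theta> i - e n i))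
        = \<zeta> i * exp (- of_real ((\<delta> n)\<^sup>2 * ?L i) + \<i> * of_real (\<delta> n * \<theta> i - e n i))"
      by (simp only: exp_add cis_conv_exp mult.left_commute)
    also have "- of_real ((\<delta> n)\<^sup>2 * ?L i) + \<i> * of_real (\<delta> n * \<theta> i - e n i)
      = of_real (\<delta> n) * (\<i> * of_real (\<theta> i)) + of_real ((\<delta> n)\<^sup>2) * (- of_real (?L i) - \<i> * of_real (e n i / (\<delta> n)\<^sup>2))"
      using \<delta>[of n] by (simp add: complex_eq_iff algebra_simps)
    finally show ?thesis .
  qed
  show ?thesis
  proof (rule that[of \<delta> s])
    show "\<delta> n > 0" for n by (rule \<delta>)
    show "\<delta> \<longlonglongrightarrow> 0" by (rule \<delta>0)
    show "Re (s n) = (\<delta> n)\<^sup>2" for n by (simp add: s_def)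
    fix i assume i: "i < d"
    have "(\<lambda>n. - of_real (?L i) - \<i> * of_real (e n i / (\<delta> n)\<^sup>2)) \<longlonglongrightarrow> - of_real (?L i) - \<i> * of_real 0"
      using i by (intro tendsto_intros e0) simp
    from tendsto_mult_left[OF exp_second_order[OF \<delta> \<delta>0 this, of "\<i> * of_real (\<theta> i)"], of "\<zeta> i"]
    have "(\<lambda>n. \<zeta> i * ((exp (of_real (\<delta> n) * (\<i> * of_real (\<theta> i)) + of_real ((\<delta> n)\<^sup>2) * (- of_real (?L i) - \<i> * of_real (e n i / (\<delta> n)\<^sup>2)))
        - 1 - of_real (\<delta> n) * (\<i> * of_real (\<theta> i))) / of_real ((\<delta> n)\<^sup>2)))
        \<longlonglongrightarrow> \<zeta> i * (- of_real (?L i) - \<i> * of_real 0 + (\<i> * of_real (\<theta> i))\<^sup>2 / 2)" .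
    moreover have "\<zeta> i * ((exp (of_real (\<delta> n) * (\<i> * of_real (\<theta> i)) + of_real ((\<delta> n)\<^sup>2) * (- of_real (?L i) - \<i> * of_real (e n i / (\<delta> n)\<^sup>2)))
        - 1 - of_real (\<delta> n) * (\<i> * of_real (\<theta> i))) / of_real ((\<delta> n)\<^sup>2))
        = (bohr_point d (s n) i - \<zeta> i - of_real (\<delta> n) * (\<i> * \<zeta> i * of_real (\<theta> i))) / of_real ((\<delta> n)\<^sup>2)" for n
      unfolding pt[OF i] by (simp add: right_diff_distrib mult_ac)
    moreover have "\<zeta> i * (- of_real (?L i) - \<i> * of_real 0 + (\<i> * of_real (\<theta> i))\<^sup>2 / 2)
        = \<zeta> i * of_real (- ?L i - (\<theta> i)\<^sup>2 / 2)"
      by (simp add: power_mult_distrib)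
    ultimately show "(\<lambda>n. (bohr_point d (s n) i - \<zeta> i - of_real (\<delta> n) * (\<i> * \<zeta> i * of_real (\<theta> i))) / of_real ((\<delta> n)\<^sup>2))
       \<longlonglongrightarrow> \<zeta> i * of_real (- ?L i - (\<theta> i)\<^sup>2 / 2)" by (simp only:)
  next
    have "(\<lambda>n. (\<delta> n)\<^sup>2 * (e n d / (\<delta> n)\<^sup>2)) \<longlonglongrightarrow> 0\<^sup>2 * 0"
      by (intro tendsto_intros \<delta>0 e0) simp
    moreover have "(\<delta> n)\<^sup>2 * (e n d / (\<delta> n)\<^sup>2) = e n d" for n using \<delta>[of n] by simp
    ultimately have "(\<lambda>n. e n d) \<longlonglongrightarrow> 0" by simp
    hence "(\<lambda>n. cis (\<phi> - e n d)) \<longlonglongrightarrow> cis (\<phi> - 0)" by (intro tendsto_intros)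
    moreover have "cis (\<phi> - e n d) = exp (- (\<i> * of_real (Im (s n) * ?L d)))" for n
      using cis_t[of n d] by (simp add: s_def cis_conv_exp)
    ultimately show "(\<lambda>n. exp (- (\<i> * of_real (Im (s n) * ?L d)))) \<longlonglongrightarrow> cis \<phi>" by simp
  qed
qed

section \<open>Asymptotics of finite Euler products\<close>

text \<open>The relations for all exponents from \<open>D0\<close> on combine to relations with polynomial weights; a polynomial
that vanishes at all values \<open>x j\<close> except \<open>y\<close> isolates the class of \<open>y\<close>.\<close>

lemma equal_power_sums_class:
  fixes x :: "'b \<Rightarrow> complex" and lam :: "'b \<Rightarrow> complex"
  assumes "finite J" and z: "\<And>D. D \<ge> D0 \<Longrightarrow> (\<Sum>j\<in>J. lam j * x j ^ D) = 0" and y: "y \<noteq> 0"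
  shows "(\<Sum>j | j \<in> J \<and> x j = y. lam j) = 0"
proof -
  \<comment> \<open>vanishes at all \<open>x j\<close> except those equal to \<open>y\<close>\<close>
  define P where "P = (\<Prod>a\<in>x ` J - {y}. [:- a, 1:])"
  have P: "poly P t = (\<Prod>a\<in>x ` J - {y}. t - a)" for t by (simp add: P_def poly_prod)
  have Py: "poly P y \<noteq> 0" unfolding P using assms(1) by (simp add: prod_zero_iff)
  have P0: "poly P (x j) = 0" if "j \<in> J" "x j \<noteq> y" for j
    unfolding P using assms(1) that by (simp add: prod_zero_iff)
  have "(\<Sum>j\<in>J. lam j * x j ^ D0 * poly P (x j)) = (\<Sum>k\<le>degree P. coeff P k * (\<Sum>j\<in>J. lam j * x j ^ (D0 + k)))"
    unfolding poly_altdef sum_distrib_left by (subst sum.swap) (simp add: power_add mult_ac)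
  also have "\<dots> = 0" using z by simp
  also have "(\<Sum>j\<in>J. lam j * x j ^ D0 * poly P (x j)) = (\<Sum>j | j \<in> J \<and> x j = y. lam j * x j ^ D0 * poly P (x j))"
    using assms(1) P0 by (intro sum.mono_neutral_right) auto
  also have "\<dots> = (\<Sum>j | j \<in> J \<and> x j = y. lam j) * (y ^ D0 * poly P y)"
    unfolding sum_distrib_right by (intro sum.cong refl) (auto simp: mult_ac)
  finally show ?thesis using Py y by simp
qed

text \<open>One Euler factor on the scale \<open>\<delta>\<^sup>2\<close>. An argument of order \<open>\<delta>\<close> makes it negligible, an argument
asymptotic to \<open>\<kappa> * \<delta>\<^sup>2\<close> gives a finite nonzero limit.\<close>

lemma euler_factor_limits:
  fixes y :: "nat \<Rightarrow> complex" and \<delta> :: "nat \<Rightarrow> real" and L :: real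
  assumes \<delta>: "\<And>n. \<delta> n > 0" "\<delta> \<longlonglongrightarrow> 0" and y: "y \<longlonglongrightarrow> \<kappa>" and L: "L > 0"
    and u: "\<And>n. u n = of_real (\<delta> n) * \<mu> + of_real ((\<delta> n)\<^sup>2) * y n"
  shows "\<mu> \<noteq> 0 \<Longrightarrow> (\<lambda>n. of_real ((\<delta> n)\<^sup>2) / (1 - exp (- (u n * of_real L)))) \<longlonglongrightarrow> 0"
    and "\<mu> = 0 \<Longrightarrow> \<kappa> \<noteq> 0 \<Longrightarrow> (\<lambda>n. of_real ((\<delta> n)\<^sup>2) / (1 - exp (- (u n * of_real L)))) \<longlonglongrightarrow> 1 / (\<kappa> * of_real L)"
proof -
  define e where "e = (\<lambda>n. exp (- (u n * of_real L)))"
  have e: "e n = exp (of_real (\<delta> n) * (- \<mu> * of_real L) + of_real ((\<delta> n)\<^sup>2) * (- y n * of_real L))" for n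
    by (simp add: e_def u algebra_simps)
  have lim: "(\<lambda>n. (e n - 1 - of_real (\<delta> n) * (- \<mu> * of_real L)) / of_real ((\<delta> n)\<^sup>2)) \<longlonglongrightarrow>
      - \<kappa> * of_real L + (- \<mu> * of_real L)\<^sup>2 / 2"
    unfolding e by (intro exp_second_order \<delta> tendsto_intros y)
  {
    assume mu: "\<mu> \<noteq> 0"
    have "(\<lambda>n. - (of_real (\<delta> n) * ((e n - 1 - of_real (\<delta> n) * (- \<mu> * of_real L)) / of_real ((\<delta> n)\<^sup>2)) + - \<mu> * of_real L))
        \<longlonglongrightarrow> - (of_real 0 * (- \<kappa> * of_real L + (- \<mu> * of_real L)\<^sup>2 / 2) + - \<mu> * of_real L)"
      by (intro tendsto_intros lim \<delta>)
    moreover have "- (of_real (\<delta> n) * ((e n - 1 - of_real (\<delta> n) * (- \<mu> * of_real L)) / of_real ((\<delta> n)\<^sup>2)) + - \<mu> * of_real L)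
        = (1 - e n) / of_real (\<delta> n)" for n
      using \<delta>(1)[of n] by (simp add: field_simps power2_eq_square)
    ultimately have "(\<lambda>n. (1 - e n) / of_real (\<delta> n)) \<longlonglongrightarrow> \<mu> * of_real L" by simp
    hence "(\<lambda>n. of_real (\<delta> n) / ((1 - e n) / of_real (\<delta> n))) \<longlonglongrightarrow> of_real 0 / (\<mu> * of_real L)"
      using mu L by (intro tendsto_divide tendsto_of_real \<delta>) auto
    thus "(\<lambda>n. of_real ((\<delta> n)\<^sup>2) / (1 - exp (- (u n * of_real L)))) \<longlonglongrightarrow> 0"
      by (simp add: e_def power2_eq_square)
  }
  {
    assume mu: "\<mu> = 0" and ka: "\<kappa> \<noteq> 0"
    have "(\<lambda>n. 1 / - ((e n - 1 - of_real (\<delta> n) * (- \<mu> * of_real L)) / of_real ((\<delta> n)\<^sup>2)))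
        \<longlonglongrightarrow> 1 / - (- \<kappa> * of_real L + (- \<mu> * of_real L)\<^sup>2 / 2)"
      using mu ka L by (intro tendsto_intros lim) auto
    moreover have "1 / - ((e n - 1 - of_real (\<delta> n) * (- \<mu> * of_real L)) / of_real ((\<delta> n)\<^sup>2))
       = of_real ((\<delta> n)\<^sup>2) / (1 - exp (- (u n * of_real L)))" for n
    proof -
      have "- ((e n - 1) / of_real ((\<delta> n)\<^sup>2)) = (1 - e n) / of_real ((\<delta> n)\<^sup>2)"
        by (simp add: minus_divide_left del: of_real_power)
      thus ?thesis using mu by (simp add: e_def)
    qed
    ultimately show "(\<lambda>n. of_real ((\<delta> n)\<^sup>2) / (1 - exp (- (u n * of_real L)))) \<longlonglongrightarrow> 1 / (\<kappa> * of_real L)"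
      using mu by simp
  }
qed

definition log_product :: "nat \<Rightarrow> real" where
  "log_product D = (\<Prod>i<D. 1 / log_prime i)"

lemma log_product_pos: "log_product D > 0"
  unfolding log_product_def using ln_nth_prime_pos by (intro prod_pos) simp

lemma scaled_euler_product:
  "euler_product D w * of_real (\<epsilon> ^ D) = (\<Prod>i<D. of_real \<epsilon> / (1 - exp (- (w * of_real (log_prime i)))))"
  by (simp add: euler_product_def prod_dividef of_real_power)

lemma euler_product_asymp:
  fixes u :: "nat \<Rightarrow> complex" and \<delta> :: "nat \<Rightarrow> real"
  assumes \<delta>: "\<And>n. \<delta> n > 0" "\<delta> \<longlonglongrightarrow> 0" and u: "(\<lambda>n. u n / of_real ((\<delta> n)\<^sup>2)) \<longlonglongrightarrow> \<kappa>" and \<kappa>: "\<kappa> \<noteq> 0"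
  shows "(\<lambda>n. euler_product D (u n) * of_real (((\<delta> n)\<^sup>2) ^ D)) \<longlonglongrightarrow> of_real (log_product D) / \<kappa> ^ D"
proof -
  have "(\<lambda>n. \<Prod>i<D. of_real ((\<delta> n)\<^sup>2) / (1 - exp (- (u n * of_real (log_prime i)))))
     \<longlonglongrightarrow> (\<Prod>i<D. 1 / (\<kappa> * of_real (log_prime i)))"
  proof (intro tendsto_prod)
    fix i
    show "(\<lambda>n. of_real ((\<delta> n)\<^sup>2) / (1 - exp (- (u n * of_real (log_prime i)))))
       \<longlonglongrightarrow> 1 / (\<kappa> * of_real (log_prime i))"
      using \<delta> by (intro euler_factor_limits(2)[where \<mu> = 0, OF \<delta> u ln_nth_prime_pos _ _ \<kappa>]) (auto simp: less_imp_neq[symmetric])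
  qed
  moreover have "(\<Prod>i<D. 1 / (\<kappa> * of_real (log_prime i))) = of_real (log_product D) / \<kappa> ^ D"
    by (simp add: log_product_def prod_dividef prod.distrib)
  ultimately show ?thesis unfolding scaled_euler_product by simp
qed

lemma euler_product_asymp_real:
  fixes u :: "nat \<Rightarrow> real"
  assumes \<delta>: "\<And>n. \<delta> n > 0" "\<delta> \<longlonglongrightarrow> 0" and u: "(\<lambda>n. u n / (\<delta> n)\<^sup>2) \<longlonglongrightarrow> \<kappa>" and \<kappa>: "\<kappa> \<noteq> 0"
  shows "(\<lambda>n. euler_product D (u n) * ((\<delta> n)\<^sup>2) ^ D) \<longlonglongrightarrow> log_product D / \<kappa> ^ D"
proof -
  have "(\<lambda>n. of_real (u n / (\<delta> n)\<^sup>2) :: complex) \<longlonglongrightarrow> of_real \<kappa>" by (intro tendsto_of_real u)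
  hence "(\<lambda>n. euler_product D (of_real (u n)) * of_real (((\<delta> n)\<^sup>2) ^ D) :: complex) \<longlonglongrightarrow> of_real (log_product D) / of_real \<kappa> ^ D"
    using \<kappa> by (intro euler_product_asymp \<delta>) auto
  hence "(\<lambda>n. of_real (euler_product D (u n) * ((\<delta> n)\<^sup>2) ^ D) :: complex) \<longlonglongrightarrow> of_real (log_product D / \<kappa> ^ D)"
    by (simp add: euler_product_of_real)
  thus ?thesis by (subst (asm) tendsto_of_real_iff)
qed

text \<open>The factors other than that of \<open>i0\<close> stay bounded because the real part of the argument is at least
\<open>\<delta>\<^sup>2\<close>.\<close>

lemma euler_product_negligible:
  fixes u :: "nat \<Rightarrow> complex" and \<delta> :: "nat \<Rightarrow> real"
  assumes \<delta>: "\<And>n. \<delta> n > 0" "\<delta> \<longlonglongrightarrow> 0" and Re: "\<And>n. Re (u n) \<ge> (\<delta> n)\<^sup>2" and i0: "i0 < D"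
    and lim: "(\<lambda>n. of_real ((\<delta> n)\<^sup>2) / (1 - exp (- (u n * of_real (log_prime i0))))) \<longlonglongrightarrow> 0"
  shows "(\<lambda>n. euler_product D (u n) * of_real (((\<delta> n)\<^sup>2) ^ D)) \<longlonglongrightarrow> 0"
proof -
  let ?L = log_prime
  define f where "f = (\<lambda>i n. of_real ((\<delta> n)\<^sup>2) / (1 - exp (- (u n * of_real (?L i)))))"
  define g where "g = (\<lambda>i n. (\<delta> n)\<^sup>2 / (1 - exp (- ((\<delta> n)\<^sup>2 * ?L i))))"
  have fg: "norm (f i n) \<le> g i n" for i n
  proof -
    have "norm (1 / (1 - exp (- (u n * of_real (?L i))))) \<le> 1 / (1 - exp (- ((\<delta> n)\<^sup>2 * ?L i)))"
      using Re[of n] \<delta>(1)[of n] ln_nth_prime_pos[of i] by (intro norm_inverse_one_minus_exp_le) auto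
    from mult_left_mono[OF this, of "(\<delta> n)\<^sup>2"] show ?thesis
      by (simp add: f_def g_def norm_divide norm_power)
  qed
  have glim: "g i \<longlonglongrightarrow> 1 / ?L i" for i
  proof -
    have one: "(\<lambda>n. of_real ((\<delta> n)\<^sup>2) / of_real ((\<delta> n)\<^sup>2) :: complex) \<longlonglongrightarrow> 1"
      using \<delta>(1) by (simp add: less_imp_neq[symmetric])
    have "(\<lambda>n. of_real ((\<delta> n)\<^sup>2) / (1 - exp (- (of_real ((\<delta> n)\<^sup>2) * of_real (?L i)))) :: complex) \<longlonglongrightarrow> 1 / (1 * of_real (?L i))"
      using \<delta> by (intro euler_factor_limits(2)[where \<mu> = 0, OF \<delta> one ln_nth_prime_pos]) (auto simp: less_imp_neq[symmetric])
    hence "(\<lambda>n. of_real (g i n) :: complex) \<longlonglongrightarrow> of_real (1 / ?L i)"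
      by (simp add: g_def exp_of_real[symmetric])
    thus ?thesis by (subst (asm) tendsto_of_real_iff)
  qed
  have "(\<lambda>n. f i0 n) \<longlonglongrightarrow> 0" using lim by (simp add: f_def)
  hence "(\<lambda>n. norm (f i0 n) * (\<Prod>i\<in>{..<D}-{i0}. g i n)) \<longlonglongrightarrow> norm (0::complex) * (\<Prod>i\<in>{..<D}-{i0}. 1 / ?L i)"
    by (intro tendsto_intros glim)
  hence bound: "(\<lambda>n. norm (f i0 n) * (\<Prod>i\<in>{..<D}-{i0}. g i n)) \<longlonglongrightarrow> 0" by simp
  have "(\<lambda>n. \<Prod>i<D. f i n) \<longlonglongrightarrow> 0"
  proof (rule Lim_null_comparison[OF _ bound], intro always_eventually allI)
    fix n
    have "norm (\<Prod>i<D. f i n) = norm (f i0 n) * (\<Prod>i\<in>{..<D}-{i0}. norm (f i n))"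
      unfolding prod_norm[symmetric] using i0 by (intro prod.remove) auto
    also have "\<dots> \<le> norm (f i0 n) * (\<Prod>i\<in>{..<D}-{i0}. g i n)"
      by (intro mult_left_mono prod_mono) (auto simp: fg)
    finally show "norm (\<Prod>i<D. f i n) \<le> norm (f i0 n) * (\<Prod>i\<in>{..<D}-{i0}. g i n)" .
  qed
  thus ?thesis unfolding scaled_euler_product f_def .
qed

text \<open>A nonzero common period \<open>\<omega>\<close> would be imaginary and make the quotient of the logarithms of the first
two primes rational.\<close>

lemma two_prime_frequencies:
  assumes "\<omega> \<noteq> (0::complex)"
  shows "\<exists>i<2. exp (- (\<omega> * of_real (log_prime i))) \<noteq> 1"
proof (rule ccontr)
  let ?L = log_prime
  assume "\<not> ?thesis"
  hence e: "exp (- (\<omega> * of_real (?L i))) = 1" if "i < 2" for i using that by blast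
  have "Re \<omega> = 0" using e[of 0] ln_nth_prime_pos[of 0] by (auto simp: exp_eq_1)
  hence y: "Im \<omega> \<noteq> 0" using assms by (simp add: complex_eq_iff)
  obtain a b :: int where ab: "- (Im \<omega> * ?L 0) = of_int (2 * a) * pi" "- (Im \<omega> * ?L 1) = of_int (2 * b) * pi"
    using e[of 0] e[of 1] by (auto simp: exp_eq_1)
  have "Im \<omega> * (of_int b * ?L 0 - of_int a * ?L 1) = 0"
  proof -
    have "Im \<omega> * (of_int b * ?L 0 - of_int a * ?L 1)
        = of_int a * - (Im \<omega> * ?L 1) - of_int b * - (Im \<omega> * ?L 0)"
      by (simp add: algebra_simps)
    thus ?thesis unfolding ab by simp
  qed
  hence "of_int b * ?L 0 + of_int (- a) * ?L 1 = 0" using y by simp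
  hence "(\<Sum>i\<in>{0,1}. of_int ((\<lambda>i. if i = 0 then b else - a) i) * ?L i) = 0" by simp
  from ln_primes_independent[OF _ this, of 0] have "b = 0" by simp
  hence "Im \<omega> * ?L 1 = 0" using ab(2) by simp
  thus False using y ln_nth_prime_pos[of 1] by simp
qed

section \<open>Separation of the symbols\<close>

text \<open>Excluding finitely many \<open>\<eta>\<close> on the unit circle separates symbols of different characteristics.\<close>

lemma finite_power_relation:
  assumes "a \<noteq> b"
  shows "finite {\<eta> :: complex. \<eta> ^ a * K = \<eta> ^ b}"
proof -
  have "monom K a - monom 1 b \<noteq> 0"
  proof
    assume "monom K a - monom 1 b = 0"
    hence "coeff (monom K a - monom 1 b) b = 0" by simp
    thus False using assms by (simp add: coeff_monom)
  qed
  hence "finite {\<eta>. poly (monom K a - monom 1 b) \<eta> = 0}" by (rule poly_roots_finite)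
  thus ?thesis by (simp add: poly_monom mult.commute)
qed

lemma infinite_unit_circle: "infinite (range cis)"
proof
  assume fin: "finite (range cis)"
  have inj: "inj_on cis {0..1}"
  proof (rule inj_onI)
    fix x y :: real assume xy: "x \<in> {0..1}" "y \<in> {0..1}" "cis x = cis y"
    have "cos x = cos y" using arg_cong[OF xy(3), of Re] by simp
    thus "x = y" using xy(1,2) pi_gt3 by - (rule cos_inj_pi; simp)
  qed
  have "cis ` {0..1} \<subseteq> range cis" by (rule image_mono[OF subset_UNIV])
  hence "finite (cis ` {0..1})" using fin by (rule finite_subset)
  hence "finite {0..1::real}" by (rule finite_imageD[OF _ inj])
  thus False using infinite_Icc[of "0::real" 1] by simp
qed

locale boundary_combination = symbol_combination +
  fixes \<zeta> :: "nat \<Rightarrow> complex"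
  assumes d: "d \<ge> 1" and \<zeta>: "\<zeta> \<in> torus d"
    and ext: "\<And>j. j \<in> {1..N} \<Longrightarrow> extends_C d 2 (bohr_lift d (c j))"
begin

abbreviation f0 :: "nat \<Rightarrow> complex" where
  "f0 j \<equiv> boundary_ext d (bohr_lift d (c j)) \<zeta>"
abbreviation f1 :: "nat \<Rightarrow> nat \<Rightarrow> complex" where
  "f1 j i \<equiv> boundary_ext d (complex_partial i (bohr_lift d (c j))) \<zeta>"
abbreviation f2 :: "nat \<Rightarrow> nat \<Rightarrow> nat \<Rightarrow> complex" where
  "f2 j i k \<equiv> boundary_ext d (complex_partial k (complex_partial i (bohr_lift d (c j)))) \<zeta>"

text \<open>\<open>first_term\<close> and \<open>second_term\<close> are the coefficients of \<open>\<delta>\<close> and \<open>\<delta>\<^sup>2\<close> in the expansion of the series part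
of the \<open>j\<close>-th symbol along an approach sequence of direction \<open>\<theta>\<close>.\<close>

definition first_term :: "nat \<Rightarrow> (nat \<Rightarrow> real) \<Rightarrow> complex" where
  "first_term j \<theta> = (\<Sum>i<d. f1 j i * (\<i> * \<zeta> i * of_real (\<theta> i)))"

definition second_term :: "nat \<Rightarrow> (nat \<Rightarrow> real) \<Rightarrow> complex" where
  "second_term j \<theta> = (\<Sum>i<d. f1 j i * (\<zeta> i * of_real (- log_prime i - (\<theta> i)\<^sup>2 / 2)))
    + (\<Sum>i<d. \<Sum>k<d. f2 j i k * (\<i> * \<zeta> i * of_real (\<theta> i)) * (\<i> * \<zeta> k * of_real (\<theta> k))) / 2"

definition approach :: "(nat \<Rightarrow> real) \<Rightarrow> (nat \<Rightarrow> complex) \<Rightarrow> (nat \<Rightarrow> real) \<Rightarrow> bool" where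
  "approach \<theta> s \<delta> \<longleftrightarrow> (\<forall>n. \<delta> n > 0) \<and> \<delta> \<longlonglongrightarrow> 0 \<and> (\<forall>n. Re (s n) = (\<delta> n)\<^sup>2) \<and>
    (\<forall>i<d. (\<lambda>n. (bohr_point d (s n) i - \<zeta> i - of_real (\<delta> n) * (\<i> * \<zeta> i * of_real (\<theta> i))) / of_real ((\<delta> n)\<^sup>2))
       \<longlonglongrightarrow> \<zeta> i * of_real (- log_prime i - (\<theta> i)\<^sup>2 / 2))"

lemma approach_exists:
  "\<exists>s \<delta>. approach \<theta> s \<delta> \<and> (\<lambda>n. exp (- (\<i> * of_real (Im (s n) * log_prime d)))) \<longlonglongrightarrow> cis \<beta>"
proof (rule approach_sequence[OF \<zeta>, of \<theta> \<beta>], goal_cases)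
  case (1 s \<delta>)
  thus ?case by (intro exI[of _ s] exI[of _ \<delta>]) (simp add: approach_def)
qed

definition remainder :: "(nat \<Rightarrow> real) \<Rightarrow> (nat \<Rightarrow> complex) \<Rightarrow> (nat \<Rightarrow> real) \<Rightarrow> nat \<Rightarrow> nat \<Rightarrow> complex" where
  "remainder \<theta> s \<delta> j n = (\<psi> j (s n) - f0 j - of_real (\<delta> n) * first_term j \<theta>) / of_real ((\<delta> n)\<^sup>2)"

context
  fixes \<theta> s \<delta>
  assumes ap: "approach \<theta> s \<delta>"
begin

lemma \<delta>_pos: "\<delta> n > 0" and \<delta>_lim: "\<delta> \<longlonglongrightarrow> 0" and Re_s: "Re (s n) = (\<delta> n)\<^sup>2"
  using ap by (simp_all add: approach_def)

lemma Re_s_pos: "Re (s n) > 0"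
  unfolding Re_s using \<delta>_pos[of n] by simp

lemma symbol_expansion:
  assumes j: "j \<in> {1..N}"
  shows "remainder \<theta> s \<delta> j \<longlonglongrightarrow> second_term j \<theta>"
proof -
  have b: "bohr_point d (s n) \<in> polydisc d" for n
    by (intro bohr_point_in_polydisc Re_s_pos)
  have "\<psi> j (s n) = bohr_lift d (c j) (bohr_point d (s n))" for n
    using j Re_s_pos by (intro dirichlet_series_eq_bohr_lift abs_conv_c first_primes)
  thus ?thesis
    unfolding remainder_def[abs_def] second_term_def first_term_def using ap
    boundary_C2.second_order_expansion[OF bohr_lift_boundary_C2[OF abs_conv_c[OF j] ext[OF j] \<zeta> d] b \<delta>_pos \<delta>_lim,
      where a = "\<lambda>i. \<i> * \<zeta> i * of_real (\<theta> i)" and b = "\<lambda>i. \<zeta> i * of_real (- log_prime i - (\<theta> i)\<^sup>2 / 2)"]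
    by (simp add: approach_def)
qed

lemma \<psi>_expand: "\<psi> j (s n) = f0 j + of_real (\<delta> n) * first_term j \<theta> + of_real ((\<delta> n)\<^sup>2) * remainder \<theta> s \<delta> j n"
  using \<delta>_pos[of n] by (simp add: remainder_def)

lemma \<psi>_lim:
  assumes j: "j \<in> {1..N}"
  shows "(\<lambda>n. \<psi> j (s n)) \<longlonglongrightarrow> f0 j"
proof -
  have "(\<lambda>n. f0 j + of_real (\<delta> n) * first_term j \<theta> + of_real ((\<delta> n)\<^sup>2) * remainder \<theta> s \<delta> j n) \<longlonglongrightarrow> f0 j + of_real 0 * first_term j \<theta> + of_real (0\<^sup>2) * second_term j \<theta>"
    by (intro tendsto_intros \<delta>_lim symbol_expansion[OF j])
  thus ?thesis unfolding \<psi>_expand by simp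
qed

text \<open>The real part of the series part is nonnegative, and in its expansion the constant term vanishes, so
the term of order \<open>\<delta>\<close> cannot be negative. Applied to both \<open>\<theta>\<close> and \<open>- \<theta>\<close> this gives \<open>Re_first_term_zero\<close>.\<close>

lemma Re_first_term_nonneg:
  assumes m: "m \<in> {1..N}" "Re (f0 m) = 0"
  shows "Re (first_term m \<theta>) \<ge> 0"
proof (rule LIMSEQ_le_const)
  have "(\<lambda>n. Re (first_term m \<theta>) + \<delta> n * Re (remainder \<theta> s \<delta> m n)) \<longlonglongrightarrow> Re (first_term m \<theta>) + 0 * Re (second_term m \<theta>)"
    by (intro tendsto_intros \<delta>_lim symbol_expansion m)
  thus "(\<lambda>n. Re (first_term m \<theta>) + \<delta> n * Re (remainder \<theta> s \<delta> m n)) \<longlonglongrightarrow> Re (first_term m \<theta>)" by simp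
  have "0 \<le> Re (first_term m \<theta>) + \<delta> n * Re (remainder \<theta> s \<delta> m n)" for n
  proof -
    have "0 \<le> Re (\<psi> m (s n))" using Re_\<psi>[OF m(1) Re_s_pos[of n]] by (auto split: if_splits)
    also have "Re (\<psi> m (s n)) = \<delta> n * (Re (first_term m \<theta>) + \<delta> n * Re (remainder \<theta> s \<delta> m n))"
      unfolding \<psi>_expand using m(2) by (simp add: algebra_simps power2_eq_square)
    finally show ?thesis using \<delta>_pos[of n] by (simp add: zero_le_mult_iff)
  qed
  thus "\<exists>n0. \<forall>n\<ge>n0. 0 \<le> Re (first_term m \<theta>) + \<delta> n * Re (remainder \<theta> s \<delta> m n)" by blast
qed

end

lemma Re_first_term_zero:
  assumes m: "m \<in> {1..N}" "Re (f0 m) = 0"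
  shows "Re (first_term m \<theta>) = 0"
proof -
  have "Re (first_term m \<theta>) \<ge> 0" for \<theta> using approach_exists[of \<theta> 0] Re_first_term_nonneg m by blast
  from this[of \<theta>] this[of "\<lambda>i. - \<theta> i"] show ?thesis
    by (simp add: first_term_def sum_negf)
qed

lemma Re_f0_half:
  assumes j: "j \<in> {1..N}" and c0: "c0 j = 0"
  shows "Re (f0 j) \<ge> 1/2"
proof -
  obtain s \<delta> where ap: "approach (\<lambda>_. 0) s \<delta>" using approach_exists by blast
  have "(\<lambda>n. Re (\<psi> j (s n))) \<longlonglongrightarrow> Re (f0 j)" by (intro tendsto_intros \<psi>_lim[OF ap j])
  moreover have "Re (\<psi> j (s n)) \<ge> 1/2" for n
    using Re_\<psi>[OF j Re_s_pos[OF ap, of n]] c0 by simp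
  ultimately show ?thesis by (intro LIMSEQ_le_const) auto
qed

text \<open>The \<open>m\<close>-th symbol provides the kernels. The last assumption makes the limit \<open>cis \<beta>\<close> of
\<open>p powr (- \<i> t)\<close>, for the prime \<open>p\<close> with index \<open>d\<close>, incompatible with any characteristic other than
that of the \<open>m\<close>-th symbol.\<close>

context
  fixes m \<theta> s \<delta> \<beta>
  assumes m: "m \<in> {1..N}" "Re (f0 m) = 0" "c0 m \<ge> 1"
    and ap: "approach \<theta> s \<delta>"
    and \<beta>: "(\<lambda>n. exp (- (\<i> * of_real (Im (s n) * log_prime d)))) \<longlonglongrightarrow> cis \<beta>"
    and generic_\<beta>: "\<And>j. j \<in> {1..N} \<Longrightarrow> c0 j \<noteq> c0 m \<Longrightarrow>
      cis \<beta> ^ c0 j * exp (- ((f0 j + cnj (f0 m)) * of_real (log_prime d))) \<noteq> cis \<beta> ^ c0 m"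
begin

definition kernel_arg :: "nat \<Rightarrow> nat \<Rightarrow> complex" where "kernel_arg j n = \<Psi> j (s n) + cnj (\<Psi> m (s n))"
definition growth :: real where "growth = real (c0 m) + Re (second_term m \<theta>)"
definition rate :: "nat \<Rightarrow> complex" where "rate j = of_real (2 * growth) + (second_term j \<theta> - second_term m \<theta>)"
text \<open>The symbols whose difference from the \<open>m\<close>-th one is \<open>O(\<delta>\<^sup>2)\<close> along the approach sequence.\<close>

definition comparable :: "nat \<Rightarrow> bool" where
  "comparable j \<longleftrightarrow> c0 j = c0 m \<and> f0 j = f0 m \<and> first_term j \<theta> = first_term m \<theta>"
text \<open>The \<open>D\<close>-th powers of these numbers are the limits of the normalised kernel values (\<open>term_limit\<close>);
incomparable symbols contribute nothing.\<close>

definition ratio :: "nat \<Rightarrow> complex" where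
  "ratio j = (if comparable j then of_real (2 * sqrt growth) / rate j else 0)"

lemma Re_\<psi>_m: "Re (\<psi> m (s n)) = (\<delta> n)\<^sup>2 * Re (remainder \<theta> s \<delta> m n)"
  unfolding \<psi>_expand[OF ap, of m n] using m(2) Re_first_term_zero[OF m(1,2)] by simp

lemma Re_second_term_m: "Re (second_term m \<theta>) \<ge> 0"
proof (rule LIMSEQ_le_const)
  show "(\<lambda>n. Re (remainder \<theta> s \<delta> m n)) \<longlonglongrightarrow> Re (second_term m \<theta>)"
    by (intro tendsto_intros symbol_expansion[OF ap m(1)])
  have "Re (remainder \<theta> s \<delta> m n) \<ge> 0" for n
    using Re_\<psi>[OF m(1) Re_s_pos[OF ap, of n]] m(3) Re_\<psi>_m[of n] \<delta>_pos[OF ap, of n]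
    by (simp add: zero_le_mult_iff)
  thus "\<exists>n0. \<forall>n\<ge>n0. 0 \<le> Re (remainder \<theta> s \<delta> m n)" by blast
qed

lemma growth_ge_1: "growth \<ge> 1"
  using Re_second_term_m m(3) by (simp add: growth_def)

lemma Re_\<Psi>_m_asymp: "(\<lambda>n. Re (\<Psi> m (s n)) / (\<delta> n)\<^sup>2) \<longlonglongrightarrow> growth"
proof -
  have "(\<lambda>n. real (c0 m) + Re (remainder \<theta> s \<delta> m n)) \<longlonglongrightarrow> growth"
    unfolding growth_def by (intro tendsto_intros symbol_expansion[OF ap m(1)])
  moreover have "Re (\<Psi> m (s n)) / (\<delta> n)\<^sup>2 = real (c0 m) + Re (remainder \<theta> s \<delta> m n)" for n
    using \<delta>_pos[OF ap, of n] by (simp add: symbol_map_def Re_\<psi>_m Re_s[OF ap] field_simps)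
  ultimately show ?thesis by simp
qed

lemma Re_\<Psi>_m_lim: "(\<lambda>n. Re (\<Psi> m (s n))) \<longlonglongrightarrow> 0"
proof -
  have "(\<lambda>n. Re (\<Psi> m (s n)) / (\<delta> n)\<^sup>2 * (\<delta> n)\<^sup>2) \<longlonglongrightarrow> growth * 0\<^sup>2"
    by (intro tendsto_intros Re_\<Psi>_m_asymp \<delta>_lim[OF ap])
  thus ?thesis using \<delta>_pos[OF ap] by (simp add: less_imp_neq[symmetric])
qed

lemma Re_kernel_arg: "j \<in> {1..N} \<Longrightarrow> Re (kernel_arg j n) \<ge> (real (c0 j) + real (c0 m)) * (\<delta> n)\<^sup>2"
  using Re_\<psi>[OF m(1) Re_s_pos[OF ap, of n]] Re_\<psi>[of j "s n"] Re_s_pos[OF ap, of n]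
  by (auto simp: kernel_arg_def symbol_map_def Re_s[OF ap] algebra_simps split: if_splits)

lemma Re_kernel_arg_ge: "j \<in> {1..N} \<Longrightarrow> Re (kernel_arg j n) \<ge> (\<delta> n)\<^sup>2"
proof -
  assume j: "j \<in> {1..N}"
  have "1 * (\<delta> n)\<^sup>2 \<le> (real (c0 j) + real (c0 m)) * (\<delta> n)\<^sup>2"
    using m(3) by (intro mult_right_mono) auto
  thus ?thesis using Re_kernel_arg[OF j, of n] by simp
qed

lemma kernel_arg_same_char:
  assumes "c0 j = c0 m"
  shows "kernel_arg j n = (f0 j - f0 m) + of_real (\<delta> n) * (first_term j \<theta> - first_term m \<theta>) +
    of_real ((\<delta> n)\<^sup>2) * (of_real (2 * (real (c0 m) + Re (remainder \<theta> s \<delta> m n)))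
       + (remainder \<theta> s \<delta> j n - remainder \<theta> s \<delta> m n))"
proof -
  have "kernel_arg j n = of_nat (c0 m) * (s n + cnj (s n)) + (\<psi> j (s n) - \<psi> m (s n)) + (\<psi> m (s n) + cnj (\<psi> m (s n)))"
    using assms by (simp add: kernel_arg_def symbol_map_def algebra_simps)
  also have "s n + cnj (s n) = of_real (2 * (\<delta> n)\<^sup>2)"
    by (simp add: complex_add_cnj Re_s[OF ap])
  also have "\<psi> m (s n) + cnj (\<psi> m (s n)) = of_real (2 * ((\<delta> n)\<^sup>2 * Re (remainder \<theta> s \<delta> m n)))"
    by (simp add: complex_add_cnj Re_\<psi>_m)
  also have "\<psi> j (s n) - \<psi> m (s n) = (f0 j - f0 m) + of_real (\<delta> n) * (first_term j \<theta> - first_term m \<theta>) +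
     of_real ((\<delta> n)\<^sup>2) * (remainder \<theta> s \<delta> j n - remainder \<theta> s \<delta> m n)"
    unfolding \<psi>_expand[OF ap, of _ n] by (simp add: algebra_simps)
  finally show ?thesis by (simp add: algebra_simps)
qed

lemma kernel_arg_remainder_lim:
  assumes "j \<in> {1..N}"
  shows "(\<lambda>n. of_real (2 * (real (c0 m) + Re (remainder \<theta> s \<delta> m n)))
       + (remainder \<theta> s \<delta> j n - remainder \<theta> s \<delta> m n)) \<longlonglongrightarrow> rate j"
  unfolding rate_def growth_def by (intro tendsto_intros symbol_expansion[OF ap] m(1) assms)

lemma comparable_asymp:
  assumes j: "j \<in> {1..N}" and good: "comparable j"
  shows "(\<lambda>n. kernel_arg j n / of_real ((\<delta> n)\<^sup>2)) \<longlonglongrightarrow> rate j" and "rate j \<noteq> 0"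
proof -
  have "kernel_arg j n / of_real ((\<delta> n)\<^sup>2) = of_real (2 * (real (c0 m) + Re (remainder \<theta> s \<delta> m n)))
       + (remainder \<theta> s \<delta> j n - remainder \<theta> s \<delta> m n)" for n
    using good \<delta>_pos[OF ap, of n] by (subst kernel_arg_same_char) (auto simp: comparable_def)
  thus lim: "(\<lambda>n. kernel_arg j n / of_real ((\<delta> n)\<^sup>2)) \<longlonglongrightarrow> rate j" using kernel_arg_remainder_lim[OF j] by simp
  have "1 \<le> Re (rate j)"
  proof (rule LIMSEQ_le_const)
    show "(\<lambda>n. Re (kernel_arg j n / of_real ((\<delta> n)\<^sup>2))) \<longlonglongrightarrow> Re (rate j)" by (intro tendsto_intros lim)
    have "1 \<le> Re (kernel_arg j n / of_real ((\<delta> n)\<^sup>2))" for n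
      using Re_kernel_arg_ge[OF j, of n] \<delta>_pos[OF ap, of n] by (simp add: Re_divide_of_real del: of_real_power)
    thus "\<exists>n0. \<forall>n\<ge>n0. 1 \<le> Re (kernel_arg j n / of_real ((\<delta> n)\<^sup>2))" by blast
  qed
  thus "rate j \<noteq> 0" by auto
qed

lemma null_of_separated:
  assumes lim: "(\<lambda>n. exp (- (kernel_arg j n * of_real (log_prime i)))) \<longlonglongrightarrow> l" and "l \<noteq> 1"
  shows "(\<lambda>n. of_real ((\<delta> n)\<^sup>2) / (1 - exp (- (kernel_arg j n * of_real (log_prime i))))) \<longlonglongrightarrow> 0"
proof -
  have "(\<lambda>n. of_real ((\<delta> n)\<^sup>2) / (1 - exp (- (kernel_arg j n * of_real (log_prime i))))) \<longlonglongrightarrow> of_real (0\<^sup>2) / (1 - l)"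
    using assms(2) by (intro tendsto_intros lim \<delta>_lim[OF ap]) auto
  thus ?thesis by simp
qed

text \<open>Different characteristics are separated by the prime with index \<open>d\<close>, different boundary values by one
of the first two primes, and different terms of order \<open>\<delta>\<close> by any prime.\<close>

lemma incomparable_null:
  assumes j: "j \<in> {1..N}" and bad: "\<not> comparable j"
  shows "\<exists>i\<le>d. (\<lambda>n. of_real ((\<delta> n)\<^sup>2) / (1 - exp (- (kernel_arg j n * of_real (log_prime i))))) \<longlonglongrightarrow> 0"
proof (cases "c0 j = c0 m")
  case False
  let ?L = "log_prime d"
  define E where "E = (\<lambda>n. exp (- (\<i> * of_real (Im (s n) * ?L))))"
  have E: "E \<longlonglongrightarrow> cis \<beta>" using \<beta> by (simp add: E_def)
  have "exp (- (kernel_arg j n * of_real ?L)) = exp (- of_real ((real (c0 j) + real (c0 m)) * (\<delta> n)\<^sup>2 * ?L))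
      * (E n ^ c0 j / E n ^ c0 m) * exp (- ((\<psi> j (s n) + cnj (\<psi> m (s n))) * of_real ?L))" for n
  proof -
    have sn: "s n = of_real ((\<delta> n)\<^sup>2) + \<i> * of_real (Im (s n))" "cnj (s n) = of_real ((\<delta> n)\<^sup>2) - \<i> * of_real (Im (s n))"
      by (simp_all add: complex_eq_iff Re_s[OF ap])
    have "- (kernel_arg j n * of_real ?L) = - of_real ((real (c0 j) + real (c0 m)) * (\<delta> n)\<^sup>2 * ?L)
      + (of_nat (c0 j) * (- (\<i> * of_real (Im (s n) * ?L))) - of_nat (c0 m) * (- (\<i> * of_real (Im (s n) * ?L))))
      + - ((\<psi> j (s n) + cnj (\<psi> m (s n))) * of_real ?L)"
      unfolding kernel_arg_def symbol_map_def complex_cnj_add complex_cnj_mult complex_cnj_of_nat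
      by (subst (1) sn(1), subst (1) sn(2)) (simp add: algebra_simps)
    thus ?thesis
      by (simp only: exp_add exp_diff E_def exp_of_nat_mult)
  qed
  moreover have "(\<lambda>n. exp (- of_real ((real (c0 j) + real (c0 m)) * (\<delta> n)\<^sup>2 * ?L))
      * (E n ^ c0 j / E n ^ c0 m) * exp (- ((\<psi> j (s n) + cnj (\<psi> m (s n))) * of_real ?L))) \<longlonglongrightarrow>
      exp (- of_real ((real (c0 j) + real (c0 m)) * 0\<^sup>2 * ?L))
      * (cis \<beta> ^ c0 j / cis \<beta> ^ c0 m) * exp (- ((f0 j + cnj (f0 m)) * of_real ?L))"
    by (intro tendsto_intros E \<delta>_lim[OF ap] \<psi>_lim[OF ap] j m(1)) auto
  ultimately have "(\<lambda>n. exp (- (kernel_arg j n * of_real ?L))) \<longlonglongrightarrow>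
      cis \<beta> ^ c0 j * exp (- ((f0 j + cnj (f0 m)) * of_real ?L)) / cis \<beta> ^ c0 m" by simp
  moreover have "cis \<beta> ^ c0 j * exp (- ((f0 j + cnj (f0 m)) * of_real ?L)) / cis \<beta> ^ c0 m \<noteq> 1"
    using generic_\<beta>[OF j False] by simp
  ultimately show ?thesis using null_of_separated by blast
next
  case same: True
  show ?thesis
  proof (cases "f0 j = f0 m")
    case False
    then obtain i where i: "i < 2" "exp (- ((f0 j - f0 m) * of_real (log_prime i))) \<noteq> 1"
      using two_prime_frequencies[of "f0 j - f0 m"] by auto
    have "(\<lambda>n. kernel_arg j n) \<longlonglongrightarrow> (f0 j - f0 m) + of_real 0 * (first_term j \<theta> - first_term m \<theta>) + of_real (0\<^sup>2) * rate j"
      unfolding kernel_arg_same_char[OF same]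
      by (intro tendsto_add tendsto_mult tendsto_const tendsto_of_real tendsto_power kernel_arg_remainder_lim \<delta>_lim[OF ap] j)
    hence "(\<lambda>n. kernel_arg j n) \<longlonglongrightarrow> f0 j - f0 m" by simp
    hence "(\<lambda>n. exp (- (kernel_arg j n * of_real (log_prime i)))) \<longlonglongrightarrow> exp (- ((f0 j - f0 m) * of_real (log_prime i)))"
      by (intro tendsto_intros)
    from null_of_separated[OF this i(2)] show ?thesis using i(1) d by (intro exI[of _ i]) auto
  next
    case True
    hence "first_term j \<theta> - first_term m \<theta> \<noteq> 0" using bad same by (auto simp: comparable_def)
    from euler_factor_limits(1)[OF \<delta>_pos[OF ap] \<delta>_lim[OF ap] kernel_arg_remainder_lim[OF j] ln_nth_prime_pos[of 0] _ this, of "kernel_arg j"]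
    show ?thesis using kernel_arg_same_char[OF same] True by (intro exI[of _ 0]) auto
  qed
qed

text \<open>Multiplying the numerator and the denominator by \<open>\<delta> ^ (2 * D)\<close> makes each Euler product converge. For a
comparable symbol \<open>log_product D\<close> cancels, and \<open>1 / rate j ^ D\<close> is divided by the square root of
\<open>1 / ((2 * growth) ^ D * 2 ^ D)\<close>.\<close>

lemma term_limit:
  assumes j: "j \<in> {1..N}" and D: "D > d"
  shows "(\<lambda>n. euler_product D (kernel_arg j n) /
    of_real (sqrt (euler_product D (2 * Re (\<Psi> m (s n)))) * sqrt (euler_product D (2 * Re (s n))))) \<longlonglongrightarrow> ratio j ^ D"
proof -
  let ?K = "log_product D"
  have K: "?K > 0" by (rule log_product_pos)
  note dp = \<delta>_pos[OF ap] and dl = \<delta>_lim[OF ap]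
  define p where "p = (\<lambda>n. euler_product D (2 * Re (\<Psi> m (s n))) * ((\<delta> n)\<^sup>2) ^ D)"
  define q where "q = (\<lambda>n. euler_product D (2 * Re (s n)) * ((\<delta> n)\<^sup>2) ^ D)"
  have p: "p \<longlonglongrightarrow> ?K / (2 * growth) ^ D"
  proof -
    have "(\<lambda>n. 2 * (Re (\<Psi> m (s n)) / (\<delta> n)\<^sup>2)) \<longlonglongrightarrow> 2 * growth" by (intro tendsto_intros Re_\<Psi>_m_asymp)
    thus ?thesis unfolding p_def using growth_ge_1 by (intro euler_product_asymp_real dp dl) auto
  qed
  have q: "q \<longlonglongrightarrow> ?K / 2 ^ D"
    unfolding q_def using dp by (intro euler_product_asymp_real dp dl) (auto simp: Re_s[OF ap] less_imp_neq[symmetric])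
  have num: "(\<lambda>n. euler_product D (kernel_arg j n) * of_real (((\<delta> n)\<^sup>2) ^ D)) \<longlonglongrightarrow>
      (if comparable j then of_real ?K / rate j ^ D else 0)"
  proof (cases "comparable j")
    case True
    thus ?thesis using euler_product_asymp[OF dp dl comparable_asymp[OF j True]] by simp
  next
    case False
    obtain i where "i \<le> d" "(\<lambda>n. of_real ((\<delta> n)\<^sup>2) / (1 - exp (- (kernel_arg j n * of_real (log_prime i))))) \<longlonglongrightarrow> 0"
      using incomparable_null[OF j False] by blast
    thus ?thesis using euler_product_negligible[OF dp dl Re_kernel_arg_ge[OF j], of i D] D False by simp
  qed
  have "(\<lambda>n. (euler_product D (kernel_arg j n) * of_real (((\<delta> n)\<^sup>2) ^ D)) / of_real (sqrt (p n) * sqrt (q n))) \<longlonglongrightarrow>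
      (if comparable j then of_real ?K / rate j ^ D else 0) / of_real (sqrt (?K / (2 * growth) ^ D) * sqrt (?K / 2 ^ D))"
    using K growth_ge_1 by (intro tendsto_intros num p q) auto
  moreover have "(euler_product D (kernel_arg j n) * of_real (((\<delta> n)\<^sup>2) ^ D)) / of_real (sqrt (p n) * sqrt (q n))
     = euler_product D (kernel_arg j n) / of_real (sqrt (euler_product D (2 * Re (\<Psi> m (s n)))) * sqrt (euler_product D (2 * Re (s n))))" for n
  proof -
    have "sqrt (p n) * sqrt (q n) = (sqrt (euler_product D (2 * Re (\<Psi> m (s n)))) * sqrt (euler_product D (2 * Re (s n)))) * ((\<delta> n)\<^sup>2) ^ D"
      by (simp add: p_def q_def real_sqrt_mult)
    thus ?thesis using dp[of n] by (simp del: of_real_power)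
  qed
  moreover have "(if comparable j then of_real ?K / rate j ^ D else 0) / of_real (sqrt (?K / (2 * growth) ^ D) * sqrt (?K / 2 ^ D)) = ratio j ^ D"
  proof -
    have "sqrt (?K / (2 * growth) ^ D) * sqrt (?K / 2 ^ D) = sqrt ((?K / (2 * growth) ^ D) * (?K / 2 ^ D))"
      by (rule real_sqrt_mult[symmetric])
    also have "(?K / (2 * growth) ^ D) * (?K / 2 ^ D) = (?K / (2 * sqrt growth) ^ D)\<^sup>2"
    proof -
      have "((2 * sqrt growth) ^ D)\<^sup>2 = ((2 * sqrt growth)\<^sup>2) ^ D" by (simp only: power_mult[symmetric] mult.commute)
      also have "(2 * sqrt growth)\<^sup>2 = 2 * growth * 2" using growth_ge_1 by (simp add: power_mult_distrib)
      finally have "((2 * sqrt growth) ^ D)\<^sup>2 = (2 * growth) ^ D * 2 ^ D" by (simp only: power_mult_distrib)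
      thus ?thesis by (simp add: power_divide power2_eq_square)
    qed
    also have "sqrt \<dots> = ?K / (2 * sqrt growth) ^ D" using K growth_ge_1 by simp
    finally have sq: "sqrt (?K / (2 * growth) ^ D) * sqrt (?K / 2 ^ D) = ?K / (2 * sqrt growth) ^ D" .
    show ?thesis unfolding sq ratio_def using K D by (simp add: power_divide)
  qed
  ultimately show ?thesis by simp
qed

lemma ratio_m: "ratio m = of_real (2 * sqrt growth) / of_real (2 * growth)" "ratio m \<noteq> 0"
proof -
  show *: "ratio m = of_real (2 * sqrt growth) / of_real (2 * growth)"
    by (simp add: ratio_def comparable_def rate_def)
  show "ratio m \<noteq> 0" unfolding * using growth_ge_1 by simp
qed

lemma ratio_eq_iff: "j \<in> {1..N} \<Longrightarrow> ratio j = ratio m \<longleftrightarrow> comparable j \<and> second_term j \<theta> = second_term m \<theta>"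
proof -
  assume j: "j \<in> {1..N}"
  show ?thesis
  proof (cases "comparable j")
    case True
    have "ratio j = ratio m \<longleftrightarrow> rate j = of_real (2 * growth)"
      unfolding ratio_m(1) using True comparable_asymp(2)[OF j True] growth_ge_1
      by (auto simp: ratio_def frac_eq_eq)
    thus ?thesis using True by (simp add: rate_def)
  next
    case False
    thus ?thesis using ratio_m(2) by (simp add: ratio_def)
  qed
qed

lemma class_sum_zero:
  "(\<Sum>j | j \<in> {1..N} \<and> comparable j \<and> second_term j \<theta> = second_term m \<theta>. lam j) = 0"
proof -
  have "(\<Sum>j\<in>{1..N}. lam j * ratio j ^ D) = 0" if D: "D \<ge> Suc d" for D
  proof -
    have "d \<le> D" "1 \<le> D" using D by auto
    obtain r where r: "strict_mono (r :: nat \<Rightarrow> nat)"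
      "(\<lambda>n. \<Sum>j=1..N. lam j * (euler_product D (\<Psi> j (s (r n)) + cnj (\<Psi> m (s (r n)))) /
        of_real (sqrt (euler_product D (2 * Re (\<Psi> m (s (r n))))) * sqrt (euler_product D (2 * Re (s (r n))))))) \<longlonglongrightarrow> 0"
      using kernel_combination_null[OF \<open>d \<le> D\<close> \<open>1 \<le> D\<close> m(1) Re_s_pos[OF ap] Re_\<Psi>_m_lim] by blast
    have "(\<lambda>n. \<Sum>j=1..N. lam j * (euler_product D (kernel_arg j (r n)) /
        of_real (sqrt (euler_product D (2 * Re (\<Psi> m (s (r n))))) * sqrt (euler_product D (2 * Re (s (r n)))))))
        \<longlonglongrightarrow> (\<Sum>j=1..N. lam j * ratio j ^ D)"
      using D by (intro tendsto_sum tendsto_mult tendsto_const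
          LIMSEQ_subseq_LIMSEQ[OF term_limit r(1), unfolded o_def]) auto
    thus ?thesis using LIMSEQ_unique[OF r(2)] by (simp add: kernel_arg_def)
  qed
  from equal_power_sums_class[OF _ this ratio_m(2)]
  have "(\<Sum>j | j \<in> {1..N} \<and> ratio j = ratio m. lam j) = 0" by simp
  moreover have "{j. j \<in> {1..N} \<and> ratio j = ratio m} = {j. j \<in> {1..N} \<and> comparable j \<and> second_term j \<theta> = second_term m \<theta>}"
    using ratio_eq_iff by blast
  ultimately show ?thesis by simp
qed

end

lemma f2_sym: "j \<in> {1..N} \<Longrightarrow> i < d \<Longrightarrow> k < d \<Longrightarrow> f2 j i k = f2 j k i"
  using boundary_C2.sym[OF bohr_lift_boundary_C2[OF abs_conv_c ext \<zeta> d]] by blast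

lemma same_data_iff:
  assumes "j \<in> {1..N}" "m \<in> {1..N}"
  shows "same_second_order_data d (bohr_lift d (c j)) (bohr_lift d (c m)) \<zeta> \<longleftrightarrow>
    f0 j = f0 m \<and> (\<forall>i<d. f1 j i = f1 m i) \<and> (\<forall>i<d. \<forall>k<d. f2 j i k = f2 m i k)"
proof -
  have "(\<forall>k<d. \<forall>i\<le>k. f2 j i k = f2 m i k) \<longleftrightarrow> (\<forall>i<d. \<forall>k<d. f2 j i k = f2 m i k)"
  proof safe
    fix i k assume a: "\<forall>k<d. \<forall>i\<le>k. f2 j i k = f2 m i k" and ik: "i < d" "k < d"
    show "f2 j i k = f2 m i k"
    proof (cases "i \<le> k")
      case False
      hence "f2 j k i = f2 m k i" using a ik by simp
      thus ?thesis using f2_sym[OF assms(1) ik] f2_sym[OF assms(2) ik] by simp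
    qed (use a ik in simp)
  qed auto
  thus ?thesis unfolding same_second_order_data_iff by simp
qed

text \<open>For a symbol with the boundary value of the \<open>m\<close>-th one but different second order data, the difference
is detected by the terms of order \<open>\<delta>\<close> if some first derivatives differ, and by the terms of order
\<open>\<delta>\<^sup>2\<close> otherwise. In both cases it is a nonzero form \<open>f j\<close> in the direction \<open>\<theta>\<close>, so a generic \<open>\<theta>\<close>
detects all of them at once.\<close>

lemma data_class_sum_zero:
  assumes m: "m \<in> {1..N}" "Re (f0 m) = 0" "c0 m \<ge> 1"
  shows "(\<Sum>j | j \<in> {1..N} \<and> c0 j = c0 m \<and>
    same_second_order_data d (bohr_lift d (c j)) (bohr_lift d (c m)) \<zeta>. lam j) = 0"
proof -
  let ?same = "\<lambda>j. same_second_order_data d (bohr_lift d (c j)) (bohr_lift d (c m)) \<zeta>"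
  define linear_diff where "linear_diff = (\<lambda>j. \<exists>i<d. f1 j i \<noteq> f1 m i)"
  define W where "W = {j\<in>{1..N}. f0 j = f0 m \<and> \<not> ?same j}"
  \<comment> \<open>the leading nonvanishing form of the difference between the \<open>j\<close>-th and the \<open>m\<close>-th expansion\<close>
  define f where "f = (\<lambda>j \<theta>.
     (\<Sum>i<d. (if linear_diff j then (f1 j i - f1 m i) * (\<i> * \<zeta> i) else 0) * of_real (\<theta> i))
     + (\<Sum>i<d. \<Sum>k<d. (if linear_diff j then 0 else (f2 j i k - f2 m i k) * (\<zeta> i * \<zeta> k)) * of_real (\<theta> i) * of_real (\<theta> k)))"
  have \<zeta>0: "\<zeta> i \<noteq> 0" if "i < d" for i using torus_norm[OF \<zeta> that] by auto
  have f_lin: "f j \<theta> = first_term j \<theta> - first_term m \<theta>" if "linear_diff j" for j \<theta>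
    using that by (simp add: f_def first_term_def sum_subtractf[symmetric] algebra_simps)
  have f_quad: "second_term j \<theta> - second_term m \<theta> = - f j \<theta> / 2" if "\<not> linear_diff j" for j \<theta>
  proof -
    have f1: "f1 j i = f1 m i" if "i < d" for i using that \<open>\<not> linear_diff j\<close> by (auto simp: linear_diff_def)
    have "f2 j i k * (\<i> * \<zeta> i * of_real (\<theta> i)) * (\<i> * \<zeta> k * of_real (\<theta> k))
       - f2 m i k * (\<i> * \<zeta> i * of_real (\<theta> i)) * (\<i> * \<zeta> k * of_real (\<theta> k))
       = - ((f2 j i k - f2 m i k) * (\<zeta> i * \<zeta> k) * of_real (\<theta> i) * of_real (\<theta> k))" for i k
    proof -
      have "(\<i> * \<zeta> i * of_real (\<theta> i)) * (\<i> * \<zeta> k * of_real (\<theta> k)) = - (\<zeta> i * \<zeta> k * of_real (\<theta> i) * of_real (\<theta> k))"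
        by (simp add: mult_ac)
      thus ?thesis by (simp only: mult.assoc) (simp add: algebra_simps)
    qed
    hence "(\<Sum>i<d. \<Sum>k<d. f2 j i k * (\<i> * \<zeta> i * of_real (\<theta> i)) * (\<i> * \<zeta> k * of_real (\<theta> k)))
       - (\<Sum>i<d. \<Sum>k<d. f2 m i k * (\<i> * \<zeta> i * of_real (\<theta> i)) * (\<i> * \<zeta> k * of_real (\<theta> k))) = - f j \<theta>"
      unfolding f_def using that by (simp add: sum_subtractf[symmetric] sum_negf)
    thus ?thesis unfolding second_term_def using f1 by (simp add: diff_divide_distrib[symmetric])
  qed
  have "\<exists>\<theta>. \<forall>j\<in>W. f j \<theta> \<noteq> 0"
  proof (rule avoid_quadratic_zeros)
    show "finite W" by (simp add: W_def)
    show "\<exists>a b c. \<forall>\<tau>. f j (\<lambda>i. \<theta> i + \<tau> * \<theta>' i) = a + b * of_real \<tau> + c * (of_real \<tau>)\<^sup>2" for j \<theta> \<theta>'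
      unfolding f_def by (rule quadratic_along_line)
    fix j assume j: "j \<in> W"
    show "\<exists>\<theta>. f j \<theta> \<noteq> 0"
    proof (cases "linear_diff j")
      case True
      then obtain i where i: "i < d" "f1 j i \<noteq> f1 m i" by (auto simp: linear_diff_def)
      have "\<exists>\<theta> :: nat \<Rightarrow> real. (\<Sum>k<d. ((f1 j k - f1 m k) * (\<i> * \<zeta> k)) * of_real (\<theta> k)) \<noteq> 0"
        using i \<zeta>0 by (intro linear_form_nonzero[of i]) auto
      thus ?thesis using True by (simp add: f_def)
    next
      case False
      then obtain i k where ik: "i < d" "k < d" "f2 j i k \<noteq> f2 m i k"
        using j m(1) same_data_iff[of j m] by (auto simp: W_def linear_diff_def)
      have "\<exists>\<theta> :: nat \<Rightarrow> real. (\<Sum>i<d. \<Sum>k<d. ((f2 j i k - f2 m i k) * (\<zeta> i * \<zeta> k)) * of_real (\<theta> i) * of_real (\<theta> k)) \<noteq> 0"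
      proof (rule quadratic_form_nonzero[OF _ ik(1,2)])
        show "(f2 j i k - f2 m i k) * (\<zeta> i * \<zeta> k) = (f2 j k i - f2 m k i) * (\<zeta> k * \<zeta> i)" if "i < d" "k < d" for i k
          using f2_sym[of j i k] f2_sym[of m i k] j m(1) that by (simp add: W_def mult.commute)
      qed (use ik \<zeta>0 in auto)
      thus ?thesis using False by (simp add: f_def)
    qed
  qed
  then obtain \<theta> where \<theta>: "\<And>j. j \<in> W \<Longrightarrow> f j \<theta> \<noteq> 0" by blast
  \<comment> \<open>the limits of \<open>p powr (- \<i> t)\<close> that fail to separate another characteristic from the \<open>m\<close>-th one\<close>
  define bad where "bad = (\<Union>j\<in>{j\<in>{1..N}. c0 j \<noteq> c0 m}.
     {\<eta>. \<eta> ^ c0 j * exp (- ((f0 j + cnj (f0 m)) * of_real (log_prime d))) = \<eta> ^ c0 m})"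
  have "finite bad" unfolding bad_def by (rule finite_UN_I) (auto intro: finite_power_relation)
  hence "\<not> range cis \<subseteq> bad" using infinite_unit_circle finite_subset by blast
  then obtain \<beta> where \<beta>: "cis \<beta> \<notin> bad" by blast
  obtain s \<delta> where ap: "approach \<theta> s \<delta>"
    "(\<lambda>n. exp (- (\<i> * of_real (Im (s n) * log_prime d)))) \<longlonglongrightarrow> cis \<beta>"
    using approach_exists[of \<theta> \<beta>] by blast
  have gen: "cis \<beta> ^ c0 j * exp (- ((f0 j + cnj (f0 m)) * of_real (log_prime d))) \<noteq> cis \<beta> ^ c0 m"
    if "j \<in> {1..N}" "c0 j \<noteq> c0 m" for j using \<beta> that by (auto simp: bad_def)
  have zero: "(\<Sum>j | j \<in> {1..N} \<and> comparable m \<theta> j \<and> second_term j \<theta> = second_term m \<theta>. lam j) = 0"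
    by (rule class_sum_zero[OF m ap]) (rule gen)
  have comparable: "comparable m \<theta> j \<longleftrightarrow> c0 j = c0 m \<and> f0 j = f0 m \<and> first_term j \<theta> = first_term m \<theta>" for j
    by (rule comparable_def[OF m ap]) (rule gen)
  have "c0 j = c0 m \<and> ?same j \<longleftrightarrow> c0 j = c0 m \<and> f0 j = f0 m \<and> first_term j \<theta> = first_term m \<theta> \<and> second_term j \<theta> = second_term m \<theta>"
    if j: "j \<in> {1..N}" for j
  proof
    assume "c0 j = c0 m \<and> ?same j"
    thus "c0 j = c0 m \<and> f0 j = f0 m \<and> first_term j \<theta> = first_term m \<theta> \<and> second_term j \<theta> = second_term m \<theta>"
      using same_data_iff[OF j m(1)] by (simp add: first_term_def second_term_def)
  next
    assume a: "c0 j = c0 m \<and> f0 j = f0 m \<and> first_term j \<theta> = first_term m \<theta> \<and> second_term j \<theta> = second_term m \<theta>"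
    hence "f j \<theta> = 0" using f_lin[of j \<theta>] f_quad[of j \<theta>] by (cases "linear_diff j") auto
    hence "j \<notin> W" using \<theta> by blast
    thus "c0 j = c0 m \<and> ?same j" using a j by (simp add: W_def)
  qed
  hence "{j. j \<in> {1..N} \<and> c0 j = c0 m \<and> ?same j}
     = {j. j \<in> {1..N} \<and> (c0 j = c0 m \<and> f0 j = f0 m \<and> first_term j \<theta> = first_term m \<theta>) \<and> second_term j \<theta> = second_term m \<theta>}" by blast
  thus ?thesis using zero unfolding comparable by simp
qed

text \<open>A symbol with the boundary value of the first one has positive characteristic, since the series part
of a symbol of characteristic \<open>0\<close> has real part at least \<open>1/2\<close>. It may thus be used in place of the
first symbol, which gives the relation for each value of the characteristic separately.\<close>

lemma same_data_sum_zero: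
  assumes N: "N \<ge> 1" and "c0 1 > 0" and "Re (f0 1) = 0"
  shows "(\<Sum>j | j \<in> {1..N} \<and> same_second_order_data d (bohr_lift d (c j)) (bohr_lift d (c 1)) \<zeta>. lam j) = 0"
proof -
  define J where "J = {j. j \<in> {1..N} \<and> same_second_order_data d (bohr_lift d (c j)) (bohr_lift d (c 1)) \<zeta>}"
  have fin: "finite J" by (simp add: J_def)
  have cls: "(\<Sum>j\<in>{j\<in>J. c0 j = v}. lam j) = 0" if v: "v \<in> c0 ` J" for v
  proof -
    obtain m where m: "m \<in> J" "v = c0 m" using v by blast
    have mN: "m \<in> {1..N}" and dat: "same_second_order_data d (bohr_lift d (c m)) (bohr_lift d (c 1)) \<zeta>"
      using m by (auto simp: J_def)
    have "f0 m = f0 1" using dat by (simp add: same_second_order_data_iff)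
    hence R: "Re (f0 m) = 0" using assms by simp
    have "c0 m \<noteq> 0" using Re_f0_half[OF mN] R by auto
    hence "(\<Sum>j | j \<in> {1..N} \<and> c0 j = c0 m \<and> same_second_order_data d (bohr_lift d (c j)) (bohr_lift d (c m)) \<zeta>. lam j) = 0"
      by (intro data_class_sum_zero mN R) simp
    moreover have "{j. j \<in> {1..N} \<and> c0 j = c0 m \<and> same_second_order_data d (bohr_lift d (c j)) (bohr_lift d (c m)) \<zeta>} = {j\<in>J. c0 j = v}"
      using dat m(2) by (auto simp: J_def same_second_order_data_def)
    ultimately show ?thesis by simp
  qed
  have "(\<Sum>j\<in>J. lam j) = (\<Sum>v\<in>c0 ` J. \<Sum>j\<in>{j\<in>J. c0 j = v}. lam j)"
    by (rule sum.image_gen[OF fin])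
  also have "\<dots> = 0" using cls by (intro sum.neutral) blast
  finally show ?thesis by (simp add: J_def)
qed

end

theorem theorem4p4:
  fixes d N :: nat
    and \<phi> :: "nat \<Rightarrow> complex \<Rightarrow> complex"
    and c0 :: "nat \<Rightarrow> nat"
    and c :: "nat \<Rightarrow> nat \<Rightarrow> complex"
    and lam :: "nat \<Rightarrow> complex"
    and z :: "nat \<Rightarrow> complex"
  assumes "d \<ge> 1" and "N \<ge> 1"
    and "\<And>j. j \<in> {1..N} \<Longrightarrow> gordon_hedenmalm (\<phi> j) (c0 j) (c j)"
    and "\<And>j. j \<in> {1..N} \<Longrightarrow> involves_first_primes d (c j)"
    and "\<And>j. j \<in> {1..N} \<Longrightarrow> extends_C d 2 (bohr_lift d (c j))"
    and "c0 1 > 0"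
    and "compact_on_hilbert_dirichlet (\<lambda>f s. \<Sum>j=1..N. lam j * composition (\<phi> j) f s)"
    and "z \<in> boundary_zero_set d (bohr_lift d (c 1))"
  shows "(\<Sum>j | j \<in> {1..N} \<and>
    same_second_order_data d (bohr_lift d (c j)) (bohr_lift d (c 1)) z. lam j) = 0"
proof -
  obtain T where T: "\<And>f s. s \<in> right_half_plane (1/2) \<Longrightarrow>
      hd_eval (T f) s = (\<Sum>j=1..N. lam j * composition (\<phi> j) f s)" "compact_operator T"
    using assms(7) unfolding compact_on_hilbert_dirichlet_def by blast
  have z: "z \<in> torus d" "Re (boundary_ext d (bohr_lift d (c 1)) z) = 0"
    using assms(8) by (simp_all add: boundary_zero_set_def)
  interpret boundary_combination d N \<phi> c0 c lam T z
    using assms(1,3-5) T z by unfold_locales (simp_all add: right_half_plane_def composition_def)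
  show ?thesis by (rule same_data_sum_zero) (use assms z in auto)
qed

end
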